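(* Let $\alpha_k=\beta_k\sqrt{P_k}$ for $k\in\mathcal{K}$ and $\alpha_m=\beta_m\sqrt{P_m}$ for $m\in\mathcal{M}$. The mean square error $\mathrm{MSE}=\mathbb{E}[\|\hat{\mathbf{g}}_t-\mathbf{g}_t\|^2]$ equals, under Scheme I, $$\mathrm{MSE}_1=\frac{8(K+1)-\pi^2}{\pi^2NK^2}\sum_{k\in\mathcal{K}}\mathbb{E}[\|\mathbf{g}_{t,k}\|^2]+\frac{8-\pi^2}{\pi^2NK^2}\sum_{k\in\mathcal{K}}\sum_{k'\in\mathcal{K},\,k'\ne k}\mathbb{E}[\mathbf{g}_{t,k}^T\mathbf{g}_{t,k'}]+\sum_{m\in\mathcal{M}}\frac{8G^2\alpha_m^2}{\pi^2NK\min_{k\in\mathcal{K}}\alpha_k^2}+\frac{8G^2\sigma^2D}{\pi^2N^2K\min_{k\in\mathcal{K}}\alpha_k^2},$$ and, under Scheme II, $$\mathrm{MSE}_2=\sum_{k\in\mathcal{K}}\frac{8\left(\frac{\sum_{i\in\mathcal{K}}\alpha_i^{-2}}{\alpha_k^{-2}}+1\right)-\pi^2}{\pi^2NK^2}\mathbb{E}[\|\mathbf{g}_{t,k}\|^2]+\frac{8-\pi^2}{\pi^2NK^2}\sum_{k\in\mathcal{K}}\sum_{k'\in\mathcal{K},\,k'\ne k}\mathbb{E}[\mathbf{g}_{t,k}^T\mathbf{g}_{t,k'}]+\sum_{m\in\mathcal{M}}\frac{8G^2\sum_{i\in\mathcal{K}}\alpha_i^{-2}}{\pi^2NK^2\a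lpha_m^{-2}}+\frac{8G^2\sigma^2D\sum_{i\in\mathcal{K}}\alpha_i^{-2}}{\pi^2N^2K^2}.$$
   Context: Let $K,N,M,D\ge 1$ be integers, $\mathcal{K}=\{1,\dots,K\}$ (target devices) and $\mathcal{M}=\{K+1,\dots,K+M\}$ (interferers). The random vectors $\mathbf{h}_p$ and $\mathbf{h}_{r,i}$, $i\in\mathcal{K}\cup\mathcal{M}$, with entries $h_{p,n}$, $h_{r,i,n}$, are mutually independent, each distributed as $\mathcal{CN}(\mathbf{0},\mathbf{I}_N)$ (i.i.d. circularly symmetric complex Gaussian entries of mean $0$ and variance $\mathbb{E}|\cdot|^2=1$). The noise is $\mathbf{z}_t\sim\mathcal{CN}(\mathbf{0},\sigma^2\mathbf{I}_D)$. Deterministic constants: $\beta_i>0$ (large-scale fading) and $P_i>0$ (maximum transmit powers) for $i\in\mathcal{K}\cup\mathcal{M}$, and $G>0$. The (random) local gradients $\mathbf{g}_{t,k}\in\mathbb{R}^D$ satisfy $\|\mathbf{g}_{t,k}\|\le G$; the interference signals $\tilde{\mathbf{g}}_{t,m}\in\mathbb{R}^D$ are arbitrary (possibly random) with $\|\tilde{\mathbf{g}}_{t,m}\|=1$. The channels, the noise, and the collection of all gradients and interference signals are independent of each other. Every interferer transmits at maximum power: $p_m=P_m$ for $m\in\mathcal{M}$. The reflecting matrix is $\mathbf{\Theta}=\mathrm{diag}\{e^{j\theta_1},\dots,e^{j\theta_N}\}$, $j=\sqrt{-1}$ (phases modulo $2\pi$); $\angle$ is the argument, $^\ast$ conjugation,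 $^H$ conjugate transpose, $\Re$ the real part. For $i\in\mathcal{K}\cup\mathcal{M}$, $\ell_i=\frac{\beta_i\sqrt{p_i}}{\lambda}\Re\{\mathbf{h}_p^H\mathbf{\Theta}\mathbf{h}_{r,i}\}$. The true global gradient is $\mathbf{g}_t=\frac1K\sum_{k\in\mathcal{K}}\mathbf{g}_{t,k}$ and its estimate is $$\hat{\mathbf{g}}_t=\sum_{k\in\mathcal{K}}\ell_k\mathbf{g}_{t,k}+\sum_{m\in\mathcal{M}}\ell_m\tilde{\mathbf{g}}_{t,m}+\frac{\Re\{\mathbf{z}_t\}}{\lambda}.$$ The expectation in the MSE is over channels, gradients, interference signals and noise. Scheme I: $\sqrt{p_k}=\beta_k^{-1}\frac{\min_{i\in\mathcal{K}}\sqrt{P_i}\beta_i}{G}$ for $k\in\mathcal{K}$, $\lambda=\frac{\pi N\sqrt K\min_{k\in\mathcal{K}}\sqrt{P_k}\beta_k}{4G}$, and $\theta_n=-\angle h_{p,n}^\ast+\angle\sum_{k=1}^K h_{r,k,n}^\ast$ for $n=1,\dots,N$. Scheme II: $\sqrt{p_k}=\frac{\sqrt{P_k}}{G}$ and $w_k=\frac{1}{\beta_k\sqrt{P_k}}$ for $k\in\mathcal{K}$, $\lambda=\frac{\pi NK}{4G\sqrt{\sum_{k=1}^Kw_k^2}}$, and $\theta_n=-\angle h_{p,n}^\ast+\angle\sum_{k=1}^K w_k h_{r,k,n}^\ast$ for $n=1,\dots,N$. *)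

theory Defs
  imports "HOL-Probability.Probability"
begin

section \<open>Complex Gaussian vectors and mutual independence\<close>

text \<open>\<open>complex_normal v\<close> is \<open>CN(0, v)\<close>, with \<open>v = E|X|^2\<close>: real and imaginary part are independent
  centred Gaussians of variance \<open>v/2\<close> each.  It is given as an image of the standard Gaussian on the
  plane, so that \<open>v = 0\<close> (point mass at 0) is included.\<close>

definition complex_normal :: "real \<Rightarrow> complex measure" where
  "complex_normal v =
     distr (std_normal_distribution \<Otimes>\<^sub>M std_normal_distribution) borel
       (\<lambda>(x, y). Complex (sqrt (v / 2) * x) (sqrt (v / 2) * y))"

text \<open>\<open>X\<close> is distributed as \<open>CN(0, v I)\<close>: i.i.d. entries with law \<open>CN(0, v)\<close>.\<close>

definition complex_normal_vector ::
  "'a measure \<Rightarrow> real \<Rightarrow> ('a \<Rightarrow> complex ^ 'n) \<Rightarrow> bool" where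
  "complex_normal_vector \<Omega> v X \<longleftrightarrow>
     X \<in> borel_measurable \<Omega> \<and>
     prob_space.indep_vars \<Omega> (\<lambda>_. borel) (\<lambda>n \<omega>. X \<omega> $ n) UNIV \<and>
     (\<forall>n. distr \<Omega> borel (\<lambda>\<omega>. X \<omega> $ n) = complex_normal v)"

text \<open>Mutual independence of three random elements with values in possibly different types; the
  library's \<open>indep_vars\<close> requires a common value type, and this is its definition written out for
  three variables.\<close>

datatype source = Channels | Noise | Signals

definition indep_triple ::
  "'a measure \<Rightarrow> 'b measure \<Rightarrow> ('a \<Rightarrow> 'b) \<Rightarrow> 'c measure \<Rightarrow> ('a \<Rightarrow> 'c) \<Rightarrow> 'd measure \<Rightarrow> ('a \<Rightarrow> 'd) \<Rightarrow> bool"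
where
  "indep_triple \<Omega> S X T Y U Z \<longleftrightarrow>
     X \<in> measurable \<Omega> S \<and> Y \<in> measurable \<Omega> T \<and> Z \<in> measurable \<Omega> U \<and>
     prob_space.indep_sets \<Omega>
       (\<lambda>s. case s of
          Channels \<Rightarrow> {X -` A \<inter> space \<Omega> | A. A \<in> sets S}
        | Noise \<Rightarrow> {Y -` A \<inter> space \<Omega> | A. A \<in> sets T}
        | Signals \<Rightarrow> {Z -` A \<inter> space \<Omega> | A. A \<in> sets U}) UNIV"


section \<open>Over-the-air aggregation through a reflecting surface\<close>

abbreviation targets :: "nat \<Rightarrow> nat set" where
  "targets K \<equiv> {1..K}"

abbreviation interferers :: "nat \<Rightarrow> nat \<Rightarrow> nat set" where
  "interferers K M \<equiv> {K+1..K+M}"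

abbreviation devices :: "nat \<Rightarrow> nat \<Rightarrow> nat set" where
  "devices K M \<equiv> {1..K+M}"

definition reflecting_matrix :: "real ^ 'n \<Rightarrow> complex ^ 'n ^ 'n" where
  "reflecting_matrix \<theta> = (\<chi> i j. if i = j then cis (\<theta> $ i) else 0)"

text \<open>\<open>hdot x y = x\<^sup>H y\<close>.  (The library's inner product on \<^typ>\<open>complex ^ 'n\<close> is its real part.)\<close>

definition hdot :: "complex ^ 'n \<Rightarrow> complex ^ 'n \<Rightarrow> complex" where
  "hdot x y = (\<Sum>n\<in>UNIV. cnj (x $ n) * y $ n)"

definition gain ::
  "(nat \<Rightarrow> real) \<Rightarrow> (nat \<Rightarrow> real) \<Rightarrow> real \<Rightarrow> real ^ 'n \<Rightarrow> complex ^ 'n \<Rightarrow> (nat \<Rightarrow> complex ^ 'n) \<Rightarrow> nat \<Rightarrow> real"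
where
  "gain \<beta> p lam \<theta> hp hr i =
     \<beta> i * sqrt (p i) / lam * Re (hdot hp (reflecting_matrix \<theta> *v hr i))"

definition global_gradient :: "nat \<Rightarrow> (nat \<Rightarrow> real ^ 'd) \<Rightarrow> real ^ 'd" where
  "global_gradient K g = (1 / real K) *\<^sub>R (\<Sum>k\<in>targets K. g k)"

definition gradient_estimate ::
  "nat \<Rightarrow> nat \<Rightarrow> real \<Rightarrow> (nat \<Rightarrow> real) \<Rightarrow> (nat \<Rightarrow> real ^ 'd) \<Rightarrow> (nat \<Rightarrow> real ^ 'd) \<Rightarrow> complex ^ 'd \<Rightarrow> real ^ 'd"
where
  "gradient_estimate K M lam l g gi z =
     (\<Sum>k\<in>targets K. l k *\<^sub>R g k) + (\<Sum>m\<in>interferers K M. l m *\<^sub>R gi m)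
       + (1 / lam) *\<^sub>R (\<chi> d. Re (z $ d))"

text \<open>The phases are a function \<open>phase\<close> of the realized channels.\<close>

definition squared_error ::
  "nat \<Rightarrow> nat \<Rightarrow> (nat \<Rightarrow> real) \<Rightarrow> (nat \<Rightarrow> real) \<Rightarrow> real
    \<Rightarrow> (complex ^ 'n \<Rightarrow> (nat \<Rightarrow> complex ^ 'n) \<Rightarrow> real ^ 'n)
    \<Rightarrow> ('a \<Rightarrow> complex ^ 'n) \<Rightarrow> (nat \<Rightarrow> 'a \<Rightarrow> complex ^ 'n)
    \<Rightarrow> (nat \<Rightarrow> 'a \<Rightarrow> real ^ 'd) \<Rightarrow> (nat \<Rightarrow> 'a \<Rightarrow> real ^ 'd) \<Rightarrow> ('a \<Rightarrow> complex ^ 'd) \<Rightarrow> 'a \<Rightarrow> real"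
where
  "squared_error K M \<beta> p lam phase hp hr g gi z \<omega> =
     (let \<theta> = phase (hp \<omega>) (\<lambda>i. hr i \<omega>);
          l = gain \<beta> p lam \<theta> (hp \<omega>) (\<lambda>i. hr i \<omega>)
      in (norm (gradient_estimate K M lam l (\<lambda>k. g k \<omega>) (\<lambda>m. gi m \<omega>) (z \<omega>)
                 - global_gradient K (\<lambda>k. g k \<omega>)))\<^sup>2)"

definition MSE ::
  "'a measure \<Rightarrow> nat \<Rightarrow> nat \<Rightarrow> (nat \<Rightarrow> real) \<Rightarrow> (nat \<Rightarrow> real) \<Rightarrow> real
    \<Rightarrow> (complex ^ 'n \<Rightarrow> (nat \<Rightarrow> complex ^ 'n) \<Rightarrow> real ^ 'n)
    \<Rightarrow> ('a \<Rightarrow> complex ^ 'n) \<Rightarrow> (nat \<Rightarrow> 'a \<Rightarrow> complex ^ 'n)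
    \<Rightarrow> (nat \<Rightarrow> 'a \<Rightarrow> real ^ 'd) \<Rightarrow> (nat \<Rightarrow> 'a \<Rightarrow> real ^ 'd) \<Rightarrow> ('a \<Rightarrow> complex ^ 'd) \<Rightarrow> real"
where
  "MSE \<Omega> K M \<beta> p lam phase hp hr g gi z =
     (\<integral>\<omega>. squared_error K M \<beta> p lam phase hp hr g gi z \<omega> \<partial>\<Omega>)"


section \<open>The two transmission schemes\<close>

text \<open>The schemes prescribe the (positive) amplitude \<open>sqrt (p k)\<close> of a target device, so its power
  is the square of that; interferers transmit at maximum power.\<close>

definition power_I :: "nat \<Rightarrow> (nat \<Rightarrow> real) \<Rightarrow> (nat \<Rightarrow> real) \<Rightarrow> real \<Rightarrow> nat \<Rightarrow> real" where
  "power_I K \<beta> P G i =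
     (if i \<in> targets K
      then (inverse (\<beta> i) * ((MIN k\<in>targets K. sqrt (P k) * \<beta> k) / G))\<^sup>2
      else P i)"

definition lambda_I :: "nat \<Rightarrow> nat \<Rightarrow> (nat \<Rightarrow> real) \<Rightarrow> (nat \<Rightarrow> real) \<Rightarrow> real \<Rightarrow> real" where
  "lambda_I N K \<beta> P G =
     pi * real N * sqrt (real K) * (MIN k\<in>targets K. sqrt (P k) * \<beta> k) / (4 * G)"

definition phase_I :: "nat \<Rightarrow> complex ^ 'n \<Rightarrow> (nat \<Rightarrow> complex ^ 'n) \<Rightarrow> real ^ 'n" where
  "phase_I K hp hr =
     (\<chi> n. - Arg (cnj (hp $ n)) + Arg (\<Sum>k\<in>targets K. cnj (hr k $ n)))"

definition power_II :: "nat \<Rightarrow> (nat \<Rightarrow> real) \<Rightarrow> real \<Rightarrow> nat \<Rightarrow> real" where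
  "power_II K P G i = (if i \<in> targets K then (sqrt (P i) / G)\<^sup>2 else P i)"

definition weight_II :: "(nat \<Rightarrow> real) \<Rightarrow> (nat \<Rightarrow> real) \<Rightarrow> nat \<Rightarrow> real" where
  "weight_II \<beta> P k = 1 / (\<beta> k * sqrt (P k))"

definition lambda_II :: "nat \<Rightarrow> nat \<Rightarrow> (nat \<Rightarrow> real) \<Rightarrow> (nat \<Rightarrow> real) \<Rightarrow> real \<Rightarrow> real" where
  "lambda_II N K \<beta> P G =
     pi * real N * real K / (4 * G * sqrt (\<Sum>k\<in>targets K. (weight_II \<beta> P k)\<^sup>2))"

definition phase_II ::
  "nat \<Rightarrow> (nat \<Rightarrow> real) \<Rightarrow> (nat \<Rightarrow> real) \<Rightarrow> complex ^ 'n \<Rightarrow> (nat \<Rightarrow> complex ^ 'n) \<Rightarrow> real ^ 'n"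
where
  "phase_II K \<beta> P hp hr =
     (\<chi> n. - Arg (cnj (hp $ n))
           + Arg (\<Sum>k\<in>targets K. complex_of_real (weight_II \<beta> P k) * cnj (hr k $ n)))"

end

theory Submission
  imports Defs
begin

text \<open>Aligning the phases with \<open>s\<^sub>n = \<Sum>k. w\<^sub>k h\<^bsub>r,k,n\<^esub>\<close> turns the cascaded channel of device \<open>i\<close> into
  \<open>T\<^sub>i = \<Sum>n. \<bar>h\<^bsub>p,n\<^esub>\<bar> Re (V\<^sub>n h\<^bsub>r,i,n\<^esub>)\<close>, where \<open>V\<^sub>n\<close> is the unit phasor conjugate to \<open>s\<^sub>n\<close>.
  Put \<open>W\<^sup>2 = \<Sum>k. w\<^sub>k\<^sup>2\<close>, with \<open>w\<^sub>m = 0\<close> for interferers.  Rotation invariance of the complex Gaussian law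
  splits \<open>h\<^bsub>r,i,n\<^esub>\<close> into \<open>(w\<^sub>i / W\<^sup>2) s\<^sub>n\<close> and an independent circular remainder, so \<open>Re (V\<^sub>n h\<^bsub>r,i,n\<^esub>)\<close> has mean
  \<open>(w\<^sub>i / W) (sqrt pi / 2)\<close> and mixed second moments \<open>(\<delta>\<^sub>i\<^sub>j + w\<^sub>i w\<^sub>j / W\<^sup>2) / 2\<close>.  Summing over the independent
  elements \<open>n\<close> gives the first two moments of the \<open>T\<^sub>i\<close>.  In both schemes the resulting gain of every target
  has mean \<open>1 / K\<close>, and independence of channels, signals and noise reduces the error to these moments.\<close>

section \<open>Rotations of the Gaussian plane\<close>

text \<open>The obstacle is that the phasor \<open>V\<^sub>n\<close> depends on every target channel
  at once, so the aligned entries of different devices are dependent. No conditional expectation is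
  taken: real rotations of pairs of independent complex Gaussians are applied to integrals of
  \<open>F(s) h\<close> and \<open>F(s) h h'\<close> with a general bounded \<open>F\<close>, and
  circularity, that is \<open>E z = 0\<close> and \<open>E z^2 = 0\<close>, deletes the remainder.
  The constants come from \<open>E |z| = sqrt pi / 2\<close> for a unit complex Gaussian. It enters
  once through the entry of \<open>hp\<close> and once through the aligned entry, so each element
  has mean \<open>(pi / 4) (w_i / W)\<close>; this is the \<open>pi N / 4\<close> inside
  \<open>lambda\<close>. The squared mean has coefficient \<open>pi^2 / 16\<close>, the second
  moment on a single element has \<open>1 / 2\<close>, and the difference
  \<open>(8 - pi^2) / 16\<close> is the numerator common to both errors. With
  \<open>a_i = \<beta>_i sqrt p_i / \<lambda>\<close>, the \<delta> part of the second moments adds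
  \<open>N a_i^2 / 2\<close> per device, which is the only contribution of an interferer.\<close>

lemma nn_integral_lborel_rotation:
  fixes c s :: real and h :: "real \<times> real \<Rightarrow> ennreal"
  assumes cs: "c\<^sup>2 + s\<^sup>2 = 1" and [measurable]: "h \<in> borel_measurable (borel \<Otimes>\<^sub>M borel)"
  shows "(\<integral>\<^sup>+x. \<integral>\<^sup>+y. h (c * x + s * y, c * y - s * x) \<partial>lborel \<partial>lborel) = (\<integral>\<^sup>+x. \<integral>\<^sup>+y. h (x, y) \<partial>lborel \<partial>lborel)"
proof (cases "c = 0")
  \<comment> \<open>The substitutions of the other case divide by \<open>c\<close>. Here the
    rotation is a swap of coordinates with a sign, so scaling the variables by \<open>s\<close> and
    \<open>- s\<close> and exchanging the integrals suffices.\<close>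
  case True
  with cs have s: "s \<noteq> 0" "\<bar>s\<bar> = 1" by (auto simp: power2_eq_1_iff)
  have "(\<integral>\<^sup>+x. \<integral>\<^sup>+y. h (x, y) \<partial>lborel \<partial>lborel) = (\<integral>\<^sup>+x. \<integral>\<^sup>+y. h (s * x, y) \<partial>lborel \<partial>lborel)"
    using s by (subst nn_integral_real_affine[where c=s and t=0]) auto
  also have "\<dots> = (\<integral>\<^sup>+y. \<integral>\<^sup>+x. h (s * x, y) \<partial>lborel \<partial>lborel)"
    by (intro lborel_pair.Fubini') simp
  also have "\<dots> = (\<integral>\<^sup>+y. \<integral>\<^sup>+x. h (s * x, - s * y) \<partial>lborel \<partial>lborel)"
    using s by (subst nn_integral_real_affine[where c="-s" and t=0]) auto
  finally show ?thesis using True by simp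
next
  case False
  \<comment> \<open>For \<open>c \<noteq> 0\<close> the rotation is composed of two one-dimensional
    affine substitutions: \<open>u = c x + s y\<close> with \<open>y\<close> fixed, and later
    \<open>y = s u + c v\<close> with \<open>u\<close> fixed. They put a factor \<open>|c|\<close>
    on opposite sides of the identity, and the two cancel at the end.\<close>
  have inner: "(\<integral>\<^sup>+u. h (u, y / c - s * u / c) \<partial>lborel)
     = ennreal \<bar>c\<bar> * (\<integral>\<^sup>+x. h (c * x + s * y, c * y - s * x) \<partial>lborel)" for y
  proof -
    have "y / c - s * (s * y + c * x) / c = c * y - s * x" for x
    proof -
      have "y / c - s * (s * y + c * x) / c = (y * (1 - s\<^sup>2) - s * c * x) / c"
        using False by (simp add: field_simps power2_eq_square)
      also have "1 - s\<^sup>2 = c\<^sup>2" using cs by simp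
      finally show ?thesis using False by (simp add: field_simps power2_eq_square)
    qed
    then show ?thesis
      using False by (subst nn_integral_real_affine[where c=c and t="s * y"]) (auto simp: add.commute)
  qed
  have "ennreal \<bar>c\<bar> * (\<integral>\<^sup>+x. \<integral>\<^sup>+y. h (c * x + s * y, c * y - s * x) \<partial>lborel \<partial>lborel)
    = (\<integral>\<^sup>+y. ennreal \<bar>c\<bar> * (\<integral>\<^sup>+x. h (c * x + s * y, c * y - s * x) \<partial>lborel) \<partial>lborel)"
    by (subst lborel_pair.Fubini') (auto simp: nn_integral_cmult)
  also have "\<dots> = (\<integral>\<^sup>+y. \<integral>\<^sup>+u. h (u, y / c - s * u / c) \<partial>lborel \<partial>lborel)"
    by (simp add: inner)
  also have "\<dots> = (\<integral>\<^sup>+u. \<integral>\<^sup>+y. h (u, y / c - s * u / c) \<partial>lborel \<partial>lborel)"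
    by (intro lborel_pair.Fubini') simp
  also have "\<dots> = (\<integral>\<^sup>+u. ennreal \<bar>c\<bar> * (\<integral>\<^sup>+v. h (u, v) \<partial>lborel) \<partial>lborel)"
  proof (rule nn_integral_cong)
    fix u
    have "(s * u + c * v) / c - s * u / c = v" for v
      using False by (simp add: field_simps)
    then show "(\<integral>\<^sup>+y. h (u, y / c - s * u / c) \<partial>lborel) = ennreal \<bar>c\<bar> * (\<integral>\<^sup>+v. h (u, v) \<partial>lborel)"
      using False by (subst nn_integral_real_affine[where c=c and t="s * u"]) auto
  qed
  also have "\<dots> = ennreal \<bar>c\<bar> * (\<integral>\<^sup>+u. \<integral>\<^sup>+v. h (u, v) \<partial>lborel \<partial>lborel)"
    by (simp add: nn_integral_cmult)
  finally show ?thesis using False by (auto simp: ennreal_mult_cancel_left)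
qed

text \<open>The density of a standard normal pair is a function of \<open>x^2 + y^2\<close>, hence
  invariant, and Lebesgue measure is invariant as well. Iterated nonnegative integrals are used so
  that the identity can be applied inside further integrals without integrability
  conditions.\<close>

lemma nn_integral_std_normal_rotation:
  fixes c s :: real and h :: "real \<times> real \<Rightarrow> ennreal"
  assumes cs: "c\<^sup>2 + s\<^sup>2 = 1" and [measurable]: "h \<in> borel_measurable (borel \<Otimes>\<^sub>M borel)"
  shows "(\<integral>\<^sup>+x. \<integral>\<^sup>+y. h (c * x + s * y, c * y - s * x) \<partial>std_normal_distribution \<partial>std_normal_distribution)
    = (\<integral>\<^sup>+x. \<integral>\<^sup>+y. h (x, y) \<partial>std_normal_distribution \<partial>std_normal_distribution)"
proof -
  define \<phi> where "\<phi> = (\<lambda>(x::real, y::real). ennreal (std_normal_density x * std_normal_density y))"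
  have [measurable]: "\<phi> \<in> borel_measurable (borel \<Otimes>\<^sub>M borel)" unfolding \<phi>_def by measurable
  have density: "(\<integral>\<^sup>+x. \<integral>\<^sup>+y. k (x, y) \<partial>std_normal_distribution \<partial>std_normal_distribution)
    = (\<integral>\<^sup>+x. \<integral>\<^sup>+y. \<phi> (x, y) * k (x, y) \<partial>lborel \<partial>lborel)"
    if [measurable]: "k \<in> borel_measurable (borel \<Otimes>\<^sub>M borel)" for k :: "real \<times> real \<Rightarrow> ennreal"
    by (simp add: nn_integral_density \<phi>_def ennreal_mult mult.assoc nn_integral_cmult)
  have inv: "\<phi> (c * x + s * y, c * y - s * x) = \<phi> (x, y)" for x y
  proof -
    have "(c * x + s * y)\<^sup>2 + (c * y - s * x)\<^sup>2 = (c\<^sup>2 + s\<^sup>2) * (x\<^sup>2 + y\<^sup>2)"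
      by (simp add: power2_eq_square algebra_simps)
    then have eq: "(c * x + s * y)\<^sup>2 + (c * y - s * x)\<^sup>2 = x\<^sup>2 + y\<^sup>2" using cs by simp
    have pd: "std_normal_density a * std_normal_density b = exp (- (a\<^sup>2 + b\<^sup>2) / 2) / (2 * pi)" for a b
      by (simp add: std_normal_density_def mult_exp_exp add_divide_distrib diff_divide_distrib)
    then show ?thesis by (simp only: \<phi>_def prod.case pd eq)
  qed
  have "(\<integral>\<^sup>+x. \<integral>\<^sup>+y. h (c * x + s * y, c * y - s * x) \<partial>std_normal_distribution \<partial>std_normal_distribution)
    = (\<integral>\<^sup>+x. \<integral>\<^sup>+y. (\<lambda>p. \<phi> p * h p) (c * x + s * y, c * y - s * x) \<partial>lborel \<partial>lborel)"
    by (subst density[where k="\<lambda>(x, y). h (c * x + s * y, c * y - s * x)", simplified]) (simp_all add: inv)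
  also have "\<dots> = (\<integral>\<^sup>+x. \<integral>\<^sup>+y. \<phi> (x, y) * h (x, y) \<partial>lborel \<partial>lborel)"
    by (rule nn_integral_lborel_rotation[OF cs]) simp
  finally show ?thesis by (simp add: density)
qed

text \<open>Substituting \<open>y = x u\<close> separates the variables: the \<open>x\<close>-integral is a second Gaussian moment,
  the \<open>u\<close>-integral is that of \<open>1 / (1 + u\<^sup>2)\<close>.\<close>

lemma nn_integral_std_normal_norm:
  "(\<integral>\<^sup>+x. \<integral>\<^sup>+y. ennreal (sqrt (x\<^sup>2 + y\<^sup>2)) \<partial>std_normal_distribution \<partial>std_normal_distribution) = ennreal (sqrt (pi / 2))"
proof -
  have sub: "(\<integral>\<^sup>+y. ennreal (exp (- (x\<^sup>2 + y\<^sup>2) / 2) / (2 * pi) * sqrt (x\<^sup>2 + y\<^sup>2)) \<partial>lborel)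
     = (\<integral>\<^sup>+u. ennreal (x\<^sup>2 * exp (- ((1 + u\<^sup>2) * x\<^sup>2) / 2) / (2 * pi) * sqrt (1 + u\<^sup>2)) \<partial>lborel)"
    if "x \<noteq> 0" for x :: real
  proof -
    have e: "\<bar>x\<bar> * (exp (- (x\<^sup>2 + (x * u)\<^sup>2) / 2) / (2 * pi) * sqrt (x\<^sup>2 + (x * u)\<^sup>2))
       = x\<^sup>2 * exp (- ((1 + u\<^sup>2) * x\<^sup>2) / 2) / (2 * pi) * sqrt (1 + u\<^sup>2)" for u
    proof -
      have a: "x\<^sup>2 + (x * u)\<^sup>2 = (1 + u\<^sup>2) * x\<^sup>2" by (simp add: algebra_simps power_mult_distrib)
      show ?thesis unfolding a by (simp add: real_sqrt_mult power2_eq_square)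
    qed
    have "(\<integral>\<^sup>+y. ennreal (exp (- (x\<^sup>2 + y\<^sup>2) / 2) / (2 * pi) * sqrt (x\<^sup>2 + y\<^sup>2)) \<partial>lborel)
      = ennreal \<bar>x\<bar> * (\<integral>\<^sup>+u. ennreal (exp (- (x\<^sup>2 + (x * u)\<^sup>2) / 2) / (2 * pi) * sqrt (x\<^sup>2 + (x * u)\<^sup>2)) \<partial>lborel)"
      using that by (subst nn_integral_real_affine[where c=x and t=0]) auto
    also have "\<dots> = (\<integral>\<^sup>+u. ennreal (\<bar>x\<bar> * (exp (- (x\<^sup>2 + (x * u)\<^sup>2) / 2) / (2 * pi) * sqrt (x\<^sup>2 + (x * u)\<^sup>2))) \<partial>lborel)"
      by (subst nn_integral_cmult[symmetric]) (simp_all only: ennreal_mult'[OF abs_ge_zero], measurable)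
    finally show ?thesis by (simp only: e)
  qed
  have xint: "(\<integral>\<^sup>+x. ennreal (x\<^sup>2 * exp (- ((1 + u\<^sup>2) * x\<^sup>2) / 2) / (2 * pi) * sqrt (1 + u\<^sup>2)) \<partial>lborel)
      = ennreal (1 / sqrt (2 * pi) * (1 / (1 + u\<^sup>2)))" for u :: real
  proof -
    \<comment> \<open>The deviation is chosen so that \<open>exp (- (1 + u^2) x^2 / 2)\<close> is,
      up to its normalising factor, the density of a centred normal law with variance
      \<open>\<tau>^2\<close>; the integral is then a second moment.\<close>
    define \<tau> where "\<tau> = 1 / sqrt (1 + u\<^sup>2)"
    have p: "1 + u\<^sup>2 > 0" by (smt (verit) zero_le_power2)
    then have t: "\<tau> > 0" "\<tau>\<^sup>2 = 1 / (1 + u\<^sup>2)" by (auto simp: \<tau>_def power_divide)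
    have hb: "has_bochner_integral lborel (\<lambda>x. normal_density 0 \<tau> x * (x - 0) ^ (2 * 1)) (fact (2 * 1) / ((2 / \<tau>\<^sup>2)^1 * fact 1))"
      by (rule normal_moment_even[OF t(1)])
    have eq: "x\<^sup>2 * exp (- ((1 + u\<^sup>2) * x\<^sup>2) / 2) / (2 * pi) * sqrt (1 + u\<^sup>2)
       = 1 / sqrt (2 * pi) * (normal_density 0 \<tau> x * x\<^sup>2)" for x
      using p by (simp add: normal_density_def t real_sqrt_mult real_sqrt_divide field_simps)
    have "(\<integral>\<^sup>+x. ennreal (1 / sqrt (2 * pi) * (normal_density 0 \<tau> x * x\<^sup>2)) \<partial>lborel)
      = ennreal (1 / sqrt (2 * pi) * \<tau>\<^sup>2)"
      using has_bochner_integral_mult_right[of "1 / sqrt (2 * pi)", OF hb]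
      by (subst nn_integral_eq_integral) (auto simp: has_bochner_integral_iff power2_eq_square intro!: arg_cong[where f=ennreal])
    then show ?thesis by (simp only: eq t(2))
  qed
  have arct: "(\<integral>\<^sup>+u. ennreal (1 / (1 + u\<^sup>2)) \<partial>lborel) = ennreal pi"
  proof -
    have half: "(\<integral>\<^sup>+u. ennreal (1 / (1 + u\<^sup>2)) * indicator {0..} u \<partial>lborel) = ennreal (pi / 2 - arctan 0)"
      by (rule nn_integral_FTC_atLeast)
        (auto intro!: derivative_eq_intros tendsto_arctan_at_top simp: inverse_eq_divide add_nonneg_eq_0_iff)
    have "(\<integral>\<^sup>+u. ennreal (1 / (1 + u\<^sup>2)) \<partial>lborel)
      = (\<integral>\<^sup>+u. ennreal (1 / (1 + u\<^sup>2)) * indicator {0..} u + ennreal (1 / (1 + u\<^sup>2)) * indicator {..<0} u \<partial>lborel)"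
      by (intro nn_integral_cong) (auto split: split_indicator)
    also have "\<dots> = ennreal (pi / 2) + (\<integral>\<^sup>+u. ennreal (1 / (1 + u\<^sup>2)) * indicator {..<0} u \<partial>lborel)"
      using half by (subst nn_integral_add) auto
    also have "(\<integral>\<^sup>+u. ennreal (1 / (1 + u\<^sup>2)) * indicator {..<0} u \<partial>lborel)
      = (\<integral>\<^sup>+u. ennreal (1 / (1 + u\<^sup>2)) * indicator {..<0} (- u) \<partial>lborel)"
      by (subst nn_integral_real_affine[where c="-1" and t=0]) auto
    \<comment> \<open>After reflection the indicator is that of the open half line, which differs
      from \<open>{0..}\<close> only at the null point \<open>0\<close>. Evenness of the integrand
      thus doubles the value \<open>pi / 2\<close> of the half line.\<close>
    also have "\<dots> = (\<integral>\<^sup>+u. ennreal (1 / (1 + u\<^sup>2)) * indicator {0..} u \<partial>lborel)"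
      using AE_lborel_singleton[of 0] by (intro nn_integral_cong_AE) (auto split: split_indicator)
    finally show ?thesis using half by (simp flip: ennreal_plus)
  qed
  have "(\<integral>\<^sup>+x. \<integral>\<^sup>+y. ennreal (sqrt (x\<^sup>2 + y\<^sup>2)) \<partial>std_normal_distribution \<partial>std_normal_distribution)
    = (\<integral>\<^sup>+x. \<integral>\<^sup>+y. ennreal (exp (- (x\<^sup>2 + y\<^sup>2) / 2) / (2 * pi) * sqrt (x\<^sup>2 + y\<^sup>2)) \<partial>lborel \<partial>lborel)"
  proof -
    have "exp (- (x\<^sup>2 + y\<^sup>2) / 2) / (2 * pi) * r = std_normal_density x * (std_normal_density y * r)" for x y r :: real
      by (simp add: std_normal_density_def mult_exp_exp add_divide_distrib diff_divide_distrib)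
    then show ?thesis
      by (simp add: nn_integral_density ennreal_mult nn_integral_cmult)
  qed
  \<comment> \<open>The substitution \<open>y = x u\<close> degenerates at \<open>x = 0\<close>,
    which is a null set.\<close>
  also have "\<dots> = (\<integral>\<^sup>+x. \<integral>\<^sup>+u. ennreal (x\<^sup>2 * exp (- ((1 + u\<^sup>2) * x\<^sup>2) / 2) / (2 * pi) * sqrt (1 + u\<^sup>2)) \<partial>lborel \<partial>lborel)"
    by (intro nn_integral_cong_AE AE_mp[OF AE_lborel_singleton[of 0] AE_I2] impI sub)
  also have "\<dots> = (\<integral>\<^sup>+u. ennreal (1 / sqrt (2 * pi) * (1 / (1 + u\<^sup>2))) \<partial>lborel)"
    by (subst lborel_pair.Fubini', simp, simp only: xint)
  also have "\<dots> = ennreal (1 / sqrt (2 * pi)) * ennreal pi"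
    by (subst ennreal_mult) (auto simp: nn_integral_cmult arct)
  also have "\<dots> = ennreal (sqrt (pi / 2))"
    by (simp flip: ennreal_mult add: real_sqrt_mult real_sqrt_divide field_simps)
  finally show ?thesis .
qed

section \<open>The circular complex normal law and its invariances\<close>

lemma prob_space_std_normal: "prob_space std_normal_distribution"
  by (rule prob_space_normal_density) simp

lemma sets_std_normal_pair[measurable_cong]:
  "sets (std_normal_distribution \<Otimes>\<^sub>M std_normal_distribution) = sets (borel \<Otimes>\<^sub>M borel)"
  by (intro sets_pair_measure_cong) auto

lemma measurable_Complex[measurable (raw)]:
  assumes [measurable]: "f \<in> borel_measurable M" "g \<in> borel_measurable M"
  shows "(\<lambda>x. Complex (f x) (g x)) \<in> borel_measurable M"
  unfolding Complex_eq by measurable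

lemma sets_complex_normal[measurable_cong, simp]: "sets (complex_normal v) = sets borel"
  and space_complex_normal[simp]: "space (complex_normal v) = UNIV"
  by (simp_all add: complex_normal_def)

lemma prob_space_complex_normal: "prob_space (complex_normal v)"
proof -
  interpret N: prob_space std_normal_distribution by (rule prob_space_std_normal)
  interpret NN: pair_prob_space std_normal_distribution std_normal_distribution ..
  show ?thesis unfolding complex_normal_def
    by (rule NN.prob_space_distr) simp
qed

lemma nn_integral_complex_normal:
  fixes F :: "complex \<Rightarrow> ennreal"
  assumes [measurable]: "F \<in> borel_measurable borel"
  shows "(\<integral>\<^sup>+z. F z \<partial>complex_normal v) =
    (\<integral>\<^sup>+x. \<integral>\<^sup>+y. F (Complex (sqrt (v / 2) * x) (sqrt (v / 2) * y)) \<partial>std_normal_distribution \<partial>std_normal_distribution)"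
proof -
  interpret N: prob_space std_normal_distribution by (rule prob_space_std_normal)
  have "(\<integral>\<^sup>+z. F z \<partial>complex_normal v) =
     (\<integral>\<^sup>+p. F (case p of (x, y) \<Rightarrow> Complex (sqrt (v / 2) * x) (sqrt (v / 2) * y)) \<partial>(std_normal_distribution \<Otimes>\<^sub>M std_normal_distribution))"
    unfolding complex_normal_def by (rule nn_integral_distr) simp_all
  also have "\<dots> = (\<integral>\<^sup>+x. \<integral>\<^sup>+y. F (case (x, y) of (x, y) \<Rightarrow> Complex (sqrt (v / 2) * x) (sqrt (v / 2) * y)) \<partial>std_normal_distribution \<partial>std_normal_distribution)"
    by (rule N.nn_integral_fst[symmetric]) simp
  finally show ?thesis by simp
qed

text \<open>Reduces every variance to the unit law. The case \<open>v = 0\<close> is covered, with a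
  point mass on both sides.\<close>

lemma complex_normal_scale:
  "complex_normal v = distr (complex_normal 1) borel (\<lambda>z. sqrt v *\<^sub>R z)"
  unfolding complex_normal_def
  by (subst distr_distr) (auto simp: comp_def real_sqrt_divide split_beta complex_eq_iff intro!: distr_cong)

text \<open>Circular symmetry: multiplication by \<open>cis t\<close> is the plane rotation with
  \<open>c = cos t\<close> and \<open>s = - sin t\<close>.\<close>

lemma distr_complex_normal_cis:
  "distr (complex_normal v) borel (\<lambda>z. cis t * z) = complex_normal v"
proof (rule measure_eqI)
  fix A assume "A \<in> sets (distr (complex_normal v) borel (\<lambda>z. cis t * z))"
  then have [measurable]: "A \<in> sets borel" by simp
  define F :: "complex \<Rightarrow> ennreal" where "F = indicator A"
  have [measurable]: "F \<in> borel_measurable borel" by (simp add: F_def)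
  have "emeasure (distr (complex_normal v) borel (\<lambda>z. cis t * z)) A = (\<integral>\<^sup>+z. F z \<partial>distr (complex_normal v) borel (\<lambda>z. cis t * z))"
    by (simp add: F_def)
  also have "\<dots> = (\<integral>\<^sup>+z. F (cis t * z) \<partial>complex_normal v)"
    by (rule nn_integral_distr) simp_all
  also have "\<dots> = (\<integral>\<^sup>+x. \<integral>\<^sup>+y. (\<lambda>(x, y). F (Complex (sqrt (v / 2) * x) (sqrt (v / 2) * y)))
     (cos t * x + (- sin t) * y, cos t * y - (- sin t) * x) \<partial>std_normal_distribution \<partial>std_normal_distribution)"
    by (subst nn_integral_complex_normal)
       (auto intro!: nn_integral_cong arg_cong[where f=F] simp: complex_eq_iff algebra_simps)
  also have "\<dots> = (\<integral>\<^sup>+z. F z \<partial>complex_normal v)"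
    by (subst nn_integral_std_normal_rotation) (auto simp: nn_integral_complex_normal)
  finally show "emeasure (distr (complex_normal v) borel (\<lambda>z. cis t * z)) A = emeasure (complex_normal v) A"
    by (simp add: F_def)
qed simp

text \<open>A real rotation mixing two complex Gaussians acts separately on the two real parts and
  on the two imaginary parts. Reordering the fourfold integral puts the coordinates of each kind
  next to each other, and the planar rotation is then applied twice.\<close>

lemma nn_integral_complex_normal_rotation:
  fixes c s :: real and F :: "complex \<times> complex \<Rightarrow> ennreal"
  assumes cs: "c\<^sup>2 + s\<^sup>2 = 1" and [measurable]: "F \<in> borel_measurable (borel \<Otimes>\<^sub>M borel)"
  shows "(\<integral>\<^sup>+a. \<integral>\<^sup>+b. F (c *\<^sub>R a + s *\<^sub>R b, c *\<^sub>R b - s *\<^sub>R a) \<partial>complex_normal v \<partial>complex_normal v)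
    = (\<integral>\<^sup>+a. \<integral>\<^sup>+b. F (a, b) \<partial>complex_normal v \<partial>complex_normal v)"
proof -
  let ?N = "std_normal_distribution"
  interpret N: prob_space ?N by (rule prob_space_std_normal)
  interpret NN: pair_prob_space ?N ?N ..
  interpret G: prob_space "complex_normal v" by (rule prob_space_complex_normal)
  define C where "C = (\<lambda>x y. Complex (sqrt (v / 2) * x) (sqrt (v / 2) * y))"
  have [measurable]: "(\<lambda>x. C (f x) (g x)) \<in> borel_measurable M"
    if "f \<in> borel_measurable M" "g \<in> borel_measurable M" for f g and M :: "'m measure"
    unfolding C_def using that by measurable
  have iter: "(\<integral>\<^sup>+a. \<integral>\<^sup>+b. H (a, b) \<partial>complex_normal v \<partial>complex_normal v)
    = (\<integral>\<^sup>+x1. \<integral>\<^sup>+x2. \<integral>\<^sup>+y1. \<integral>\<^sup>+y2. H (C x1 y1, C x2 y2) \<partial>?N \<partial>?N \<partial>?N \<partial>?N)"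
    if [measurable]: "H \<in> borel_measurable (borel \<Otimes>\<^sub>M borel)" for H :: "complex \<times> complex \<Rightarrow> ennreal"
  proof -
    have "(\<integral>\<^sup>+a. \<integral>\<^sup>+b. H (a, b) \<partial>complex_normal v \<partial>complex_normal v)
      = (\<integral>\<^sup>+x1. \<integral>\<^sup>+y1. \<integral>\<^sup>+x2. \<integral>\<^sup>+y2. H (C x1 y1, C x2 y2) \<partial>?N \<partial>?N \<partial>?N \<partial>?N)"
      by (simp add: nn_integral_complex_normal C_def)
    also have "\<dots> = (\<integral>\<^sup>+x1. \<integral>\<^sup>+x2. \<integral>\<^sup>+y1. \<integral>\<^sup>+y2. H (C x1 y1, C x2 y2) \<partial>?N \<partial>?N \<partial>?N \<partial>?N)"
      by (intro nn_integral_cong NN.Fubini') simp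
    finally show ?thesis .
  qed
  have C_rot: "c *\<^sub>R C x1 y1 + s *\<^sub>R C x2 y2 = C (c * x1 + s * x2) (c * y1 + s * y2)"
    "c *\<^sub>R C x2 y2 - s *\<^sub>R C x1 y1 = C (c * x2 - s * x1) (c * y2 - s * y1)" for x1 x2 y1 y2
    by (simp_all add: C_def complex_eq_iff algebra_simps)
  have "(\<integral>\<^sup>+a. \<integral>\<^sup>+b. F (c *\<^sub>R a + s *\<^sub>R b, c *\<^sub>R b - s *\<^sub>R a) \<partial>complex_normal v \<partial>complex_normal v)
    = (\<integral>\<^sup>+x1. \<integral>\<^sup>+x2. \<integral>\<^sup>+y1. \<integral>\<^sup>+y2. F (C (c * x1 + s * x2) (c * y1 + s * y2), C (c * x2 - s * x1) (c * y2 - s * y1)) \<partial>?N \<partial>?N \<partial>?N \<partial>?N)"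
    by (subst iter[of "\<lambda>(a, b). F (c *\<^sub>R a + s *\<^sub>R b, c *\<^sub>R b - s *\<^sub>R a)", simplified]) (simp_all add: C_rot)
  also have "\<dots> = (\<integral>\<^sup>+x1. \<integral>\<^sup>+x2. \<integral>\<^sup>+y1. \<integral>\<^sup>+y2. F (C (c * x1 + s * x2) y1, C (c * x2 - s * x1) y2) \<partial>?N \<partial>?N \<partial>?N \<partial>?N)"
  proof (rule nn_integral_cong, rule nn_integral_cong)
    fix x1 x2
    show "(\<integral>\<^sup>+y1. \<integral>\<^sup>+y2. F (C (c * x1 + s * x2) (c * y1 + s * y2), C (c * x2 - s * x1) (c * y2 - s * y1)) \<partial>?N \<partial>?N)
      = (\<integral>\<^sup>+y1. \<integral>\<^sup>+y2. F (C (c * x1 + s * x2) y1, C (c * x2 - s * x1) y2) \<partial>?N \<partial>?N)"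
      using nn_integral_std_normal_rotation[OF cs, of "\<lambda>(y1, y2). F (C (c * x1 + s * x2) y1, C (c * x2 - s * x1) y2)"]
      by simp
  qed
  also have "\<dots> = (\<integral>\<^sup>+x1. \<integral>\<^sup>+x2. \<integral>\<^sup>+y1. \<integral>\<^sup>+y2. F (C x1 y1, C x2 y2) \<partial>?N \<partial>?N \<partial>?N \<partial>?N)"
    using nn_integral_std_normal_rotation[OF cs, of "\<lambda>(x1, x2). \<integral>\<^sup>+y1. \<integral>\<^sup>+y2. F (C x1 y1, C x2 y2) \<partial>?N \<partial>?N"]
    by simp
  finally show ?thesis by (simp add: iter)
qed

lemma distr_complex_normal_rotation:
  fixes c s :: real
  assumes cs: "c\<^sup>2 + s\<^sup>2 = 1"
  shows "distr (complex_normal v \<Otimes>\<^sub>M complex_normal v) (borel \<Otimes>\<^sub>M borel)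
     (\<lambda>(a, b). (c *\<^sub>R a + s *\<^sub>R b, c *\<^sub>R b - s *\<^sub>R a)) = complex_normal v \<Otimes>\<^sub>M complex_normal v"
    (is "distr ?P _ ?R = _")
proof (rule measure_eqI)
  have sP: "sets ?P = sets (borel \<Otimes>\<^sub>M borel)" by (intro sets_pair_measure_cong) auto
  then show "sets (distr ?P (borel \<Otimes>\<^sub>M borel) ?R) = sets ?P" by simp
  note [measurable_cong] = sP
  interpret G: prob_space "complex_normal v" by (rule prob_space_complex_normal)
  fix A assume "A \<in> sets (distr ?P (borel \<Otimes>\<^sub>M borel) ?R)"
  then have [measurable]: "A \<in> sets (borel \<Otimes>\<^sub>M borel)" by simp
  define F :: "complex \<times> complex \<Rightarrow> ennreal" where "F = indicator A"
  have [measurable]: "F \<in> borel_measurable (borel \<Otimes>\<^sub>M borel)" by (simp add: F_def)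
  have "emeasure (distr ?P (borel \<Otimes>\<^sub>M borel) ?R) A = (\<integral>\<^sup>+p. F p \<partial>distr ?P (borel \<Otimes>\<^sub>M borel) ?R)"
    by (simp add: F_def)
  also have "\<dots> = (\<integral>\<^sup>+p. F (?R p) \<partial>?P)"
    by (rule nn_integral_distr) simp_all
  also have "\<dots> = (\<integral>\<^sup>+a. \<integral>\<^sup>+b. F (c *\<^sub>R a + s *\<^sub>R b, c *\<^sub>R b - s *\<^sub>R a) \<partial>complex_normal v \<partial>complex_normal v)"
    by (subst G.nn_integral_fst[symmetric]) auto
  also have "\<dots> = (\<integral>\<^sup>+p. F p \<partial>?P)"
    by (subst nn_integral_complex_normal_rotation[OF cs]) (auto simp: G.nn_integral_fst)
  finally show "emeasure (distr ?P (borel \<Otimes>\<^sub>M borel) ?R) A = emeasure ?P A"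
    by (simp add: F_def sP)
qed

section \<open>Moments of the unit complex normal law\<close>

lemma nn_integral_complex_normal_norm_square:
  "(\<integral>\<^sup>+z. ennreal ((cmod z)\<^sup>2) \<partial>complex_normal 1) = 1"
proof -
  interpret N: prob_space std_normal_distribution by (rule prob_space_std_normal)
  have "has_bochner_integral lborel (\<lambda>x. std_normal_density x * x ^ (2 * 1)) (fact (2 * 1) / (2 ^ 1 * fact 1))"
    by (rule std_normal_moment_even)
  then have "(\<integral>\<^sup>+x. ennreal (std_normal_density x * x\<^sup>2) \<partial>lborel) = ennreal 1"
    by (subst nn_integral_eq_integral) (auto simp: has_bochner_integral_iff power2_eq_square)
  then have m2: "(\<integral>\<^sup>+x. ennreal (x\<^sup>2) \<partial>std_normal_distribution) = 1"
    by (simp add: nn_integral_density ennreal_mult')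
  have pointwise: "ennreal ((cmod (Complex (sqrt (1 / 2) * x) (sqrt (1 / 2) * y)))\<^sup>2)
      = ennreal (1/2) * ennreal (x\<^sup>2) + ennreal (1/2) * ennreal (y\<^sup>2)" for x y
    by (subst ennreal_mult[symmetric], simp, simp, subst ennreal_mult[symmetric], simp, simp, subst ennreal_plus[symmetric])
       (simp_all add: cmod_power2 power_mult_distrib power_divide real_sqrt_divide)
  have "(\<integral>\<^sup>+z. ennreal ((cmod z)\<^sup>2) \<partial>complex_normal 1)
    = (\<integral>\<^sup>+x. \<integral>\<^sup>+y. ennreal (1/2) * ennreal (x\<^sup>2) + ennreal (1/2) * ennreal (y\<^sup>2) \<partial>std_normal_distribution \<partial>std_normal_distribution)"
    by (simp add: nn_integral_complex_normal pointwise del: ennreal_half)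
  also have "\<dots> = ennreal (1/2) + ennreal (1/2)"
    using N.emeasure_space_1 by (simp add: nn_integral_add nn_integral_cmult m2)
  also have "\<dots> = 1"
    by (subst ennreal_plus[symmetric]) auto
  finally show ?thesis .
qed

lemma nn_integral_complex_normal_norm:
  "(\<integral>\<^sup>+z. ennreal (cmod z) \<partial>complex_normal 1) = ennreal (sqrt pi / 2)"
proof -
  interpret N: prob_space std_normal_distribution by (rule prob_space_std_normal)
  have "cmod (Complex (sqrt (1 / 2) * x) (sqrt (1 / 2) * y)) = sqrt (1 / 2) * sqrt (x\<^sup>2 + y\<^sup>2)" for x y
    by (simp add: cmod_def power_mult_distrib flip: real_sqrt_mult distrib_left)
  then have "(\<integral>\<^sup>+z. ennreal (cmod z) \<partial>complex_normal 1)
    = (\<integral>\<^sup>+x. \<integral>\<^sup>+y. ennreal (sqrt (1/2)) * ennreal (sqrt (x\<^sup>2 + y\<^sup>2)) \<partial>std_normal_distribution \<partial>std_normal_distribution)"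
    by (simp add: nn_integral_complex_normal ennreal_mult)
  also have "\<dots> = ennreal (sqrt (1/2)) * ennreal (sqrt (pi / 2))"
    by (simp add: nn_integral_cmult nn_integral_std_normal_norm)
  also have "\<dots> = ennreal (sqrt pi / 2)"
    by (simp add: real_sqrt_divide flip: ennreal_mult)
  finally show ?thesis .
qed

lemma
  shows integrable_complex_normal_norm_square: "integrable (complex_normal 1) (\<lambda>z. (cmod z)\<^sup>2)"
    and integral_complex_normal_norm_square: "(\<integral>z. (cmod z)\<^sup>2 \<partial>complex_normal 1) = 1"
    and integrable_complex_normal_norm: "integrable (complex_normal 1) cmod"
    and integral_complex_normal_norm: "(\<integral>z. cmod z \<partial>complex_normal 1) = sqrt pi / 2"
proof -
  have "has_bochner_integral (complex_normal 1) (\<lambda>z. (cmod z)\<^sup>2) 1"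
    by (rule has_bochner_integral_nn_integral) (auto simp: nn_integral_complex_normal_norm_square)
  then show "integrable (complex_normal 1) (\<lambda>z. (cmod z)\<^sup>2)" "(\<integral>z. (cmod z)\<^sup>2 \<partial>complex_normal 1) = 1"
    by (auto simp: has_bochner_integral_iff)
  have "has_bochner_integral (complex_normal 1) cmod (sqrt pi / 2)"
    by (rule has_bochner_integral_nn_integral) (auto simp: nn_integral_complex_normal_norm)
  then show "integrable (complex_normal 1) cmod" "(\<integral>z. cmod z \<partial>complex_normal 1) = sqrt pi / 2"
    by (auto simp: has_bochner_integral_iff)
qed

lemma integrable_complex_normal_id: "integrable (complex_normal 1) (\<lambda>z. z)"
  by (rule Bochner_Integration.integrable_bound[OF integrable_complex_normal_norm]) auto

lemma integral_complex_normal_id: "(\<integral>z. z \<partial>complex_normal 1) = 0"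
proof -
  have "(\<integral>z. z \<partial>complex_normal 1) = (\<integral>z. cis pi * z \<partial>complex_normal 1)"
    by (subst (1) distr_complex_normal_cis[of 1 pi, symmetric]) (simp add: integral_distr)
  then show ?thesis by simp
qed

text \<open>A quarter turn preserves the law and changes the sign of the square, so the integral
  equals its own negative; the half turn does the same for the mean. This vanishing of
  \<open>E z^2\<close> is what later removes the squared remainder.\<close>

lemma integral_complex_normal_square: "(\<integral>z. z\<^sup>2 \<partial>complex_normal 1) = 0"
proof -
  have "(\<integral>z. z\<^sup>2 \<partial>complex_normal 1) = (\<integral>z. (cis (pi / 2) * z)\<^sup>2 \<partial>complex_normal 1)"
    by (subst (1) distr_complex_normal_cis[of 1 "pi / 2", symmetric]) (simp add: integral_distr)
  then show ?thesis by (simp add: power_mult_distrib)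
qed

section \<open>Regression for independent complex Gaussians\<close>

lemma pair_prob_space_complex_normal:
  "pair_prob_space (complex_normal v) (complex_normal v')"
proof -
  interpret prob_space "complex_normal v" by (rule prob_space_complex_normal)
  interpret Q: prob_space "complex_normal v'" by (rule prob_space_complex_normal)
  show ?thesis ..
qed

lemma (in pair_prob_space) integral_pair_mult:
  fixes f :: "'a \<Rightarrow> 'c::{real_normed_field, banach, second_countable_topology}"
  assumes f: "integrable M1 f" and g: "integrable M2 g"
  shows integrable_pair_mult: "integrable (M1 \<Otimes>\<^sub>M M2) (\<lambda>p. f (fst p) * g (snd p))"
    and "(\<integral>p. f (fst p) * g (snd p) \<partial>(M1 \<Otimes>\<^sub>M M2)) = (\<integral>x. f x \<partial>M1) * (\<integral>y. g y \<partial>M2)"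
proof -
  have [measurable]: "f \<in> borel_measurable M1" "g \<in> borel_measurable M2" using f g by auto
  show i: "integrable (M1 \<Otimes>\<^sub>M M2) (\<lambda>p. f (fst p) * g (snd p))"
    by (rule Fubini_integrable) (use f g in \<open>auto simp: norm_mult\<close>)
  show "(\<integral>p. f (fst p) * g (snd p) \<partial>(M1 \<Otimes>\<^sub>M M2)) = (\<integral>x. f x \<partial>M1) * (\<integral>y. g y \<partial>M2)"
    using integral_fst'[OF i] by simp
qed

lemma sets_complex_normal_pair[measurable_cong, simp]:
  "sets (complex_normal v \<Otimes>\<^sub>M complex_normal v') = sets (borel \<Otimes>\<^sub>M borel)"
  by (intro sets_pair_measure_cong) auto

lemma integral_complex_normal_rotation:
  fixes G :: "complex \<times> complex \<Rightarrow> complex"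
  assumes "c\<^sup>2 + s\<^sup>2 = 1" and [measurable]: "G \<in> borel_measurable (borel \<Otimes>\<^sub>M borel)"
  shows "(\<integral>p. G p \<partial>(complex_normal v \<Otimes>\<^sub>M complex_normal v))
    = (\<integral>p. G (c *\<^sub>R fst p + s *\<^sub>R snd p, c *\<^sub>R snd p - s *\<^sub>R fst p) \<partial>(complex_normal v \<Otimes>\<^sub>M complex_normal v))"
  by (subst (1) distr_complex_normal_rotation[OF assms(1), symmetric], subst integral_distr)
     (auto simp: split_beta)

text \<open>Up to the factor \<open>W = sqrt (x^2 + y^2)\<close>, the combination is the first
  coordinate of a rotated pair, and rotation does not change the law of the pair. At
  \<open>x = y = 0\<close> there is no direction to rotate to, and both sides are a point
  mass.\<close>

lemma distr_complex_normal_lincomb: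
  "distr (complex_normal 1 \<Otimes>\<^sub>M complex_normal 1) borel (\<lambda>(a, b). x *\<^sub>R a + y *\<^sub>R b) = complex_normal (x\<^sup>2 + y\<^sup>2)"
proof (cases "x = 0 \<and> y = 0")
  case True
  interpret P: pair_prob_space "complex_normal 1" "complex_normal 1" by (rule pair_prob_space_complex_normal)
  show ?thesis using True by (simp add: complex_normal_scale[of 0] case_prod_unfold prob_space.distr_const[OF P.prob_space_axioms] prob_space.distr_const[OF prob_space_complex_normal])
next
  case False
  define W where "W = sqrt (x\<^sup>2 + y\<^sup>2)"
  have W: "W > 0" "W\<^sup>2 = x\<^sup>2 + y\<^sup>2"
    using False by (auto simp: W_def add_nonneg_eq_0_iff sum_power2_gt_zero_iff)
  have cs: "(x / W)\<^sup>2 + (y / W)\<^sup>2 = 1" using W(1) by (simp add: power_divide flip: add_divide_distrib W(2))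
  interpret Q: prob_space "complex_normal 1" by (rule prob_space_complex_normal)
  have "complex_normal (x\<^sup>2 + y\<^sup>2) = distr (complex_normal 1) borel (\<lambda>z. W *\<^sub>R z)"
    by (subst complex_normal_scale) (simp add: W_def)
  also have "complex_normal 1 = distr (complex_normal 1 \<Otimes>\<^sub>M complex_normal 1) (complex_normal 1) fst"
    by (simp add: Q.distr_pair_fst)
  also have "distr \<dots> borel (\<lambda>z. W *\<^sub>R z) = distr (complex_normal 1 \<Otimes>\<^sub>M complex_normal 1) borel (\<lambda>p. W *\<^sub>R fst p)"
    by (subst distr_distr) (auto simp: comp_def)
  also have "\<dots> = distr (distr (complex_normal 1 \<Otimes>\<^sub>M complex_normal 1) (borel \<Otimes>\<^sub>M borel)
      (\<lambda>(a, b). ((x / W) *\<^sub>R a + (y / W) *\<^sub>R b, (x / W) *\<^sub>R b - (y / W) *\<^sub>R a))) borel (\<lambda>p. W *\<^sub>R fst p)"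
    by (simp add: distr_complex_normal_rotation[OF cs])
  also have "\<dots> = distr (complex_normal 1 \<Otimes>\<^sub>M complex_normal 1) borel (\<lambda>(a, b). x *\<^sub>R a + y *\<^sub>R b)"
    using W by (subst distr_distr) (auto simp: comp_def case_prod_unfold scaleR_add_right)
  finally show ?thesis by simp
qed

text \<open>In the applications \<open>F\<close> is built from a phasor or the square of one;
  boundedness leaves integrability to the first two absolute moments.\<close>

lemma integrable_complex_normal_bounded_mult:
  fixes F :: "complex \<Rightarrow> complex"
  assumes [measurable]: "F \<in> borel_measurable borel" and F: "\<And>z. cmod (F z) \<le> 1"
  shows "integrable (complex_normal 1) F"
    and "integrable (complex_normal 1) (\<lambda>z. F z * z)"
    and "integrable (complex_normal 1) (\<lambda>z. F z * z\<^sup>2)"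
proof -
  interpret prob_space "complex_normal 1" by (rule prob_space_complex_normal)
  show "integrable (complex_normal 1) F"
    by (rule integrable_const_bound[of _ 1]) (use F in auto)
  show "integrable (complex_normal 1) (\<lambda>z. F z * z)"
    by (rule Bochner_Integration.integrable_bound[OF integrable_complex_normal_norm])
       (use F in \<open>auto simp: norm_mult intro!: mult_left_le_one_le\<close>)
  show "integrable (complex_normal 1) (\<lambda>z. F z * z\<^sup>2)"
    by (rule Bochner_Integration.integrable_bound[OF integrable_complex_normal_norm_square])
       (use F in \<open>auto simp: norm_mult norm_power intro!: mult_left_le_one_le\<close>)
qed

text \<open>\<open>F\<close> sees only the first coordinate, so every term containing the second one
  factors. Terms linear in it vanish by \<open>E b = 0\<close>, and the term with \<open>b^2\<close>
  vanishes by circularity. The square is the complex one, not \<open>|b|^2\<close>, whose mean is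
  not zero.\<close>

lemma integral_complex_normal_pair_expand:
  fixes F :: "complex \<Rightarrow> complex"
  assumes [measurable]: "F \<in> borel_measurable borel" and F: "\<And>z. cmod (F z) \<le> 1"
  shows "(\<integral>p. F (fst p) * (x *\<^sub>R fst p + y *\<^sub>R snd p) \<partial>(complex_normal 1 \<Otimes>\<^sub>M complex_normal 1))
      = x *\<^sub>R (\<integral>a. F a * a \<partial>complex_normal 1)" (is ?lin)
    and "(\<integral>p. F (fst p) * (x *\<^sub>R fst p + y *\<^sub>R snd p) * (x' *\<^sub>R fst p + y' *\<^sub>R snd p) \<partial>(complex_normal 1 \<Otimes>\<^sub>M complex_normal 1))
      = (x * x') *\<^sub>R (\<integral>a. F a * a\<^sup>2 \<partial>complex_normal 1)" (is ?quad)
proof -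
  interpret P: pair_prob_space "complex_normal 1" "complex_normal 1" by (rule pair_prob_space_complex_normal)
  note int = integrable_complex_normal_bounded_mult[OF assms]
  note sq = integrable_complex_normal_bounded_mult(3)[of "\<lambda>_. 1", simplified]
  have one: "integrable (complex_normal 1) (\<lambda>_. 1 :: complex)" by simp
  note I1 = P.integrable_pair_mult[OF int(2) one, simplified]
    and I2 = P.integrable_pair_mult[OF int(1) integrable_complex_normal_id]
    and I3 = P.integrable_pair_mult[OF int(3) one, simplified]
    and I4 = P.integrable_pair_mult[OF int(2) integrable_complex_normal_id]
    and I5 = P.integrable_pair_mult[OF int(1) sq]
  note J1 = P.integral_pair_mult(2)[OF int(2) one, simplified]
    and J2 = P.integral_pair_mult(2)[OF int(1) integrable_complex_normal_id]
    and J3 = P.integral_pair_mult(2)[OF int(3) one, simplified]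
    and J4 = P.integral_pair_mult(2)[OF int(2) integrable_complex_normal_id]
    and J5 = P.integral_pair_mult(2)[OF int(1) sq]
  have "(\<integral>p. F (fst p) * (x *\<^sub>R fst p + y *\<^sub>R snd p) \<partial>(complex_normal 1 \<Otimes>\<^sub>M complex_normal 1))
    = (\<integral>p. x *\<^sub>R (F (fst p) * fst p) + y *\<^sub>R (F (fst p) * snd p) \<partial>(complex_normal 1 \<Otimes>\<^sub>M complex_normal 1))"
    by (intro Bochner_Integration.integral_cong) (auto simp: algebra_simps)
  also have "\<dots> = x *\<^sub>R (\<integral>a. F a * a \<partial>complex_normal 1)"
    using I1 I2 P.M1.prob_space by (simp add: J1 J2 integral_complex_normal_id)
  finally show ?lin .
  have "(\<integral>p. F (fst p) * (x *\<^sub>R fst p + y *\<^sub>R snd p) * (x' *\<^sub>R fst p + y' *\<^sub>R snd p) \<partial>(complex_normal 1 \<Otimes>\<^sub>M complex_normal 1))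
    = (\<integral>p. (x * x') *\<^sub>R (F (fst p) * (fst p)\<^sup>2) + ((x * y' + x' * y) *\<^sub>R (F (fst p) * fst p * snd p)
        + (y * y') *\<^sub>R (F (fst p) * (snd p)\<^sup>2)) \<partial>(complex_normal 1 \<Otimes>\<^sub>M complex_normal 1))"
    by (intro Bochner_Integration.integral_cong) (auto simp: algebra_simps power2_eq_square)
  also have "\<dots> = (x * x') *\<^sub>R (\<integral>a. F a * a\<^sup>2 \<partial>complex_normal 1)"
    using I3 I4 I5 P.M1.prob_space by (simp add: J3 J4 J5 integral_complex_normal_id integral_complex_normal_square)
  finally show ?quad .
qed

text \<open>The rotation taking \<open>x a + y b\<close> to \<open>W a\<close> turns the second argument into a noise term
  independent of it.\<close>

lemma integral_complex_normal_regression: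
  fixes F :: "complex \<Rightarrow> complex"
  assumes [measurable]: "F \<in> borel_measurable borel" and F: "\<And>z. cmod (F z) \<le> 1"
    and W: "W > 0" "W\<^sup>2 = x\<^sup>2 + y\<^sup>2"
  shows "(\<integral>p. F (x *\<^sub>R fst p + y *\<^sub>R snd p) * fst p \<partial>(complex_normal 1 \<Otimes>\<^sub>M complex_normal 1))
      = (x / W) *\<^sub>R (\<integral>a. F (W *\<^sub>R a) * a \<partial>complex_normal 1)" (is ?lin)
    and "(\<integral>p. F (x *\<^sub>R fst p + y *\<^sub>R snd p) * fst p * fst p \<partial>(complex_normal 1 \<Otimes>\<^sub>M complex_normal 1))
      = (x / W)\<^sup>2 *\<^sub>R (\<integral>a. F (W *\<^sub>R a) * a\<^sup>2 \<partial>complex_normal 1)" (is ?square)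
    and "(\<integral>p. F (x *\<^sub>R fst p + y *\<^sub>R snd p) * fst p * snd p \<partial>(complex_normal 1 \<Otimes>\<^sub>M complex_normal 1))
      = (x * y / W\<^sup>2) *\<^sub>R (\<integral>a. F (W *\<^sub>R a) * a\<^sup>2 \<partial>complex_normal 1)" (is ?mixed)
proof -
  let ?P = "complex_normal 1 \<Otimes>\<^sub>M complex_normal 1"
  \<comment> \<open>The parameters are \<open>c = x / W\<close> and \<open>s = - y / W\<close>:
    under this rotation the argument of \<open>F\<close> becomes \<open>W a\<close>, and the two
    original coordinates become \<open>(x a - y b) / W\<close> and
    \<open>(y a + x b) / W\<close>.\<close>
  have cs: "(x / W)\<^sup>2 + (- y / W)\<^sup>2 = 1" using W(1) by (simp add: power_divide flip: add_divide_distrib W(2))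
  have [measurable]: "(\<lambda>a. F (W *\<^sub>R a)) \<in> borel_measurable borel" by measurable
  have s: "x *\<^sub>R ((x / W) *\<^sub>R a + (- y / W) *\<^sub>R b) + y *\<^sub>R ((x / W) *\<^sub>R b - (- y / W) *\<^sub>R a) = W *\<^sub>R a" for a b :: complex
  proof -
    have "x *\<^sub>R ((x / W) *\<^sub>R a + (- y / W) *\<^sub>R b) + y *\<^sub>R ((x / W) *\<^sub>R b - (- y / W) *\<^sub>R a) = ((x\<^sup>2 + y\<^sup>2) / W) *\<^sub>R a"
      by (simp add: scaleR_add_right scaleR_diff_right scaleR_add_left power2_eq_square add_divide_distrib algebra_simps)
    also have "(x\<^sup>2 + y\<^sup>2) / W = W" unfolding W(2)[symmetric] using W(1) by (simp add: power2_eq_square)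
    finally show ?thesis .
  qed
  have "(\<integral>p. F (x *\<^sub>R fst p + y *\<^sub>R snd p) * fst p \<partial>?P)
      = (\<integral>p. F (W *\<^sub>R fst p) * ((x / W) *\<^sub>R fst p + (- y / W) *\<^sub>R snd p) \<partial>?P)"
    by (subst integral_complex_normal_rotation[OF cs]) (simp_all only: s fst_conv snd_conv, measurable)
  then show ?lin using F by (simp only: integral_complex_normal_pair_expand[of "\<lambda>a. F (W *\<^sub>R a)"] \<open>(\<lambda>a. F (W *\<^sub>R a)) \<in> _\<close>)
  have "(\<integral>p. F (x *\<^sub>R fst p + y *\<^sub>R snd p) * fst p * fst p \<partial>?P)
      = (\<integral>p. F (W *\<^sub>R fst p) * ((x / W) *\<^sub>R fst p + (- y / W) *\<^sub>R snd p) * ((x / W) *\<^sub>R fst p + (- y / W) *\<^sub>R snd p) \<partial>?P)"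
    by (subst integral_complex_normal_rotation[OF cs]) (simp_all only: s fst_conv snd_conv, measurable)
  then show ?square using F
    by (simp only: integral_complex_normal_pair_expand[of "\<lambda>a. F (W *\<^sub>R a)"] \<open>(\<lambda>a. F (W *\<^sub>R a)) \<in> _\<close> power2_eq_square[of "x / W"])
  have "(\<integral>p. F (x *\<^sub>R fst p + y *\<^sub>R snd p) * fst p * snd p \<partial>?P)
      = (\<integral>p. F (W *\<^sub>R fst p) * ((x / W) *\<^sub>R fst p + (- y / W) *\<^sub>R snd p) * ((x / W) *\<^sub>R snd p - (- y / W) *\<^sub>R fst p) \<partial>?P)"
    by (subst integral_complex_normal_rotation[OF cs]) (simp_all only: s fst_conv snd_conv, measurable)
  also have "\<dots> = (\<integral>p. F (W *\<^sub>R fst p) * ((x / W) *\<^sub>R fst p + (- y / W) *\<^sub>R snd p) * ((y / W) *\<^sub>R fst p + (x / W) *\<^sub>R snd p) \<partial>?P)"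
    by (simp add: add.commute)
  also have "\<dots> = ((x / W) * (y / W)) *\<^sub>R (\<integral>a. F (W *\<^sub>R a) * a\<^sup>2 \<partial>complex_normal 1)"
    by (rule integral_complex_normal_pair_expand(2)) (use F in auto)
  finally show ?mixed by (simp add: power2_eq_square)
qed

section \<open>Finite families of independent unit complex normals\<close>

context prob_space
begin

lemma indep_var_restrict_compose:
  assumes "indep_vars (\<lambda>_. N) h I" "A \<inter> B = {}" "A \<subseteq> I" "B \<subseteq> I"
    and "f \<in> measurable (\<Pi>\<^sub>M i\<in>A. N) S" "g \<in> measurable (\<Pi>\<^sub>M i\<in>B. N) T"
  shows "indep_var S (\<lambda>\<omega>. f (\<lambda>i\<in>A. h i \<omega>)) T (\<lambda>\<omega>. g (\<lambda>i\<in>B. h i \<omega>))"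
  using indep_var_compose[OF indep_var_restrict[OF assms(1-4)] assms(5,6)] by (simp add: comp_def)

lemma indep_var_lincomb:
  fixes h :: "'i \<Rightarrow> 'a \<Rightarrow> complex"
  assumes "indep_vars (\<lambda>_. borel) h I" "A \<inter> B = {}" "A \<subseteq> I" "B \<subseteq> I"
  shows "indep_var borel (\<lambda>\<omega>. \<Sum>i\<in>A. w i *\<^sub>R h i \<omega>) borel (\<lambda>\<omega>. \<Sum>i\<in>B. u i *\<^sub>R h i \<omega>)"
proof -
  have "indep_var borel (\<lambda>\<omega>. (\<lambda>f. \<Sum>i\<in>A. w i *\<^sub>R f i) (\<lambda>i\<in>A. h i \<omega>)) borel (\<lambda>\<omega>. (\<lambda>f. \<Sum>i\<in>B. u i *\<^sub>R f i) (\<lambda>i\<in>B. h i \<omega>))"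
    by (rule indep_var_restrict_compose[OF assms]) measurable
  then show ?thesis by simp
qed

text \<open>Realises an independent pair through two unit Gaussians, the second scaled by
  \<open>sqrt v\<close>. This is the form in which the two-variable formulas apply, also when
  \<open>v = 0\<close>.\<close>

lemma distr_pair_complex_normal:
  assumes "indep_var borel X borel Y" "distr M borel X = complex_normal 1" "distr M borel Y = complex_normal v"
  shows "distr M (borel \<Otimes>\<^sub>M borel) (\<lambda>\<omega>. (X \<omega>, Y \<omega>))
    = distr (complex_normal 1 \<Otimes>\<^sub>M complex_normal 1) (borel \<Otimes>\<^sub>M borel) (\<lambda>(a, b). (a, sqrt v *\<^sub>R b))"
proof -
  interpret Q: prob_space "complex_normal v" by (rule prob_space_complex_normal)
  have "distr M (borel \<Otimes>\<^sub>M borel) (\<lambda>\<omega>. (X \<omega>, Y \<omega>)) = distr M borel X \<Otimes>\<^sub>M distr M borel Y"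
    using assms(1) by (simp add: indep_var_distribution_eq)
  also have "\<dots> = distr (complex_normal 1) borel (\<lambda>a. a) \<Otimes>\<^sub>M distr (complex_normal 1) borel (\<lambda>b. sqrt v *\<^sub>R b)"
    by (simp add: assms complex_normal_scale[symmetric])
       (metis distr_id2 sets_complex_normal)
  also have "\<dots> = distr (complex_normal 1 \<Otimes>\<^sub>M complex_normal 1) (borel \<Otimes>\<^sub>M borel) (\<lambda>(a, b). (a, sqrt v *\<^sub>R b))"
    by (rule pair_measure_distr) (auto simp: complex_normal_scale[symmetric] intro: Q.sigma_finite_measure_axioms)
  finally show ?thesis .
qed

text \<open>Induction on \<open>J\<close>: the new term and the earlier sum form an independent
  pair, so the law of a real combination of two unit Gaussians applies with coefficients
  \<open>w j\<close> and \<open>sqrt v\<close>.\<close>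

lemma distr_sum_complex_normal:
  fixes h :: "'i \<Rightarrow> 'a \<Rightarrow> complex"
  assumes "indep_vars (\<lambda>_. borel) h I" "\<And>i. i \<in> I \<Longrightarrow> distr M borel (h i) = complex_normal 1"
    and "finite J" "J \<subseteq> I"
  shows "distr M borel (\<lambda>\<omega>. \<Sum>i\<in>J. w i *\<^sub>R h i \<omega>) = complex_normal (\<Sum>i\<in>J. (w i)\<^sup>2)"
  using assms(3,4)
proof (induction J)
  case empty
  show ?case by (simp add: complex_normal_scale[of 0] prob_space.distr_const[OF prob_space_complex_normal])
next
  case (insert j J)
  have [measurable]: "i \<in> I \<Longrightarrow> h i \<in> borel_measurable M" for i
    using assms(1) by (auto simp: indep_vars_def)
  \<comment> \<open>The singleton sum with weight \<open>1\<close> is \<open>h j\<close>, written so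
    that independence of sums over disjoint blocks applies.\<close>
  have ind: "indep_var borel (\<lambda>\<omega>. \<Sum>i\<in>{j}. (1::real) *\<^sub>R h i \<omega>) borel (\<lambda>\<omega>. \<Sum>i\<in>J. w i *\<^sub>R h i \<omega>)"
    using insert by (intro indep_var_lincomb[OF assms(1)]) auto
  define v where "v = (\<Sum>i\<in>J. (w i)\<^sup>2)"
  have v: "v \<ge> 0" by (simp add: v_def sum_nonneg)
  have meas: "(\<lambda>\<omega>. \<Sum>i\<in>J. w i *\<^sub>R h i \<omega>) \<in> borel_measurable M"
    using insert by (intro borel_measurable_sum borel_measurable_scaleR) auto
  have "distr M borel (\<lambda>\<omega>. \<Sum>i\<in>insert j J. w i *\<^sub>R h i \<omega>)
    = distr (distr M (borel \<Otimes>\<^sub>M borel) (\<lambda>\<omega>. (h j \<omega>, \<Sum>i\<in>J. w i *\<^sub>R h i \<omega>))) borel (\<lambda>(a, b). w j *\<^sub>R a + b)"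
    using insert meas by (subst distr_distr) (auto simp: comp_def)
  also have "\<dots> = distr (distr (complex_normal 1 \<Otimes>\<^sub>M complex_normal 1) (borel \<Otimes>\<^sub>M borel) (\<lambda>(a, b). (a, sqrt v *\<^sub>R b))) borel (\<lambda>(a, b). w j *\<^sub>R a + b)"
    using insert ind assms(2) by (subst distr_pair_complex_normal[where v=v]) (auto simp: v_def)
  also have "\<dots> = distr (complex_normal 1 \<Otimes>\<^sub>M complex_normal 1) borel (\<lambda>(a, b). w j *\<^sub>R a + sqrt v *\<^sub>R b)"
    by (subst distr_distr) (auto simp: comp_def case_prod_unfold)
  also have "\<dots> = complex_normal ((w j)\<^sup>2 + (sqrt v)\<^sup>2)"
    by (rule distr_complex_normal_lincomb)
  finally show ?case using insert v by (simp add: v_def)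
qed

end

context prob_space
begin

definition complex_normal_family :: "('i \<Rightarrow> 'a \<Rightarrow> complex) \<Rightarrow> 'i set \<Rightarrow> bool" where
  "complex_normal_family h I \<longleftrightarrow> finite I \<and> indep_vars (\<lambda>_. borel) h I \<and>
     (\<forall>i\<in>I. distr M borel (h i) = complex_normal 1)"

context
  fixes h :: "'i \<Rightarrow> 'a \<Rightarrow> complex" and I :: "'i set"
  assumes fam: "complex_normal_family h I"
begin

lemma complex_normal_family_finite: "finite I"
  and complex_normal_family_indep: "indep_vars (\<lambda>_. borel) h I"
  and complex_normal_family_law: "i \<in> I \<Longrightarrow> distr M borel (h i) = complex_normal 1"
  using fam by (auto simp: complex_normal_family_def)

lemma complex_normal_family_measurable: "i \<in> I \<Longrightarrow> h i \<in> borel_measurable M"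
  using complex_normal_family_indep by (auto simp: indep_vars_def)

lemma complex_normal_family_integrable:
  assumes "i \<in> I"
  shows "integrable M (\<lambda>\<omega>. (cmod (h i \<omega>))\<^sup>2)" "integrable M (h i)"
    and "(\<integral>\<omega>. (cmod (h i \<omega>))\<^sup>2 \<partial>M) = 1" "(\<integral>\<omega>. h i \<omega> \<partial>M) = 0"
    "(\<integral>\<omega>. cmod (h i \<omega>) \<partial>M) = sqrt pi / 2"
proof -
  note [measurable] = complex_normal_family_measurable[OF assms]
  have I: "integrable M (\<lambda>\<omega>. f (h i \<omega>)) \<longleftrightarrow> integrable (complex_normal 1) f"
    "(\<integral>\<omega>. f (h i \<omega>) \<partial>M) = (\<integral>z. f z \<partial>complex_normal 1)"
    if [measurable]: "f \<in> borel_measurable borel" for f :: "complex \<Rightarrow> 'c::{banach, second_countable_topology}"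
    unfolding complex_normal_family_law[OF assms, symmetric] by (simp_all add: integrable_distr_eq integral_distr)
  show "integrable M (\<lambda>\<omega>. (cmod (h i \<omega>))\<^sup>2)"
    by (rule I(1)[THEN iffD2, OF _ integrable_complex_normal_norm_square]) simp
  show "integrable M (h i)"
    by (rule I(1)[THEN iffD2, OF _ integrable_complex_normal_id]) simp
  show "(\<integral>\<omega>. (cmod (h i \<omega>))\<^sup>2 \<partial>M) = 1"
    by (subst I(2)) (simp_all add: integral_complex_normal_norm_square)
  show "(\<integral>\<omega>. h i \<omega> \<partial>M) = 0"
    by (rule I(2)[OF _, THEN trans, OF _ integral_complex_normal_id]) simp
  show "(\<integral>\<omega>. cmod (h i \<omega>) \<partial>M) = sqrt pi / 2"
    by (subst I(2)) (simp_all add: integral_complex_normal_norm)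
qed

text \<open>Domination by \<open>|h i|^2 + |h j|^2\<close> treats equal and distinct indices
  alike.\<close>

lemma complex_normal_family_integrable_mult:
  assumes "i \<in> I" "j \<in> I" and [measurable]: "f \<in> borel_measurable M" and "\<And>\<omega>. norm (f \<omega>) \<le> (1::real)"
  shows "integrable M (\<lambda>\<omega>. f \<omega> * (h i \<omega> * h j \<omega>))"
proof (rule Bochner_Integration.integrable_bound)
  note [measurable] = complex_normal_family_measurable[OF assms(1)] complex_normal_family_measurable[OF assms(2)]
  show "integrable M (\<lambda>\<omega>. (cmod (h i \<omega>))\<^sup>2 + (cmod (h j \<omega>))\<^sup>2)"
    using complex_normal_family_integrable assms by auto
  show "(\<lambda>\<omega>. f \<omega> * (h i \<omega> * h j \<omega>)) \<in> borel_measurable M" by simp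
  have "cmod (f \<omega> * (h i \<omega> * h j \<omega>)) \<le> (cmod (h i \<omega>))\<^sup>2 + (cmod (h j \<omega>))\<^sup>2" for \<omega>
  proof -
    have "cmod (f \<omega> * (h i \<omega> * h j \<omega>)) \<le> cmod (h i \<omega>) * cmod (h j \<omega>)"
      using assms(4)[of \<omega>] by (simp add: norm_mult mult_left_le_one_le)
    also have "\<dots> \<le> (cmod (h i \<omega>))\<^sup>2 + (cmod (h j \<omega>))\<^sup>2"
      using sum_squares_bound[of "cmod (h i \<omega>)" "cmod (h j \<omega>)"]
        mult_nonneg_nonneg[OF norm_ge_zero[of "h i \<omega>"] norm_ge_zero[of "h j \<omega>"]] by linarith
    finally show ?thesis .
  qed
  then show "AE \<omega> in M. norm (f \<omega> * (h i \<omega> * h j \<omega>)) \<le> norm ((cmod (h i \<omega>))\<^sup>2 + (cmod (h j \<omega>))\<^sup>2)"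
    by simp
qed

text \<open>The weighted sum is \<open>w i\<close> times \<open>h i\<close> plus an independent
  complex normal of variance \<open>v\<close>, so the two-variable formula applies with
  \<open>x = w i\<close> and \<open>y = sqrt v\<close>. The sum runs over a subset \<open>J\<close>
  because the mixed moment uses this result for \<open>I\<close> with one index removed.\<close>

lemma complex_normal_family_regression_single:
  fixes F :: "complex \<Rightarrow> complex"
  assumes [measurable]: "F \<in> borel_measurable borel" and F: "\<And>z. cmod (F z) \<le> 1"
    and W: "W > 0" "W\<^sup>2 = (\<Sum>i\<in>J. (w i)\<^sup>2)" and J: "J \<subseteq> I" and i: "i \<in> J"
  shows "(\<integral>\<omega>. F (\<Sum>i\<in>J. w i *\<^sub>R h i \<omega>) * h i \<omega> \<partial>M)
      = (w i / W) *\<^sub>R (\<integral>a. F (W *\<^sub>R a) * a \<partial>complex_normal 1)"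
    and "(\<integral>\<omega>. F (\<Sum>i\<in>J. w i *\<^sub>R h i \<omega>) * h i \<omega> * h i \<omega> \<partial>M)
      = (w i / W)\<^sup>2 *\<^sub>R (\<integral>a. F (W *\<^sub>R a) * a\<^sup>2 \<partial>complex_normal 1)"
proof -
  have fJ: "finite J" using J complex_normal_family_finite by (rule finite_subset)
  define v where "v = (\<Sum>l\<in>J - {i}. (w l)\<^sup>2)"
  have v: "v \<ge> 0" by (simp add: v_def sum_nonneg)
  have Wv: "W\<^sup>2 = (w i)\<^sup>2 + (sqrt v)\<^sup>2"
    using v i fJ W by (simp add: v_def sum.remove)
  define Y where "Y = (\<lambda>\<omega>. \<Sum>l\<in>J - {i}. w l *\<^sub>R h l \<omega>)"
  have [measurable]: "h i \<in> borel_measurable M" "Y \<in> borel_measurable M"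
    unfolding Y_def using i J by (auto intro!: borel_measurable_sum borel_measurable_scaleR complex_normal_family_measurable)
  have s: "(\<Sum>l\<in>J. w l *\<^sub>R h l \<omega>) = w i *\<^sub>R h i \<omega> + Y \<omega>" for \<omega>
    unfolding Y_def using i fJ by (simp add: sum.remove)
  have "indep_var borel (\<lambda>\<omega>. \<Sum>l\<in>{i}. (1::real) *\<^sub>R h l \<omega>) borel Y"
    unfolding Y_def using i J by (intro indep_var_lincomb[OF complex_normal_family_indep]) auto
  then have iv: "indep_var borel (h i) borel Y" by simp
  have "distr M borel Y = complex_normal v"
    unfolding Y_def v_def using J fJ by (intro distr_sum_complex_normal[OF complex_normal_family_indep complex_normal_family_law]) auto
  from distr_pair_complex_normal[OF iv _ this] complex_normal_family_law i J
  have d: "distr M (borel \<Otimes>\<^sub>M borel) (\<lambda>\<omega>. (h i \<omega>, Y \<omega>))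
    = distr (complex_normal 1 \<Otimes>\<^sub>M complex_normal 1) (borel \<Otimes>\<^sub>M borel) (\<lambda>(a, b). (a, sqrt v *\<^sub>R b))" by auto
  have tr: "(\<integral>\<omega>. G (h i \<omega>, Y \<omega>) \<partial>M) = (\<integral>p. G (fst p, sqrt v *\<^sub>R snd p) \<partial>(complex_normal 1 \<Otimes>\<^sub>M complex_normal 1))"
    if [measurable]: "G \<in> borel_measurable (borel \<Otimes>\<^sub>M borel)" for G :: "complex \<times> complex \<Rightarrow> complex"
  proof -
    have "(\<integral>\<omega>. G (h i \<omega>, Y \<omega>) \<partial>M) = (\<integral>p. G p \<partial>distr M (borel \<Otimes>\<^sub>M borel) (\<lambda>\<omega>. (h i \<omega>, Y \<omega>)))"
      by (simp add: integral_distr)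
    also have "\<dots> = (\<integral>p. G (fst p, sqrt v *\<^sub>R snd p) \<partial>(complex_normal 1 \<Otimes>\<^sub>M complex_normal 1))"
      unfolding d by (subst integral_distr) (auto simp: case_prod_unfold)
    finally show ?thesis .
  qed
  show "(\<integral>\<omega>. F (\<Sum>i\<in>J. w i *\<^sub>R h i \<omega>) * h i \<omega> \<partial>M)
      = (w i / W) *\<^sub>R (\<integral>a. F (W *\<^sub>R a) * a \<partial>complex_normal 1)"
    using tr[of "\<lambda>(a, b). F (w i *\<^sub>R a + b) * a"] integral_complex_normal_regression(1)[OF assms(1) F W(1) Wv]
    by (simp add: s)
  show "(\<integral>\<omega>. F (\<Sum>i\<in>J. w i *\<^sub>R h i \<omega>) * h i \<omega> * h i \<omega> \<partial>M)
      = (w i / W)\<^sup>2 *\<^sub>R (\<integral>a. F (W *\<^sub>R a) * a\<^sup>2 \<partial>complex_normal 1)"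
    using tr[of "\<lambda>(a, b). F (w i *\<^sub>R a + b) * a * a"] integral_complex_normal_regression(2)[OF assms(1) F W(1) Wv]
    by (simp add: s)
qed

text \<open>Here \<open>h i\<close> is held fixed, and the sum of the remaining terms is regressed on \<open>h j\<close>.\<close>

lemma complex_normal_family_regression_mixed:
  fixes F :: "complex \<Rightarrow> complex"
  assumes [measurable]: "F \<in> borel_measurable borel" and F: "\<And>z. cmod (F z) \<le> 1"
    and W: "W > 0" "W\<^sup>2 = (\<Sum>i\<in>I. (w i)\<^sup>2)" and ij: "i \<in> I" "j \<in> I" "i \<noteq> j"
  shows "(\<integral>\<omega>. F (\<Sum>i\<in>I. w i *\<^sub>R h i \<omega>) * h i \<omega> * h j \<omega> \<partial>M)
      = (w i * w j / W\<^sup>2) *\<^sub>R (\<integral>a. F (W *\<^sub>R a) * a\<^sup>2 \<partial>complex_normal 1)"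
proof (cases "w j = 0")
  \<comment> \<open>The other case divides by the deviation \<open>\<tau>\<close> of the sum without
    \<open>h i\<close>, and \<open>w j \<noteq> 0\<close> is what makes it positive. Here
    \<open>h j\<close> does not occur in the argument of \<open>F\<close>, so it is independent of
    the other factors and its mean \<open>0\<close> settles the claim.\<close>
  case True
  note [measurable] = complex_normal_family_measurable[OF ij(1)] complex_normal_family_measurable[OF ij(2)]
  define Y where "Y = (\<lambda>\<omega>. F (\<Sum>l\<in>I - {j}. w l *\<^sub>R h l \<omega>) * h i \<omega>)"
  have "indep_var borel (\<lambda>\<omega>. (\<lambda>f. F (\<Sum>l\<in>I - {j}. w l *\<^sub>R f l) * f i) (\<lambda>l\<in>I - {j}. h l \<omega>)) borel (\<lambda>\<omega>. (\<lambda>f. f j) (\<lambda>l\<in>{j}. h l \<omega>))"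
    using ij by (intro indep_var_restrict_compose[OF complex_normal_family_indep]) auto
  then have iv: "indep_var borel Y borel (h j)" using ij by (simp add: Y_def)
  have [measurable]: "Y \<in> borel_measurable M" using iv by (rule indep_var_rv1)
  have "integrable M Y"
    by (rule Bochner_Integration.integrable_bound[OF complex_normal_family_integrable(2)[OF ij(1)]])
       (use F \<open>Y \<in> borel_measurable M\<close> in \<open>auto simp: Y_def norm_mult intro!: mult_left_le_one_le\<close>)
  then have "(\<integral>\<omega>. Y \<omega> * h j \<omega> \<partial>M) = 0"
    using indep_var_lebesgue_integral[OF iv] complex_normal_family_integrable[OF ij(2)] by simp
  also have "(\<lambda>\<omega>. Y \<omega> * h j \<omega>) = (\<lambda>\<omega>. F (\<Sum>i\<in>I. w i *\<^sub>R h i \<omega>) * h i \<omega> * h j \<omega>)"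
    using ij complex_normal_family_finite True by (auto simp: Y_def sum.remove[of I j])
  finally show ?thesis using True by simp
next
  case False
  note [measurable] = complex_normal_family_measurable[OF ij(1)] complex_normal_family_measurable[OF ij(2)]
  define v where "v = (\<Sum>l\<in>I - {i}. (w l)\<^sup>2)"
  have "(w j)\<^sup>2 \<le> v" unfolding v_def using ij complex_normal_family_finite by (intro member_le_sum) auto
  with False have v: "v > 0" by (smt (verit) zero_less_power2)
  define \<tau> where "\<tau> = sqrt v"
  have \<tau>: "\<tau> > 0" "\<tau>\<^sup>2 = (\<Sum>l\<in>I - {i}. (w l)\<^sup>2)" using v by (auto simp: \<tau>_def v_def)
  have W\<tau>: "W\<^sup>2 = (w i)\<^sup>2 + \<tau>\<^sup>2" unfolding \<tau>(2) W(2) using ij complex_normal_family_finite by (simp add: sum.remove)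
  let ?\<gamma> = "complex_normal 1"
  define Y where "Y = (\<lambda>\<omega>. (\<Sum>l\<in>I - {i}. w l *\<^sub>R h l \<omega>, h j \<omega>))"
  \<comment> \<open>\<^const>\<open>indep_var\<close> wants both variables to have the same value type, hence the padding with \<open>0\<close>.\<close>
  define X where "X = (\<lambda>\<omega>. (h i \<omega>, 0 :: complex))"
  have "indep_var (borel \<Otimes>\<^sub>M borel) (\<lambda>\<omega>. (\<lambda>f. (f i, 0 :: complex)) (\<lambda>l\<in>{i}. h l \<omega>))
      (borel \<Otimes>\<^sub>M borel) (\<lambda>\<omega>. (\<lambda>f. (\<Sum>l\<in>I - {i}. w l *\<^sub>R f l, f j)) (\<lambda>l\<in>I - {i}. h l \<omega>))"
    using ij by (intro indep_var_restrict_compose[OF complex_normal_family_indep]) auto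
  then have iv: "indep_var (borel \<Otimes>\<^sub>M borel) X (borel \<Otimes>\<^sub>M borel) Y" using ij by (simp add: X_def Y_def)
  have [measurable]: "X \<in> measurable M (borel \<Otimes>\<^sub>M borel)" "Y \<in> measurable M (borel \<Otimes>\<^sub>M borel)"
    using iv by (rule indep_var_rv1, rule indep_var_rv2)
  define D where "D = distr ?\<gamma> (borel \<Otimes>\<^sub>M borel) (\<lambda>x. (x, 0 :: complex))"
  have sD[measurable_cong, simp]: "sets D = sets (borel \<Otimes>\<^sub>M borel)" by (simp add: D_def)
  have D: "distr M (borel \<Otimes>\<^sub>M borel) X = D"
    unfolding D_def complex_normal_family_law[OF ij(1), symmetric] by (subst distr_distr) (auto simp: comp_def X_def)
  define L where "L = distr M (borel \<Otimes>\<^sub>M borel) Y"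
  have sL[measurable_cong, simp]: "sets L = sets (borel \<Otimes>\<^sub>M borel)" by (simp add: L_def)
  interpret L: prob_space L unfolding L_def by (rule prob_space_distr) simp
  interpret G: prob_space ?\<gamma> by (rule prob_space_complex_normal)
  interpret D: prob_space D unfolding D[symmetric] by (rule prob_space_distr) simp
  interpret DL: pair_prob_space D L ..
  interpret GG: pair_prob_space ?\<gamma> ?\<gamma> ..
  have joint: "distr M ((borel \<Otimes>\<^sub>M borel) \<Otimes>\<^sub>M (borel \<Otimes>\<^sub>M borel)) (\<lambda>\<omega>. (X \<omega>, Y \<omega>)) = D \<Otimes>\<^sub>M L"
    using iv by (simp add: indep_var_distribution_eq L_def D)
  define H where "H = (\<lambda>p :: (complex \<times> complex) \<times> (complex \<times> complex). F (w i *\<^sub>R fst (fst p) + fst (snd p)) * fst (fst p) * snd (snd p))"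
  have [measurable]: "H \<in> borel_measurable ((borel \<Otimes>\<^sub>M borel) \<Otimes>\<^sub>M (borel \<Otimes>\<^sub>M borel))" unfolding H_def by measurable
  have HY: "H (X \<omega>, Y \<omega>) = F (\<Sum>i\<in>I. w i *\<^sub>R h i \<omega>) * h i \<omega> * h j \<omega>" for \<omega>
    using ij complex_normal_family_finite by (simp add: H_def X_def Y_def sum.remove[of I i])
  have "integrable M (\<lambda>\<omega>. H (X \<omega>, Y \<omega>))"
  proof -
    have "(\<lambda>\<omega>. F (w i *\<^sub>R h i \<omega> + fst (Y \<omega>))) \<in> borel_measurable M" by measurable
    from complex_normal_family_integrable_mult[OF ij(1,2) this] F show ?thesis
      by (simp add: H_def X_def Y_def mult.assoc)
  qed
  then have intH: "integrable (D \<Otimes>\<^sub>M L) H"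
    unfolding joint[symmetric] by (subst integrable_distr_eq) auto
  \<comment> \<open>For a fixed value \<open>x\<close> of \<open>h i\<close>, the map
    \<open>F (w i x + _)\<close> is again bounded and measurable, now evaluated at the sum of the
    other terms. The coefficient of \<open>h j\<close> in that sum, normalised by its deviation, is
    \<open>w j / \<tau>\<close>.\<close>
  have inner: "(\<integral>q. H ((x, 0), q) \<partial>L) = (w j / \<tau>) *\<^sub>R (\<integral>u. F (w i *\<^sub>R x + \<tau> *\<^sub>R u) * x * u \<partial>?\<gamma>)" for x
  proof -
    have "(\<integral>q. H ((x, 0), q) \<partial>L) = (\<integral>\<omega>. H ((x, 0), Y \<omega>) \<partial>M)"
      unfolding L_def by (rule integral_distr) measurable
    also have "\<dots> = (\<integral>\<omega>. x * (F (w i *\<^sub>R x + (\<Sum>l\<in>I - {i}. w l *\<^sub>R h l \<omega>)) * h j \<omega>) \<partial>M)"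
      by (simp only: H_def Y_def fst_conv snd_conv mult_ac)
    also have "\<dots> = x * (\<integral>\<omega>. F (w i *\<^sub>R x + (\<Sum>l\<in>I - {i}. w l *\<^sub>R h l \<omega>)) * h j \<omega> \<partial>M)"
      by simp
    also have "(\<integral>\<omega>. F (w i *\<^sub>R x + (\<Sum>l\<in>I - {i}. w l *\<^sub>R h l \<omega>)) * h j \<omega> \<partial>M)
       = (w j / \<tau>) *\<^sub>R (\<integral>u. F (w i *\<^sub>R x + \<tau> *\<^sub>R u) * u \<partial>?\<gamma>)"
      using ij F by (intro complex_normal_family_regression_single(1)[OF _ _ \<tau>, of "\<lambda>z. F (w i *\<^sub>R x + z)"]) auto
    finally show ?thesis
      by (simp flip: Bochner_Integration.integral_mult_right_zero add: ac_simps)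
  qed
  have int2: "integrable (?\<gamma> \<Otimes>\<^sub>M ?\<gamma>) (\<lambda>p. F (w i *\<^sub>R fst p + \<tau> *\<^sub>R snd p) * fst p * snd p)"
  proof (rule Bochner_Integration.integrable_bound)
    show "integrable (?\<gamma> \<Otimes>\<^sub>M ?\<gamma>) (\<lambda>p. cmod (fst p) * cmod (snd p))"
      by (rule GG.integrable_pair_mult) (rule integrable_complex_normal_norm)+
    show "(\<lambda>p. F (w i *\<^sub>R fst p + \<tau> *\<^sub>R snd p) * fst p * snd p) \<in> borel_measurable (?\<gamma> \<Otimes>\<^sub>M ?\<gamma>)"
      by measurable
    show "AE p in ?\<gamma> \<Otimes>\<^sub>M ?\<gamma>. norm (F (w i *\<^sub>R fst p + \<tau> *\<^sub>R snd p) * fst p * snd p) \<le> norm (cmod (fst p) * cmod (snd p))"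
      using F by (intro AE_I2) (simp add: norm_mult mult.assoc mult_left_le_one_le)
  qed
  have "(\<integral>\<omega>. F (\<Sum>i\<in>I. w i *\<^sub>R h i \<omega>) * h i \<omega> * h j \<omega> \<partial>M) = (\<integral>p. H p \<partial>(D \<Otimes>\<^sub>M L))"
    unfolding joint[symmetric] HY[symmetric] by (subst integral_distr) auto
  also have "\<dots> = (\<integral>x. (w j / \<tau>) *\<^sub>R (\<integral>u. F (w i *\<^sub>R x + \<tau> *\<^sub>R u) * x * u \<partial>?\<gamma>) \<partial>?\<gamma>)"
    unfolding DL.integral_fst'[OF intH, symmetric] inner[symmetric]
    by (unfold D_def, rule integral_distr) measurable
  also have "\<dots> = (w j / \<tau>) *\<^sub>R (\<integral>p. F (w i *\<^sub>R fst p + \<tau> *\<^sub>R snd p) * fst p * snd p \<partial>(?\<gamma> \<Otimes>\<^sub>M ?\<gamma>))"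
    unfolding GG.integral_fst'[OF int2, symmetric] by simp
  \<comment> \<open>What remains is a pair of independent unit Gaussians with weights
    \<open>w i\<close> and \<open>\<tau>\<close>. Its mixed formula contributes
    \<open>w i \<tau> / W^2\<close>, so the auxiliary \<open>\<tau>\<close> cancels.\<close>
  also have "\<dots> = (w j / \<tau>) *\<^sub>R ((w i * \<tau> / W\<^sup>2) *\<^sub>R (\<integral>a. F (W *\<^sub>R a) * a\<^sup>2 \<partial>?\<gamma>))"
    by (simp add: integral_complex_normal_regression(3)[OF assms(1) F W(1) W\<tau>])
  finally show ?thesis using \<tau>(1) by (simp add: field_simps)
qed

end

end

section \<open>Channels with aligned phases\<close>

text \<open>The unit factor \<open>cis (Arg z)\<close>; it is \<open>1\<close> at \<open>0\<close>, where \<open>sgn\<close> is \<open>0\<close>.\<close>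

definition phasor :: "complex \<Rightarrow> complex" where
  "phasor z = (if z = 0 then 1 else sgn z)"

lemma cis_Arg_eq_phasor: "cis (Arg z) = phasor z"
  by (auto simp: phasor_def cis_Arg Arg_zero)

lemma norm_phasor: "cmod (phasor z) = 1"
  by (simp add: phasor_def norm_sgn)

lemma borel_measurable_phasor[measurable]: "phasor \<in> borel_measurable borel"
  unfolding phasor_def sgn_div_norm by measurable

lemma borel_measurable_cnj[measurable]: "cnj \<in> borel_measurable borel"
  by (intro borel_measurable_continuous_onI continuous_intros)

lemma phasor_scaleR: "r > 0 \<Longrightarrow> phasor (r *\<^sub>R z) = phasor z"
  by (simp add: phasor_def sgn_scaleR)

lemma phasor_cnj_mult: "phasor (cnj z) * z = complex_of_real (cmod z)"
  by (simp add: phasor_def sgn_eq complex_norm_square[symmetric] power2_eq_square mult.commute[of "cnj z"])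

lemma phasor_cnj_power2_mult: "(phasor (cnj z))\<^sup>2 * z\<^sup>2 = complex_of_real ((cmod z)\<^sup>2)"
  by (simp add: phasor_cnj_mult flip: power_mult_distrib)

context prob_space
begin

context
  fixes h :: "'i \<Rightarrow> 'a \<Rightarrow> complex" and I :: "'i set" and w :: "'i \<Rightarrow> real" and W :: real
  assumes fam: "complex_normal_family h I"
    and W: "W > 0" "W\<^sup>2 = (\<Sum>i\<in>I. (w i)\<^sup>2)"
begin

lemma weighted_sum_measurable: "(\<lambda>\<omega>. \<Sum>l\<in>I. w l *\<^sub>R h l \<omega>) \<in> borel_measurable M"
  by (intro borel_measurable_sum borel_measurable_scaleR borel_measurable_const complex_normal_family_measurable[OF fam])

lemma aligned_measurable:
  assumes "i \<in> I"
  shows "(\<lambda>\<omega>. phasor (cnj (\<Sum>l\<in>I. w l *\<^sub>R h l \<omega>)) * h i \<omega>) \<in> borel_measurable M"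
proof -
  note [measurable] = weighted_sum_measurable complex_normal_family_measurable[OF fam assms]
  show ?thesis by measurable
qed

text \<open>Regression with \<open>F\<close> the phasor of the conjugate. It is invariant under
  positive scaling, so \<open>F (W a) a = |a|\<close>, whose mean is \<open>sqrt pi / 2\<close>;
  only the factor \<open>w i / W\<close> remembers the device.\<close>

lemma aligned_mean:
  assumes "i \<in> I"
  shows "integrable M (\<lambda>\<omega>. Re (phasor (cnj (\<Sum>l\<in>I. w l *\<^sub>R h l \<omega>)) * h i \<omega>))"
    and "(\<integral>\<omega>. Re (phasor (cnj (\<Sum>l\<in>I. w l *\<^sub>R h l \<omega>)) * h i \<omega>) \<partial>M) = w i / W * (sqrt pi / 2)"
proof -
  have int: "integrable M (\<lambda>\<omega>. phasor (cnj (\<Sum>l\<in>I. w l *\<^sub>R h l \<omega>)) * h i \<omega>)"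
    by (rule Bochner_Integration.integrable_bound[OF complex_normal_family_integrable(2)[OF fam assms]])
       (use aligned_measurable[OF assms] in \<open>auto simp: norm_mult norm_phasor\<close>)
  then show "integrable M (\<lambda>\<omega>. Re (phasor (cnj (\<Sum>l\<in>I. w l *\<^sub>R h l \<omega>)) * h i \<omega>))"
    by (rule integrable_Re)
  have "(\<integral>\<omega>. phasor (cnj (\<Sum>l\<in>I. w l *\<^sub>R h l \<omega>)) * h i \<omega> \<partial>M)
     = (w i / W) *\<^sub>R (\<integral>a. phasor (cnj (W *\<^sub>R a)) * a \<partial>complex_normal 1)"
    by (rule complex_normal_family_regression_single(1)[OF fam _ _ W, of "\<lambda>z. phasor (cnj z)"])
       (auto simp: norm_phasor assms)
  also have "(\<lambda>a. phasor (cnj (W *\<^sub>R a)) * a) = (\<lambda>a. complex_of_real (cmod a))"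
    using W(1) by (simp add: phasor_scaleR phasor_cnj_mult)
  also have "(w i / W) *\<^sub>R (\<integral>a. complex_of_real (cmod a) \<partial>complex_normal 1) = complex_of_real (w i / W * (sqrt pi / 2))"
    by (simp add: integral_complex_normal_norm scaleR_conv_of_real)
  finally show "(\<integral>\<omega>. Re (phasor (cnj (\<Sum>l\<in>I. w l *\<^sub>R h l \<omega>)) * h i \<omega>) \<partial>M) = w i / W * (sqrt pi / 2)"
    by (simp only: integral_Re[OF int] Re_complex_of_real)
qed

text \<open>Uses \<open>Re a Re b = (Re (a b) + Re (a cnj b)) / 2\<close>. In the second term the
  phasor cancels because it has modulus \<open>1\<close>, which leaves the plain covariance of the
  entries, the source of \<open>of_bool (i = j)\<close>. In the first it appears squared, and
  regression gives \<open>w i w j / W^2\<close> times \<open>E |a|^2 = 1\<close>.\<close>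

lemma aligned_second_moment:
  assumes ij: "i \<in> I" "j \<in> I"
  defines "A \<equiv> \<lambda>i \<omega>. phasor (cnj (\<Sum>l\<in>I. w l *\<^sub>R h l \<omega>)) * h i \<omega>"
  shows "integrable M (\<lambda>\<omega>. Re (A i \<omega>) * Re (A j \<omega>))"
    and "(\<integral>\<omega>. Re (A i \<omega>) * Re (A j \<omega>) \<partial>M) = (of_bool (i = j) + w i * w j / W\<^sup>2) / 2"
proof -
  define V where "V = (\<lambda>\<omega>. phasor (cnj (\<Sum>l\<in>I. w l *\<^sub>R h l \<omega>)))"
  note hm = complex_normal_family_measurable[OF fam]
  note [measurable] = hm[OF ij(1)] hm[OF ij(2)]
  have Vm[measurable]: "V \<in> borel_measurable M"
    unfolding V_def using weighted_sum_measurable by measurable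
  have sq2: "\<And>z. cmod ((phasor (cnj z))\<^sup>2) \<le> 1" by (simp add: norm_power norm_phasor)
  have "(\<lambda>\<omega>. (V \<omega>)\<^sup>2) \<in> borel_measurable M" by measurable
  then have int1: "integrable M (\<lambda>\<omega>. (V \<omega>)\<^sup>2 * (h i \<omega> * h j \<omega>))"
    by (rule complex_normal_family_integrable_mult[OF fam ij]) (simp add: V_def norm_power norm_phasor)
  have int2: "integrable M (\<lambda>\<omega>. h i \<omega> * cnj (h j \<omega>))"
    by (rule Bochner_Integration.integrable_bound[OF complex_normal_family_integrable_mult[OF fam ij, of "\<lambda>_. 1"]])
       (auto simp: norm_mult)
  have expand: "Re (A i \<omega>) * Re (A j \<omega>) = (Re ((V \<omega>)\<^sup>2 * (h i \<omega> * h j \<omega>)) + Re (h i \<omega> * cnj (h j \<omega>))) / 2" for \<omega>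
  proof -
    have two: "Re a * Re b = (Re (a * b) + Re (a * cnj b)) / 2" for a b by simp
    have "A i \<omega> * cnj (A j \<omega>) = (V \<omega> * cnj (V \<omega>)) * (h i \<omega> * cnj (h j \<omega>))" by (simp add: A_def V_def mult_ac)
    also have "V \<omega> * cnj (V \<omega>) = 1" by (simp add: V_def norm_phasor flip: complex_norm_square)
    finally have "A i \<omega> * cnj (A j \<omega>) = h i \<omega> * cnj (h j \<omega>)" by simp
    moreover have "A i \<omega> * A j \<omega> = (V \<omega>)\<^sup>2 * (h i \<omega> * h j \<omega>)" by (simp add: A_def V_def power2_eq_square mult_ac)
    ultimately show ?thesis unfolding two[of "A i \<omega>"] by simp
  qed
  show "integrable M (\<lambda>\<omega>. Re (A i \<omega>) * Re (A j \<omega>))"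
    unfolding expand
    by (intro integrable_divide Bochner_Integration.integrable_add integrable_Re int1 int2)
  have Q: "(\<integral>a. (phasor (cnj (W *\<^sub>R a)))\<^sup>2 * a\<^sup>2 \<partial>complex_normal 1) = 1"
    using W(1) by (simp add: phasor_scaleR phasor_cnj_power2_mult integral_complex_normal_norm_square del: of_real_power)
  have E1: "(\<integral>\<omega>. (V \<omega>)\<^sup>2 * (h i \<omega> * h j \<omega>) \<partial>M) = complex_of_real (w i * w j / W\<^sup>2)"
  proof (cases "i = j")
    case True
    have "(\<integral>\<omega>. (V \<omega>)\<^sup>2 * h i \<omega> * h i \<omega> \<partial>M) = (w i / W)\<^sup>2 *\<^sub>R (\<integral>a. (phasor (cnj (W *\<^sub>R a)))\<^sup>2 * a\<^sup>2 \<partial>complex_normal 1)"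
      unfolding V_def
      by (rule complex_normal_family_regression_single(2)[OF fam _ sq2 W subset_refl ij(1)]) auto
    then show ?thesis unfolding Q using True by (simp add: mult.assoc power2_eq_square scaleR_conv_of_real)
  next
    case False
    have "(\<integral>\<omega>. (V \<omega>)\<^sup>2 * h i \<omega> * h j \<omega> \<partial>M) = (w i * w j / W\<^sup>2) *\<^sub>R (\<integral>a. (phasor (cnj (W *\<^sub>R a)))\<^sup>2 * a\<^sup>2 \<partial>complex_normal 1)"
      unfolding V_def
      by (rule complex_normal_family_regression_mixed[OF fam _ sq2 W ij False]) auto
    then show ?thesis unfolding Q by (simp add: mult.assoc scaleR_conv_of_real)
  qed
  have E2: "(\<integral>\<omega>. h i \<omega> * cnj (h j \<omega>) \<partial>M) = of_bool (i = j)"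
  proof (cases "i = j")
    case True
    then show ?thesis
      using complex_normal_family_integrable(3)[OF fam ij(1)]
      by (simp flip: complex_norm_square of_real_power)
  next
    case False
    have "indep_var borel (\<lambda>\<omega>. (\<lambda>f. f i) (\<lambda>l\<in>{i}. h l \<omega>)) borel (\<lambda>\<omega>. (\<lambda>f. cnj (f j)) (\<lambda>l\<in>{j}. h l \<omega>))"
      using ij False by (intro indep_var_restrict_compose[OF complex_normal_family_indep[OF fam]]) auto
    then have "indep_var borel (h i) borel (\<lambda>\<omega>. cnj (h j \<omega>))" by simp
    from indep_var_lebesgue_integral[OF this] show ?thesis
      using False ij complex_normal_family_integrable[OF fam] by simp
  qed
  have "(\<integral>\<omega>. Re (A i \<omega>) * Re (A j \<omega>) \<partial>M)
     = (Re (\<integral>\<omega>. (V \<omega>)\<^sup>2 * (h i \<omega> * h j \<omega>) \<partial>M) + Re (\<integral>\<omega>. h i \<omega> * cnj (h j \<omega>) \<partial>M)) / 2"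
    unfolding expand using integrable_Re[OF int1] integrable_Re[OF int2]
    by (simp only: integral_divide_zero Bochner_Integration.integral_add integral_Re[OF int1] integral_Re[OF int2])
  then show "(\<integral>\<omega>. Re (A i \<omega>) * Re (A j \<omega>) \<partial>M) = (of_bool (i = j) + w i * w j / W\<^sup>2) / 2"
    unfolding E1 E2 by simp
qed

end

text \<open>Independence on two levels is merged into one family. A product event over all entries
  is regrouped, for each \<open>i\<close>, into a box \<open>B i\<close>; independence of the
  vectors factors over \<open>i\<close>, and independence within each vector then factors over
  \<open>n\<close>.\<close>

lemma indep_vars_vec_entries:
  fixes X :: "'i \<Rightarrow> 'a \<Rightarrow> complex ^ 'n"
  assumes fin: "finite I" "I \<noteq> {}" and ind: "indep_vars (\<lambda>_. borel) X I"
    and ent: "\<And>i. i \<in> I \<Longrightarrow> indep_vars (\<lambda>_. borel) (\<lambda>n \<omega>. X i \<omega> $ n) UNIV"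
  shows "indep_vars (\<lambda>_. borel) (\<lambda>(i, n) \<omega>. X i \<omega> $ n) (I \<times> UNIV)"
proof (subst indep_vars_finite[where E="\<lambda>_. sets borel"])
  have [measurable]: "(\<lambda>x :: complex ^ 'n. x $ n) \<in> borel_measurable borel" for n
    by (intro borel_measurable_continuous_onI continuous_intros)
  have Xm: "i \<in> I \<Longrightarrow> X i \<in> borel_measurable M" for i using ind by (auto simp: indep_vars_def)
  show "\<forall>A\<in>I \<times> UNIV \<rightarrow> sets borel.
      prob (\<Inter>p\<in>I \<times> UNIV. (case p of (i, n) \<Rightarrow> \<lambda>\<omega>. X i \<omega> $ n) -` A p \<inter> space M)
      = (\<Prod>p\<in>I \<times> UNIV. prob ((case p of (i, n) \<Rightarrow> \<lambda>\<omega>. X i \<omega> $ n) -` A p \<inter> space M))"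
  proof
    fix A :: "'i \<times> 'n \<Rightarrow> complex set" assume "A \<in> I \<times> UNIV \<rightarrow> sets borel"
    then have A[measurable]: "i \<in> I \<Longrightarrow> A (i, n) \<in> sets borel" for i n by auto
    define B where "B i = {x :: complex ^ 'n. \<forall>n. x $ n \<in> A (i, n)}" for i
    have B: "B i \<in> sets borel" if "i \<in> I" for i
    proof -
      have "{x \<in> space borel. \<forall>n. x $ n \<in> A (i, n)} \<in> sets (borel :: (complex ^ 'n) measure)"
        using A[OF that] by measurable
      then show ?thesis by (simp add: B_def)
    qed
    have "(\<Inter>p\<in>I \<times> UNIV. (case p of (i, n) \<Rightarrow> \<lambda>\<omega>. X i \<omega> $ n) -` A p \<inter> space M) = (\<Inter>i\<in>I. X i -` B i \<inter> space M)"
      using fin by (auto simp: B_def)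
    also have "prob \<dots> = (\<Prod>i\<in>I. prob (X i -` B i \<inter> space M))"
      using fin B by (intro indep_varsD[OF ind]) auto
    also have "\<dots> = (\<Prod>i\<in>I. \<Prod>n\<in>UNIV. prob ((\<lambda>\<omega>. X i \<omega> $ n) -` A (i, n) \<inter> space M))"
    proof (rule prod.cong[OF refl])
      fix i assume i: "i \<in> I"
      have "X i -` B i \<inter> space M = (\<Inter>n\<in>UNIV. (\<lambda>\<omega>. X i \<omega> $ n) -` A (i, n) \<inter> space M)"
        by (auto simp: B_def)
      also have "prob \<dots> = (\<Prod>n\<in>UNIV. prob ((\<lambda>\<omega>. X i \<omega> $ n) -` A (i, n) \<inter> space M))"
        using A[OF i] by (intro indep_varsD[OF ent[OF i]]) auto
      finally show "prob (X i -` B i \<inter> space M) = (\<Prod>n\<in>UNIV. prob ((\<lambda>\<omega>. X i \<omega> $ n) -` A (i, n) \<inter> space M))" .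
    qed
    also have "\<dots> = (\<Prod>p\<in>I \<times> UNIV. prob ((case p of (i, n) \<Rightarrow> \<lambda>\<omega>. X i \<omega> $ n) -` A p \<inter> space M))"
      by (simp add: prod.cartesian_product split_beta)
    finally show "prob (\<Inter>p\<in>I \<times> UNIV. (case p of (i, n) \<Rightarrow> \<lambda>\<omega>. X i \<omega> $ n) -` A p \<inter> space M)
      = (\<Prod>p\<in>I \<times> UNIV. prob ((case p of (i, n) \<Rightarrow> \<lambda>\<omega>. X i \<omega> $ n) -` A p \<inter> space M))" .
  qed
  show "random_variable borel (case p of (i, n) \<Rightarrow> \<lambda>\<omega>. X i \<omega> $ n)" if "p \<in> I \<times> UNIV" for p
    using that Xm by (auto intro: measurable_compose)
  show "Int_stable (sets (borel :: complex measure))" by (rule sets.Int_stable)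
  show "I \<times> UNIV \<noteq> {}" "finite (I \<times> (UNIV :: 'n set))" using fin by auto
  show "sets (borel :: complex measure) = sigma_sets (space borel) (sets borel)"
    using sets.sigma_sets_eq[of "borel :: complex measure"] by simp
  show "space (borel :: complex measure) \<in> sets borel" by simp
qed (auto simp: sets.sets_into_space)

end

text \<open>The summand of \<open>Re (h\<^sub>p\<^sup>H \<Theta> h\<^sub>i)\<close> at the reflecting element \<open>n\<close>, after aligning the phases
  with the combination \<open>\<Sum>l. w l h\<^sub>l\<close>.\<close>

definition reflected ::
  "('i \<Rightarrow> 'a \<Rightarrow> complex ^ 'n) \<Rightarrow> 'i set \<Rightarrow> 'i \<Rightarrow> ('i \<Rightarrow> real) \<Rightarrow> 'i \<Rightarrow> 'n \<Rightarrow> 'a \<Rightarrow> real" where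
  "reflected X I p w i n \<omega> = cmod (X p \<omega> $ n) * Re (phasor (cnj (\<Sum>l\<in>I. w l *\<^sub>R X l \<omega> $ n)) * X i \<omega> $ n)"

section \<open>Moments of the cascaded channel\<close>

context prob_space
begin

context
  fixes X :: "'i \<Rightarrow> 'a \<Rightarrow> complex ^ 'n" and I :: "'i set" and p :: 'i
    and w :: "'i \<Rightarrow> real" and W :: real
  assumes ind: "indep_vars (\<lambda>_. borel) X (insert p I)"
    and cn: "\<And>i. i \<in> insert p I \<Longrightarrow> complex_normal_vector M 1 (X i)"
    and I: "finite I" "p \<notin> I"
    and W: "W > 0" "W\<^sup>2 = (\<Sum>i\<in>I. (w i)\<^sup>2)"
begin

lemma entries_indep: "indep_vars (\<lambda>_. borel) (\<lambda>(i, n) \<omega>. X i \<omega> $ n) (insert p I \<times> UNIV)"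
  using I cn by (intro indep_vars_vec_entries ind) (auto simp: complex_normal_vector_def)

lemma entries_family: "J \<subseteq> insert p I \<Longrightarrow> complex_normal_family (\<lambda>i \<omega>. X i \<omega> $ n) J"
proof -
  assume J: "J \<subseteq> insert p I"
  have "indep_vars (\<lambda>_. borel) (\<lambda>i \<omega>. (\<lambda>x. x $ n) (X i \<omega>)) J"
    by (rule indep_vars_compose2[OF indep_vars_subset[OF ind J]])
       (intro borel_measurable_continuous_onI continuous_intros)
  then show ?thesis
    using J I cn by (auto simp: complex_normal_family_def complex_normal_vector_def intro: finite_subset)
qed

lemma indep_var_entries:
  assumes "A \<inter> B = {}" "A \<subseteq> insert p I \<times> UNIV" "B \<subseteq> insert p I \<times> UNIV"
    and "f \<in> measurable (\<Pi>\<^sub>M a\<in>A. borel) S" "g \<in> measurable (\<Pi>\<^sub>M a\<in>B. borel) T"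
  shows "indep_var S (\<lambda>\<omega>. f (\<lambda>a\<in>A. X (fst a) \<omega> $ snd a)) T (\<lambda>\<omega>. g (\<lambda>a\<in>B. X (fst a) \<omega> $ snd a))"
  using indep_var_restrict_compose[OF entries_indep assms] by (simp add: case_prod_unfold)

text \<open>The magnitude uses the entry \<open>(p, n)\<close> and the aligned factor only entries
  in \<open>I \<times> {n}\<close>; as \<open>p \<notin> I\<close>, these are disjoint and the
  factors independent. Each contributes \<open>sqrt pi / 2\<close>, hence
  \<open>pi / 4\<close>.\<close>

lemma reflected_mean:
  assumes i: "i \<in> I"
  shows "integrable M (reflected X I p w i n)" "(\<integral>\<omega>. reflected X I p w i n \<omega> \<partial>M) = pi / 4 * (w i / W)"
proof -
  define R where "R = (\<lambda>\<omega>. Re (phasor (cnj (\<Sum>l\<in>I. w l *\<^sub>R X l \<omega> $ n)) * X i \<omega> $ n))"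
  have "indep_var borel (\<lambda>\<omega>. (\<lambda>f. cmod (f (p, n))) (\<lambda>a\<in>{(p, n)}. X (fst a) \<omega> $ snd a))
     borel (\<lambda>\<omega>. (\<lambda>f. Re (phasor (cnj (\<Sum>l\<in>I. w l *\<^sub>R f (l, n))) * f (i, n))) (\<lambda>a\<in>I \<times> {n}. X (fst a) \<omega> $ snd a))"
    using I i by (intro indep_var_entries) auto
  then have iv: "indep_var borel (\<lambda>\<omega>. cmod (X p \<omega> $ n)) borel R"
    using i by (simp add: R_def)
  have famI: "complex_normal_family (\<lambda>i \<omega>. X i \<omega> $ n) I"
    and famp: "complex_normal_family (\<lambda>i \<omega>. X i \<omega> $ n) {p}"
    by (auto intro!: entries_family)
  have a: "integrable M (\<lambda>\<omega>. cmod (X p \<omega> $ n))" "(\<integral>\<omega>. cmod (X p \<omega> $ n) \<partial>M) = sqrt pi / 2"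
    using complex_normal_family_integrable[OF famp, of p] by auto
  have b: "integrable M R" "(\<integral>\<omega>. R \<omega> \<partial>M) = w i / W * (sqrt pi / 2)"
    unfolding R_def using aligned_mean[OF famI W i] by auto
  have r: "reflected X I p w i n = (\<lambda>\<omega>. cmod (X p \<omega> $ n) * R \<omega>)"
    by (simp add: fun_eq_iff reflected_def R_def)
  show "integrable M (reflected X I p w i n)"
    unfolding r by (rule indep_var_integrable[OF iv a(1) b(1)])
  show "(\<integral>\<omega>. reflected X I p w i n \<omega> \<partial>M) = pi / 4 * (w i / W)"
    unfolding r indep_var_lebesgue_integral[OF iv a(1) b(1)] a(2) b(2) by simp
qed

text \<open>Both factors share the magnitude of the entry of \<open>X p\<close>, which therefore
  enters squared and has mean \<open>1\<close>; the aligned second moment is left unchanged.\<close>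

lemma reflected_second_moment_same:
  assumes i: "i \<in> I" "j \<in> I"
  shows "integrable M (\<lambda>\<omega>. reflected X I p w i n \<omega> * reflected X I p w j n \<omega>)"
    "(\<integral>\<omega>. reflected X I p w i n \<omega> * reflected X I p w j n \<omega> \<partial>M) = (of_bool (i = j) + w i * w j / W\<^sup>2) / 2"
proof -
  define R where "R = (\<lambda>\<omega>. Re (phasor (cnj (\<Sum>l\<in>I. w l *\<^sub>R X l \<omega> $ n)) * X i \<omega> $ n)
     * Re (phasor (cnj (\<Sum>l\<in>I. w l *\<^sub>R X l \<omega> $ n)) * X j \<omega> $ n))"
  have "indep_var borel (\<lambda>\<omega>. (\<lambda>f. (cmod (f (p, n)))\<^sup>2) (\<lambda>a\<in>{(p, n)}. X (fst a) \<omega> $ snd a))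
     borel (\<lambda>\<omega>. (\<lambda>f. Re (phasor (cnj (\<Sum>l\<in>I. w l *\<^sub>R f (l, n))) * f (i, n)) * Re (phasor (cnj (\<Sum>l\<in>I. w l *\<^sub>R f (l, n))) * f (j, n)))
         (\<lambda>a\<in>I \<times> {n}. X (fst a) \<omega> $ snd a))"
    using I i by (intro indep_var_entries) auto
  then have iv: "indep_var borel (\<lambda>\<omega>. (cmod (X p \<omega> $ n))\<^sup>2) borel R"
    using i by (simp add: R_def)
  have famI: "complex_normal_family (\<lambda>i \<omega>. X i \<omega> $ n) I"
    and famp: "complex_normal_family (\<lambda>i \<omega>. X i \<omega> $ n) {p}"
    by (auto intro!: entries_family)
  have a: "integrable M (\<lambda>\<omega>. (cmod (X p \<omega> $ n))\<^sup>2)" "(\<integral>\<omega>. (cmod (X p \<omega> $ n))\<^sup>2 \<partial>M) = 1"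
    using complex_normal_family_integrable[OF famp, of p] by auto
  have b: "integrable M R" "(\<integral>\<omega>. R \<omega> \<partial>M) = (of_bool (i = j) + w i * w j / W\<^sup>2) / 2"
    unfolding R_def using aligned_second_moment[OF famI W i] by auto
  have r: "(\<lambda>\<omega>. reflected X I p w i n \<omega> * reflected X I p w j n \<omega>) = (\<lambda>\<omega>. (cmod (X p \<omega> $ n))\<^sup>2 * R \<omega>)"
    by (simp add: fun_eq_iff reflected_def R_def power2_eq_square)
  show "integrable M (\<lambda>\<omega>. reflected X I p w i n \<omega> * reflected X I p w j n \<omega>)"
    unfolding r by (rule indep_var_integrable[OF iv a(1) b(1)])
  show "(\<integral>\<omega>. reflected X I p w i n \<omega> * reflected X I p w j n \<omega> \<partial>M) = (of_bool (i = j) + w i * w j / W\<^sup>2) / 2"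
    unfolding r indep_var_lebesgue_integral[OF iv a(1) b(1)] a(2) b(2) by simp
qed

text \<open>Different reflecting elements involve disjoint sets of entries, so the summands are
  independent and only the product of the means remains.\<close>

lemma reflected_second_moment_distinct:
  assumes i: "i \<in> I" "j \<in> I" and nm: "n \<noteq> m"
  shows "integrable M (\<lambda>\<omega>. reflected X I p w i n \<omega> * reflected X I p w j m \<omega>)"
    "(\<integral>\<omega>. reflected X I p w i n \<omega> * reflected X I p w j m \<omega> \<partial>M) = (pi / 4)\<^sup>2 * (w i * w j / W\<^sup>2)"
proof -
  let ?G = "\<lambda>i n f. cmod (f (p, n)) * Re (phasor (cnj (\<Sum>l\<in>I. w l *\<^sub>R f (l, n))) * f (i, n))"
  have "indep_var borel (\<lambda>\<omega>. ?G i n (\<lambda>a\<in>insert p I \<times> {n}. X (fst a) \<omega> $ snd a))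
     borel (\<lambda>\<omega>. ?G j m (\<lambda>a\<in>insert p I \<times> {m}. X (fst a) \<omega> $ snd a))"
    using I i nm by (intro indep_var_entries) auto
  then have iv: "indep_var borel (reflected X I p w i n) borel (reflected X I p w j m)"
    using i by (simp add: reflected_def[abs_def])
  show "integrable M (\<lambda>\<omega>. reflected X I p w i n \<omega> * reflected X I p w j m \<omega>)"
    by (rule indep_var_integrable[OF iv]) (rule reflected_mean i)+
  show "(\<integral>\<omega>. reflected X I p w i n \<omega> * reflected X I p w j m \<omega> \<partial>M) = (pi / 4)\<^sup>2 * (w i * w j / W\<^sup>2)"
    using i by (subst indep_var_lebesgue_integral[OF iv]) (simp_all add: reflected_mean power2_eq_square)
qed

lemma reflected_sum_moments:
  assumes i: "i \<in> I" "j \<in> I"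
  defines "T \<equiv> \<lambda>i \<omega>. \<Sum>n\<in>UNIV. reflected X I p w i n \<omega>" and "N \<equiv> real CARD('n)"
  shows "integrable M (T i)" "(\<integral>\<omega>. T i \<omega> \<partial>M) = N * (pi / 4 * (w i / W))"
    and "integrable M (\<lambda>\<omega>. T i \<omega> * T j \<omega>)"
    and "(\<integral>\<omega>. T i \<omega> * T j \<omega> \<partial>M) = N * ((of_bool (i = j) + w i * w j / W\<^sup>2) / 2)
      + N * (N - 1) * ((pi / 4)\<^sup>2 * (w i * w j / W\<^sup>2))"
proof -
  show "integrable M (T i)" "(\<integral>\<omega>. T i \<omega> \<partial>M) = N * (pi / 4 * (w i / W))"
    unfolding T_def N_def using reflected_mean[OF i(1)] by (auto simp: Bochner_Integration.integral_sum)
  have TT: "(\<lambda>\<omega>. T i \<omega> * T j \<omega>) = (\<lambda>\<omega>. \<Sum>n\<in>UNIV. \<Sum>m\<in>UNIV. reflected X I p w i n \<omega> * reflected X I p w j m \<omega>)"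
    by (simp add: T_def sum_product)
  have int: "integrable M (\<lambda>\<omega>. reflected X I p w i n \<omega> * reflected X I p w j m \<omega>)" for n m
    using reflected_second_moment_same(1)[OF i] reflected_second_moment_distinct(1)[OF i] by (cases "n = m") auto
  then show "integrable M (\<lambda>\<omega>. T i \<omega> * T j \<omega>)" unfolding TT by auto
  let ?a = "(of_bool (i = j) + w i * w j / W\<^sup>2) / 2" and ?b = "(pi / 4)\<^sup>2 * (w i * w j / W\<^sup>2)"
  have "(\<integral>\<omega>. T i \<omega> * T j \<omega> \<partial>M) = (\<Sum>n\<in>UNIV. \<Sum>m\<in>UNIV. \<integral>\<omega>. reflected X I p w i n \<omega> * reflected X I p w j m \<omega> \<partial>M)"
    unfolding TT using int by (simp add: Bochner_Integration.integral_sum)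
  \<comment> \<open>The off-diagonal value is used everywhere and corrected on the diagonal:
    \<open>N^2 b + N (a - b) = N a + N (N - 1) b\<close>.\<close>
  also have "\<dots> = (\<Sum>n\<in>(UNIV :: 'n set). \<Sum>m\<in>(UNIV :: 'n set). ?b + (if n = m then ?a - ?b else 0))"
    using reflected_second_moment_same(2)[OF i] reflected_second_moment_distinct(2)[OF i]
    by (intro sum.cong refl) auto
  also have "\<dots> = N * ?a + N * (N - 1) * ?b"
    by (simp only: sum.distrib sum_constant sum.delta finite UNIV_I if_True) (simp add: N_def algebra_simps diff_divide_distrib)
  finally show "(\<integral>\<omega>. T i \<omega> * T j \<omega> \<partial>M) = N * ?a + N * (N - 1) * ?b" .
qed

end

end

section \<open>The gain as a function of the channel values\<close>

lemma measurable_vec_nth_raw[measurable (raw)]: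
  fixes f :: "'m \<Rightarrow> 'b::{topological_space, second_countable_topology} ^ 'n"
  assumes "f \<in> borel_measurable M"
  shows "(\<lambda>x. f x $ n) \<in> borel_measurable M"
  by (rule measurable_compose[OF assms])
     (intro borel_measurable_continuous_onI continuous_intros)

text \<open>The sum of the \<open>reflected\<close> terms, but as a function of channel values
  instead of sample points: independence of channels, noise and signals is used through measurable
  functions of the values.\<close>

definition aligned_channel :: "nat \<Rightarrow> (nat \<Rightarrow> real) \<Rightarrow> complex ^ 'n \<Rightarrow> (nat \<Rightarrow> complex ^ 'n) \<Rightarrow> nat \<Rightarrow> real" where
  "aligned_channel K w x y i =
     (\<Sum>n\<in>UNIV. cmod (x $ n) * Re (phasor (cnj (\<Sum>l\<in>targets K. w l *\<^sub>R y l $ n)) * y i $ n))"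

lemma hdot_reflecting_matrix:
  "hdot x (reflecting_matrix \<theta> *v y) = (\<Sum>n\<in>UNIV. cnj (x $ n) * (cis (\<theta> $ n) * y $ n))"
proof -
  have "(reflecting_matrix \<theta> *v y) $ n = cis (\<theta> $ n) * y $ n" for n
    by (simp add: reflecting_matrix_def matrix_vector_mult_def if_distrib[where f="\<lambda>a. a * _"] cong: if_cong)
  then show ?thesis by (simp add: hdot_def)
qed

text \<open>The part \<open>- Arg (cnj (x $ n))\<close> of the phase cancels the argument of the
  entry of \<open>x\<close>, leaving its modulus, and the other part produces the phasor. Since
  \<open>Arg 0 = 0\<close> matches the value \<open>1\<close> of \<open>phasor\<close> at
  \<open>0\<close>, the identity holds at every point and not just almost everywhere.\<close>

lemma gain_eq_aligned_channel:
  assumes "\<And>n. \<theta> $ n = - Arg (cnj (x $ n)) + Arg (\<Sum>l\<in>targets K. complex_of_real (w l) * cnj (y l $ n))"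
  shows "gain \<beta> q lam \<theta> x y i = \<beta> i * sqrt (q i) / lam * aligned_channel K w x y i"
proof -
  have "cnj (x $ n) * (cis (\<theta> $ n) * y i $ n)
      = complex_of_real (cmod (x $ n)) * (phasor (cnj (\<Sum>l\<in>targets K. w l *\<^sub>R y l $ n)) * y i $ n)" for n
  proof -
    have "cis (\<theta> $ n) = cis (- Arg (cnj (x $ n))) * cis (Arg (\<Sum>l\<in>targets K. complex_of_real (w l) * cnj (y l $ n)))"
      by (simp add: assms cis_mult)
    also have "cis (- Arg (cnj (x $ n))) = cnj (phasor (cnj (x $ n)))"
      by (simp add: cis_cnj[symmetric] cis_Arg_eq_phasor)
    also have "cis (Arg (\<Sum>l\<in>targets K. complex_of_real (w l) * cnj (y l $ n))) = phasor (cnj (\<Sum>l\<in>targets K. w l *\<^sub>R y l $ n))"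
      by (simp add: cis_Arg_eq_phasor scaleR_conv_of_real)
    finally have "cnj (x $ n) * (cis (\<theta> $ n) * y i $ n)
      = cnj (phasor (cnj (x $ n)) * x $ n) * (phasor (cnj (\<Sum>l\<in>targets K. w l *\<^sub>R y l $ n)) * y i $ n)"
      by (simp add: mult_ac)
    then show ?thesis by (simp only: phasor_cnj_mult complex_cnj_complex_of_real)
  qed
  moreover have "Re (complex_of_real r * a) = r * Re a" for r a by simp
  ultimately have "Re (hdot x (reflecting_matrix \<theta> *v y i)) = aligned_channel K w x y i"
    unfolding hdot_reflecting_matrix aligned_channel_def Re_sum by (intro sum.cong refl) (simp only:)
  then show ?thesis by (simp add: gain_def)
qed

lemma aligned_channel_restrict:
  "targets K \<subseteq> J \<Longrightarrow> i \<in> J \<Longrightarrow> aligned_channel K w x (restrict y J) i = aligned_channel K w x y i"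
  by (auto simp: aligned_channel_def subset_iff intro!: sum.cong arg_cong2[where f="(*)"] arg_cong[where f=Re] arg_cong[where f=phasor])

lemma measurable_aligned_channel:
  fixes f :: "'m \<Rightarrow> complex ^ 'n"
  assumes "targets K \<subseteq> J" "i \<in> J"
  shows "(\<lambda>q. aligned_channel K w (fst q) (snd q) i) \<in> borel_measurable ((borel :: (complex ^ 'n) measure) \<Otimes>\<^sub>M (\<Pi>\<^sub>M i\<in>J. borel))"
proof -
  have [measurable]: "(\<lambda>q. snd q l $ n) \<in> borel_measurable ((borel :: (complex ^ 'n) measure) \<Otimes>\<^sub>M (\<Pi>\<^sub>M i\<in>J. (borel :: (complex ^ 'n) measure)))"
    if "l \<in> J" for l n
    using that by measurable
  have [measurable]: "(\<lambda>q. \<Sum>l\<in>targets K. w l *\<^sub>R snd q l $ n) \<in> borel_measurable ((borel :: (complex ^ 'n) measure) \<Otimes>\<^sub>M (\<Pi>\<^sub>M i\<in>J. (borel :: (complex ^ 'n) measure)))" for n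
    using assms(1) by (intro borel_measurable_sum borel_measurable_scaleR borel_measurable_const) auto
  show ?thesis unfolding aligned_channel_def using assms(2) by measurable
qed

context prob_space
begin

text \<open>The index type \<open>nat option\<close> puts \<open>hp\<close> and the device channels
  into one family, with \<open>None\<close> for \<open>hp\<close>. Interferers join the aligned sum
  with weight \<open>0\<close>, so the combination and \<open>W\<close> involve the targets alone
  while the moments are available for all devices.\<close>

lemma aligned_channel_moments:
  fixes hp :: "'a \<Rightarrow> complex ^ 'n" and hr :: "nat \<Rightarrow> 'a \<Rightarrow> complex ^ 'n"
  assumes cn: "complex_normal_vector M 1 hp" "\<And>i. i \<in> devices K K' \<Longrightarrow> complex_normal_vector M 1 (hr i)"
    and ind: "indep_vars (\<lambda>_. borel) (case_option hp hr) (insert None (Some ` devices K K'))"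
    and W: "W > 0" "W\<^sup>2 = (\<Sum>k\<in>targets K. (w k)\<^sup>2)" and w0: "\<And>m. m \<notin> targets K \<Longrightarrow> w m = 0"
    and i: "i \<in> devices K K'" "j \<in> devices K K'"
  defines "T \<equiv> \<lambda>i \<omega>. aligned_channel K w (hp \<omega>) (\<lambda>i. hr i \<omega>) i" and "N \<equiv> real CARD('n)"
  shows "integrable M (T i)" "(\<integral>\<omega>. T i \<omega> \<partial>M) = N * (pi / 4 * (w i / W))"
    and "integrable M (\<lambda>\<omega>. T i \<omega> * T j \<omega>)"
    and "(\<integral>\<omega>. T i \<omega> * T j \<omega> \<partial>M) = N * ((of_bool (i = j) + w i * w j / W\<^sup>2) / 2)
      + N * (N - 1) * ((pi / 4)\<^sup>2 * (w i * w j / W\<^sup>2))"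
proof -
  define w' where "w' = case_option 0 w"
  have devs: "targets K \<subseteq> devices K K'" by auto
  have sub: "(\<Sum>l\<in>Some ` devices K K'. f l) = (\<Sum>l\<in>targets K. f (Some l))"
    if "\<And>m. m \<notin> targets K \<Longrightarrow> f (Some m) = 0" for f :: "nat option \<Rightarrow> 'c::comm_monoid_add"
  proof -
    have "(\<Sum>l\<in>Some ` devices K K'. f l) = (\<Sum>l\<in>devices K K'. f (Some l))"
      by (simp add: sum.reindex)
    also have "\<dots> = (\<Sum>l\<in>targets K. f (Some l))"
      using that by (intro sum.mono_neutral_right devs) auto
    finally show ?thesis .
  qed
  have T: "T l = (\<lambda>\<omega>. \<Sum>n\<in>UNIV. reflected (case_option hp hr) (Some ` devices K K') None w' (Some l) n \<omega>)" for l
    unfolding T_def aligned_channel_def reflected_def by (subst sub) (simp_all add: w'_def w0)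
  have cn': "a \<in> insert None (Some ` devices K K') \<Longrightarrow> complex_normal_vector M 1 (case_option hp hr a)" for a
    using cn by auto
  have W': "W\<^sup>2 = (\<Sum>l\<in>Some ` devices K K'. (w' l)\<^sup>2)"
    by (subst sub) (simp_all add: w'_def w0 W(2))
  note mom = reflected_sum_moments[OF ind cn' _ _ W(1) W' imageI[OF i(1)] imageI[OF i(2)]]
  show "integrable M (T i)" "(\<integral>\<omega>. T i \<omega> \<partial>M) = N * (pi / 4 * (w i / W))"
    and "integrable M (\<lambda>\<omega>. T i \<omega> * T j \<omega>)"
    and "(\<integral>\<omega>. T i \<omega> * T j \<omega> \<partial>M) = N * ((of_bool (i = j) + w i * w j / W\<^sup>2) / 2)
      + N * (N - 1) * ((pi / 4)\<^sup>2 * (w i * w j / W\<^sup>2))"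
    using mom unfolding T N_def by (simp_all add: w'_def)
qed

text \<open>For the unit law \<open>(Re z)^2 = (|z|^2 + Re (z^2)) / 2\<close>, and the second term
  has mean \<open>0\<close> by circularity: the real part carries half of the variance. Scaling by
  \<open>sqrt v\<close> includes noise of variance \<open>0\<close>.\<close>

lemma complex_normal_Re_moments:
  assumes [measurable]: "Z \<in> borel_measurable M" and law: "distr M borel Z = complex_normal v" and v: "v \<ge> 0"
  shows "integrable M (\<lambda>\<omega>. Re (Z \<omega>))" "(\<integral>\<omega>. Re (Z \<omega>) \<partial>M) = 0"
    and "integrable M (\<lambda>\<omega>. (Re (Z \<omega>))\<^sup>2)" "(\<integral>\<omega>. (Re (Z \<omega>))\<^sup>2 \<partial>M) = v / 2"
proof -
  have I: "integrable M (\<lambda>\<omega>. f (Z \<omega>)) \<longleftrightarrow> integrable (complex_normal 1) (\<lambda>z. f (sqrt v *\<^sub>R z))"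
    "(\<integral>\<omega>. f (Z \<omega>) \<partial>M) = (\<integral>z. f (sqrt v *\<^sub>R z) \<partial>complex_normal 1)"
    if [measurable]: "f \<in> borel_measurable borel" for f :: "complex \<Rightarrow> real"
  proof -
    have eq: "distr M borel Z = distr (complex_normal 1) borel (\<lambda>z. sqrt v *\<^sub>R z)"
      unfolding law by (rule complex_normal_scale)
    show "integrable M (\<lambda>\<omega>. f (Z \<omega>)) \<longleftrightarrow> integrable (complex_normal 1) (\<lambda>z. f (sqrt v *\<^sub>R z))"
      using arg_cong[OF eq, of "\<lambda>L. integrable L f"] by (simp add: integrable_distr_eq)
    show "(\<integral>\<omega>. f (Z \<omega>) \<partial>M) = (\<integral>z. f (sqrt v *\<^sub>R z) \<partial>complex_normal 1)"
      using arg_cong[OF eq, of "\<lambda>L. integral\<^sup>L L f"] by (simp add: integral_distr)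
  qed
  have sq: "integrable (complex_normal 1) (\<lambda>z. z\<^sup>2)"
    using integrable_complex_normal_bounded_mult(3)[of "\<lambda>_. 1"] by simp
  have Re2: "(Re (sqrt v *\<^sub>R z))\<^sup>2 = v / 2 * ((cmod z)\<^sup>2 + Re (z\<^sup>2))" for z
  proof -
    have "(cmod z)\<^sup>2 + Re (z\<^sup>2) = 2 * (Re z)\<^sup>2" by (simp add: cmod_power2 Re_power2)
    then show ?thesis using v by (simp add: power_mult_distrib)
  qed
  show "integrable M (\<lambda>\<omega>. Re (Z \<omega>))" "(\<integral>\<omega>. Re (Z \<omega>) \<partial>M) = 0"
    using I[of Re] integrable_Re[OF integrable_complex_normal_id] integral_Re[OF integrable_complex_normal_id] integral_complex_normal_id
    by simp_all
  have iR: "integrable (complex_normal 1) (\<lambda>z. Re (z\<^sup>2))" "(\<integral>z. Re (z\<^sup>2) \<partial>complex_normal 1) = 0"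
    using integrable_Re[OF sq] integral_Re[OF sq] integral_complex_normal_square by auto
  have m: "(\<lambda>z. (Re z)\<^sup>2) \<in> borel_measurable borel" by measurable
  have i1: "integrable (complex_normal 1) (\<lambda>z. (cmod z)\<^sup>2 + Re (z\<^sup>2))"
    by (rule Bochner_Integration.integrable_add[OF integrable_complex_normal_norm_square iR(1)])
  have i2: "(\<integral>z. (cmod z)\<^sup>2 + Re (z\<^sup>2) \<partial>complex_normal 1) = 1"
    by (simp only: Bochner_Integration.integral_add[OF integrable_complex_normal_norm_square iR(1)]
        integral_complex_normal_norm_square iR(2) add_0_right)
  show "integrable M (\<lambda>\<omega>. (Re (Z \<omega>))\<^sup>2)"
    unfolding I(1)[OF m] Re2 by (rule integrable_mult_right[OF i1])
  show "(\<integral>\<omega>. (Re (Z \<omega>))\<^sup>2 \<partial>M) = v / 2"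
    unfolding I(2)[OF m] Re2 by (simp only: integral_mult_right_zero i2 mult_1_right)
qed

lemma UNIV_source: "(UNIV :: source set) = {Channels, Noise, Signals}"
  using source.exhaust by auto

text \<open>Once composed with real functions, the three sources have a common value type and form
  an ordinary independent family indexed by \<open>source\<close>. Each composition generates no
  more events than its source, so independence is inherited.\<close>

lemma indep_triple_integral:
  fixes f :: "'b \<Rightarrow> real" and h :: "'c \<Rightarrow> real" and k :: "'d \<Rightarrow> real"
  assumes ind: "indep_triple M S X T Y U Z"
    and [measurable]: "f \<in> borel_measurable S" "h \<in> borel_measurable T" "k \<in> borel_measurable U"
    and int: "integrable M (\<lambda>\<omega>. f (X \<omega>))" "integrable M (\<lambda>\<omega>. h (Y \<omega>))" "integrable M (\<lambda>\<omega>. k (Z \<omega>))"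
  shows "integrable M (\<lambda>\<omega>. f (X \<omega>) * h (Y \<omega>) * k (Z \<omega>))"
    and "(\<integral>\<omega>. f (X \<omega>) * h (Y \<omega>) * k (Z \<omega>) \<partial>M) = (\<integral>\<omega>. f (X \<omega>) \<partial>M) * (\<integral>\<omega>. h (Y \<omega>) \<partial>M) * (\<integral>\<omega>. k (Z \<omega>) \<partial>M)"
proof -
  have m[measurable]: "X \<in> measurable M S" "Y \<in> measurable M T" "Z \<in> measurable M U"
    using ind by (auto simp: indep_triple_def)
  define R where "R = case_source (\<lambda>\<omega>. f (X \<omega>)) (\<lambda>\<omega>. h (Y \<omega>)) (\<lambda>\<omega>. k (Z \<omega>))"
  have "indep_vars (\<lambda>_. borel) R UNIV"
    unfolding indep_vars_def2
  proof (intro conjI ballI)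
    show "R s \<in> borel_measurable M" for s by (cases s) (simp_all add: R_def)
    have pre: "{(\<lambda>\<omega>. r (V \<omega>)) -` A \<inter> space M |A. A \<in> sets borel} \<subseteq> {V -` A \<inter> space M |A. A \<in> sets Q}"
      if [measurable]: "V \<in> measurable M Q" "r \<in> borel_measurable Q" for V and r :: "'q \<Rightarrow> real" and Q :: "'q measure"
    proof safe
      fix A :: "real set" assume [measurable]: "A \<in> sets borel"
      have "(\<lambda>\<omega>. r (V \<omega>)) -` A \<inter> space M = V -` (r -` A \<inter> space Q) \<inter> space M"
        using measurable_space[OF that(1)] by auto
      moreover have "r -` A \<inter> space Q \<in> sets Q" by measurable
      ultimately show "\<exists>B. (\<lambda>\<omega>. r (V \<omega>)) -` A \<inter> space M = V -` B \<inter> space M \<and> B \<in> sets Q" by blast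
    qed
    show "indep_sets (\<lambda>s. {R s -` A \<inter> space M |A. A \<in> sets borel}) UNIV"
    proof (rule indep_sets_mono_sets)
      show "indep_sets (\<lambda>s. case s of Channels \<Rightarrow> {X -` A \<inter> space M | A. A \<in> sets S}
        | Noise \<Rightarrow> {Y -` A \<inter> space M | A. A \<in> sets T} | Signals \<Rightarrow> {Z -` A \<inter> space M | A. A \<in> sets U}) UNIV"
        using ind by (simp add: indep_triple_def)
      show "{R s -` A \<inter> space M |A. A \<in> sets borel} \<subseteq> (case s of Channels \<Rightarrow> {X -` A \<inter> space M | A. A \<in> sets S}
        | Noise \<Rightarrow> {Y -` A \<inter> space M | A. A \<in> sets T} | Signals \<Rightarrow> {Z -` A \<inter> space M | A. A \<in> sets U})" for s
        using pre[of X S f] pre[of Y T h] pre[of Z U k] by (cases s) (simp_all add: R_def)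
    qed
  qed
  moreover have "finite (UNIV :: source set)" by (simp add: UNIV_source)
  moreover have "integrable M (R s)" for s using int by (cases s) (simp_all add: R_def)
  ultimately have "integrable M (\<lambda>\<omega>. \<Prod>s\<in>UNIV. R s \<omega>)" "(\<integral>\<omega>. (\<Prod>s\<in>UNIV. R s \<omega>) \<partial>M) = (\<Prod>s\<in>UNIV. \<integral>\<omega>. R s \<omega> \<partial>M)"
    by (auto intro!: indep_vars_integrable indep_vars_lebesgue_integral)
  then show "integrable M (\<lambda>\<omega>. f (X \<omega>) * h (Y \<omega>) * k (Z \<omega>))"
    and "(\<integral>\<omega>. f (X \<omega>) * h (Y \<omega>) * k (Z \<omega>) \<partial>M) = (\<integral>\<omega>. f (X \<omega>) \<partial>M) * (\<integral>\<omega>. h (Y \<omega>) \<partial>M) * (\<integral>\<omega>. k (Z \<omega>) \<partial>M)"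
    by (simp_all add: UNIV_source R_def mult.assoc)
qed

end

section \<open>The mean square error\<close>

text \<open>The mixed term is kept as a sum over coordinates, so that every summand is a product of
  one channel, one noise and one signal factor, the shape that independence can split.\<close>

lemma norm_sum_scaleR_power2:
  fixes v :: "'i \<Rightarrow> real ^ 'd"
  shows "(norm ((\<Sum>i\<in>A. c i *\<^sub>R v i) + r *\<^sub>R \<zeta>))\<^sup>2
    = (\<Sum>i\<in>A. \<Sum>j\<in>A. c i * c j * (v i \<bullet> v j))
      + 2 * r * (\<Sum>i\<in>A. \<Sum>d\<in>UNIV. c i * \<zeta> $ d * v i $ d) + r\<^sup>2 * (\<Sum>d\<in>UNIV. (\<zeta> $ d)\<^sup>2)"
proof -
  let ?S = "\<Sum>i\<in>A. c i *\<^sub>R v i"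
  have "(norm (?S + r *\<^sub>R \<zeta>))\<^sup>2 = ?S \<bullet> ?S + 2 * r * (?S \<bullet> \<zeta>) + r\<^sup>2 * (\<zeta> \<bullet> \<zeta>)"
    unfolding power2_norm_eq_inner by (simp add: inner_add_left inner_add_right inner_commute power2_eq_square algebra_simps)
  also have "?S \<bullet> ?S = (\<Sum>i\<in>A. \<Sum>j\<in>A. c i * c j * (v i \<bullet> v j))"
    by (subst sum.swap) (simp add: inner_sum_left inner_sum_right mult_ac sum_distrib_left)
  also have "?S \<bullet> \<zeta> = (\<Sum>i\<in>A. \<Sum>d\<in>UNIV. c i * \<zeta> $ d * v i $ d)"
    unfolding inner_sum_left by (simp add: inner_vec_def sum_distrib_left mult_ac)
  also have "\<zeta> \<bullet> \<zeta> = (\<Sum>d\<in>UNIV. (\<zeta> $ d)\<^sup>2)"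
    by (simp add: inner_vec_def power2_eq_square)
  finally show ?thesis .
qed

lemma integral_sum_sum:
  fixes f :: "'i \<Rightarrow> 'j \<Rightarrow> 'm \<Rightarrow> real"
  assumes "\<And>i j. i \<in> A \<Longrightarrow> j \<in> B \<Longrightarrow> integrable M (f i j)"
  shows "integrable M (\<lambda>\<omega>. \<Sum>i\<in>A. \<Sum>j\<in>B. f i j \<omega>)"
    and "(\<integral>\<omega>. (\<Sum>i\<in>A. \<Sum>j\<in>B. f i j \<omega>) \<partial>M) = (\<Sum>i\<in>A. \<Sum>j\<in>B. \<integral>\<omega>. f i j \<omega> \<partial>M)"
  using assms by (simp_all add: Bochner_Integration.integral_sum)

context prob_space
begin

text \<open>Both schemes align the phases with a weighted sum of the target channels and choose the powers
  such that the gain of every target device has mean \<open>1 / K\<close>; these two facts determine the error.\<close>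

lemma aligned_unbiased_MSE:
  fixes K K' N D :: nat
    and hp :: "'a \<Rightarrow> complex ^ 'n" and hr :: "nat \<Rightarrow> 'a \<Rightarrow> complex ^ 'n"
    and g gi :: "nat \<Rightarrow> 'a \<Rightarrow> real ^ 'd" and z :: "'a \<Rightarrow> complex ^ 'd"
    and w \<beta> q :: "nat \<Rightarrow> real" and G \<sigma> W lam :: real
  assumes N: "N = CARD('n)" and D: "D = CARD('d)"
    and hp: "complex_normal_vector M 1 hp"
    and hr: "\<And>i. i \<in> devices K K' \<Longrightarrow> complex_normal_vector M 1 (hr i)"
    and ind: "indep_vars (\<lambda>_. borel) (case_option hp hr) (insert None (Some ` devices K K'))"
    and z: "complex_normal_vector M (\<sigma>\<^sup>2) z"
    and gm: "\<And>k. k \<in> targets K \<Longrightarrow> g k \<in> borel_measurable M"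
    and gb: "\<And>k. k \<in> targets K \<Longrightarrow> AE \<omega> in M. norm (g k \<omega>) \<le> G"
    and gim: "\<And>m. m \<in> interferers K K' \<Longrightarrow> gi m \<in> borel_measurable M"
    and gib: "\<And>m. m \<in> interferers K K' \<Longrightarrow> AE \<omega> in M. norm (gi m \<omega>) = 1"
    and trip: "indep_triple M
           (borel \<Otimes>\<^sub>M (\<Pi>\<^sub>M i\<in>devices K K'. borel))
             (\<lambda>\<omega>. (hp \<omega>, \<lambda>i\<in>devices K K'. hr i \<omega>))
           borel z
           ((\<Pi>\<^sub>M k\<in>targets K. borel) \<Otimes>\<^sub>M (\<Pi>\<^sub>M m\<in>interferers K K'. borel))
             (\<lambda>\<omega>. (\<lambda>k\<in>targets K. g k \<omega>, \<lambda>m\<in>interferers K K'. gi m \<omega>))"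
    and phase: "\<And>x y n. phase x y $ n
      = - Arg (cnj (x $ n)) + Arg (\<Sum>l\<in>targets K. complex_of_real (w l) * cnj (y l $ n))"
    and W: "W > 0" "W\<^sup>2 = (\<Sum>k\<in>targets K. (w k)\<^sup>2)"
    and unbiased: "\<And>k. k \<in> targets K \<Longrightarrow> \<beta> k * sqrt (q k) / lam * (real N * (pi / 4 * (w k / W))) = 1 / real K"
  defines "a \<equiv> \<lambda>i. \<beta> i * sqrt (q i) / lam"
  shows "integrable M (squared_error K K' \<beta> q lam phase hp hr g gi z)"
    and "MSE M K K' \<beta> q lam phase hp hr g gi z
      = (\<Sum>k\<in>targets K. real N * (a k)\<^sup>2 / 2 * (\<integral>\<omega>. (norm (g k \<omega>))\<^sup>2 \<partial>M))
        + (8 - pi\<^sup>2) / (pi\<^sup>2 * real N * (real K)\<^sup>2)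
          * (\<Sum>k\<in>targets K. \<Sum>k'\<in>targets K. \<integral>\<omega>. g k \<omega> \<bullet> g k' \<omega> \<partial>M)
        + (\<Sum>m\<in>interferers K K'. real N * (a m)\<^sup>2 / 2)
        + \<sigma>\<^sup>2 * real D / (2 * lam\<^sup>2)"
proof -
  let ?Dv = "devices K K'"
  have sub: "targets K \<subseteq> ?Dv" by auto
  have Npos: "real N > 0" unfolding N by simp
  \<comment> \<open>Coefficient of each signal in the true global gradient, \<open>0\<close> for
    interference. The error thus becomes one sum over all devices with coefficients
    \<open>a i * T i - \<kappa> i\<close>, plus the noise.\<close>
  define \<kappa> where "\<kappa> i = (if i \<in> targets K then 1 / real K else 0)" for i
  \<comment> \<open>The channel moments require weights that vanish off the targets, whereas
    \<open>w\<close> may be, for instance, constantly \<open>1\<close>; the aligned sum does not see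
    the difference.\<close>
  define u where "u i = (if i \<in> targets K then w i else 0)" for i
  define T where "T i \<omega> = aligned_channel K u (hp \<omega>) (\<lambda>i. hr i \<omega>) i" for i \<omega>
  define c where "c i \<omega> = a i * T i \<omega> - \<kappa> i" for i \<omega>
  define v where "v i \<omega> = (if i \<in> targets K then g i \<omega> else gi i \<omega>)" for i \<omega>
  define \<zeta> where "\<zeta> \<omega> = (\<chi> d. Re (z \<omega> $ d))" for \<omega>
  have Wu: "W\<^sup>2 = (\<Sum>k\<in>targets K. (u k)\<^sup>2)" unfolding W(2) by (simp add: u_def)
  have u0: "m \<notin> targets K \<Longrightarrow> u m = 0" for m unfolding u_def by (rule if_not_P)
  \<comment> \<open>For an interferer both sides are \<open>0\<close>, so each
    \<open>\<kappa> i\<close> is the mean of the gain and \<open>c i\<close> is centred for every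
    device.\<close>
  have mean: "a i * (real N * (pi / 4 * (u i / W))) = \<kappa> i" for i
    using unbiased[of i] by (simp add: a_def u_def \<kappa>_def)
  have mean': "a i * b * (real N * (pi / 4 * (u i / W))) = \<kappa> i * b" for i b
    unfolding mean[of i, symmetric] by (simp only: mult_ac)

  have err: "squared_error K K' \<beta> q lam phase hp hr g gi z \<omega>
     = (\<Sum>i\<in>?Dv. \<Sum>j\<in>?Dv. c i \<omega> * c j \<omega> * (v i \<omega> \<bullet> v j \<omega>))
      + 2 * (1 / lam) * (\<Sum>i\<in>?Dv. \<Sum>d\<in>UNIV. c i \<omega> * \<zeta> \<omega> $ d * v i \<omega> $ d)
      + (1 / lam)\<^sup>2 * (\<Sum>d\<in>UNIV. (\<zeta> \<omega> $ d)\<^sup>2)" for \<omega>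
  proof -
    define l where "l = gain \<beta> q lam (phase (hp \<omega>) (\<lambda>i. hr i \<omega>)) (hp \<omega>) (\<lambda>i. hr i \<omega>)"
    have l: "l i = a i * T i \<omega>" for i
    proof -
      have "l i = a i * aligned_channel K w (hp \<omega>) (\<lambda>i. hr i \<omega>) i"
        unfolding l_def a_def by (rule gain_eq_aligned_channel[OF phase])
      also have "aligned_channel K w (hp \<omega>) (\<lambda>i. hr i \<omega>) i = T i \<omega>"
        by (simp add: T_def aligned_channel_def u_def)
      finally show ?thesis .
    qed
    have split: "?Dv = targets K \<union> interferers K K'" "targets K \<inter> interferers K K' = {}" by auto
    have "(\<Sum>i\<in>?Dv. c i \<omega> *\<^sub>R v i \<omega>)
        = (\<Sum>k\<in>targets K. (l k - 1 / real K) *\<^sub>R g k \<omega>) + (\<Sum>m\<in>interferers K K'. l m *\<^sub>R gi m \<omega>)"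
      unfolding split(1)
      by (subst sum.union_disjoint) (auto simp: c_def v_def \<kappa>_def l intro!: arg_cong2[where f="(+)"] sum.cong)
    then have "gradient_estimate K K' lam l (\<lambda>k. g k \<omega>) (\<lambda>m. gi m \<omega>) (z \<omega>) - global_gradient K (\<lambda>k. g k \<omega>)
      = (\<Sum>i\<in>?Dv. c i \<omega> *\<^sub>R v i \<omega>) + (1 / lam) *\<^sub>R \<zeta> \<omega>"
      by (simp add: gradient_estimate_def global_gradient_def \<zeta>_def scaleR_diff_left sum_subtractf scaleR_sum_right)
    then show ?thesis
      by (simp add: squared_error_def l_def[symmetric] norm_sum_scaleR_power2)
  qed

  have T_mom: "integrable M (T i)" "(\<integral>\<omega>. T i \<omega> \<partial>M) = real N * (pi / 4 * (u i / W))"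
    "integrable M (\<lambda>\<omega>. T i \<omega> * T j \<omega>)"
    "(\<integral>\<omega>. T i \<omega> * T j \<omega> \<partial>M) = real N * ((of_bool (i = j) + u i * u j / W\<^sup>2) / 2)
      + real N * (real N - 1) * ((pi / 4)\<^sup>2 * (u i * u j / W\<^sup>2))"
    if ij: "i \<in> ?Dv" "j \<in> ?Dv" for i j
    unfolding T_def N by (rule aligned_channel_moments[OF hp hr ind W(1) Wu u0 ij]; assumption)+
  have c_mean: "integrable M (c i)" if "i \<in> ?Dv" for i
    unfolding c_def using T_mom(1)[OF that that] by simp
  have cc: "integrable M (\<lambda>\<omega>. c i \<omega> * c j \<omega>)"
    "(\<integral>\<omega>. c i \<omega> * c j \<omega> \<partial>M) = of_bool (i = j) * (real N * (a i)\<^sup>2 / 2) + \<kappa> i * \<kappa> j * ((8 - pi\<^sup>2) / (pi\<^sup>2 * real N))"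
    if ij: "i \<in> ?Dv" "j \<in> ?Dv" for i j
  proof -
    have e: "c i \<omega> * c j \<omega> = a i * a j * (T i \<omega> * T j \<omega>) - (a i * \<kappa> j) * T i \<omega> - (a j * \<kappa> i) * T j \<omega> + \<kappa> i * \<kappa> j" for \<omega>
      by (simp add: c_def algebra_simps)
    note ints = T_mom(3)[OF ij] T_mom(1)[OF ij(1) ij(1)] T_mom(1)[OF ij(2) ij(2)]
    show "integrable M (\<lambda>\<omega>. c i \<omega> * c j \<omega>)" unfolding e using ints by simp
    define \<rho> where "\<rho> = u i * u j / W\<^sup>2"
    have "(\<integral>\<omega>. c i \<omega> * c j \<omega> \<partial>M)
       = a i * a j * (\<integral>\<omega>. T i \<omega> * T j \<omega> \<partial>M) - a i * \<kappa> j * (\<integral>\<omega>. T i \<omega> \<partial>M) - a j * \<kappa> i * (\<integral>\<omega>. T j \<omega> \<partial>M) + \<kappa> i * \<kappa> j"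
      unfolding e using ints prob_space by simp
    also have "\<dots> = a i * a j * (real N * ((of_bool (i = j) + \<rho>) / 2) + real N * (real N - 1) * ((pi / 4)\<^sup>2 * \<rho>)) - \<kappa> i * \<kappa> j"
      unfolding T_mom(4)[OF ij] T_mom(2)[OF ij(1) ij(1)] T_mom(2)[OF ij(2) ij(2)] \<rho>_def[symmetric]
      by (simp only: mean') simp
    \<comment> \<open>The subtracted product of means is \<open>a i a j N \<rho>\<close> times
      \<open>N (pi / 4)^2\<close>. Against the factor \<open>1 / 2 + (N - 1) (pi / 4)^2\<close> this
      leaves \<open>1 / 2 - pi^2 / 16 = (8 - pi^2) / 16\<close>.\<close>
    also have "\<dots> = of_bool (i = j) * (real N * (a i)\<^sup>2 / 2) + a i * a j * real N * \<rho> * (1 / 2 + (real N - 1) * (pi / 4)\<^sup>2) - \<kappa> i * \<kappa> j"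
      by (cases "i = j") (simp_all add: algebra_simps power2_eq_square add_divide_distrib)
    also have "\<kappa> i * \<kappa> j = (a i * (real N * (pi / 4 * (u i / W)))) * (a j * (real N * (pi / 4 * (u j / W))))"
      by (simp only: mean)
    also have "\<dots> = a i * a j * real N * \<rho> * (real N * (pi / 4)\<^sup>2)"
      by (simp add: \<rho>_def power2_eq_square mult_ac)
    also have "of_bool (i = j) * (real N * (a i)\<^sup>2 / 2) + a i * a j * real N * \<rho> * (1 / 2 + (real N - 1) * (pi / 4)\<^sup>2)
        - a i * a j * real N * \<rho> * (real N * (pi / 4)\<^sup>2)
      = of_bool (i = j) * (real N * (a i)\<^sup>2 / 2) + a i * a j * real N * \<rho> * ((8 - pi\<^sup>2) / 16)"
      by (simp add: field_simps power2_eq_square)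
    finally have 1: "(\<integral>\<omega>. c i \<omega> * c j \<omega> \<partial>M)
      = of_bool (i = j) * (real N * (a i)\<^sup>2 / 2) + a i * a j * real N * \<rho> * ((8 - pi\<^sup>2) / 16)" .
    \<comment> \<open>Trades the scheme-dependent \<open>a i a j N \<rho>\<close> for
      \<open>\<kappa> i * \<kappa> j\<close> through unbiasedness. This is why the correlation term
      comes out the same in both schemes.\<close>
    have cancel: "x * (e / 16) = x * (real N * (pi / 4)\<^sup>2) * (e / (pi\<^sup>2 * real N))" for x e
      using Npos by (simp add: power2_eq_square)
    have "\<kappa> i * \<kappa> j = a i * a j * real N * \<rho> * (real N * (pi / 4)\<^sup>2)"
      unfolding mean[of i, symmetric] mean[of j, symmetric] by (simp add: \<rho>_def power2_eq_square mult_ac)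
    then have "a i * a j * real N * \<rho> * ((8 - pi\<^sup>2) / 16) = \<kappa> i * \<kappa> j * ((8 - pi\<^sup>2) / (pi\<^sup>2 * real N))"
      by (simp only: cancel)
    with 1 show "(\<integral>\<omega>. c i \<omega> * c j \<omega> \<partial>M)
      = of_bool (i = j) * (real N * (a i)\<^sup>2 / 2) + \<kappa> i * \<kappa> j * ((8 - pi\<^sup>2) / (pi\<^sup>2 * real N))" by simp
  qed

  define CS where "CS = (borel :: (complex ^ 'n) measure) \<Otimes>\<^sub>M (\<Pi>\<^sub>M i\<in>?Dv. (borel :: (complex ^ 'n) measure))"
  define SS where "SS = (\<Pi>\<^sub>M k\<in>targets K. (borel :: (real ^ 'd) measure)) \<Otimes>\<^sub>M (\<Pi>\<^sub>M m\<in>interferers K K'. (borel :: (real ^ 'd) measure))"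
  \<comment> \<open>\<open>cF\<close> and \<open>vF\<close> read the coefficient and the signal off
    the tuples whose independence is assumed; evaluated at those tuples they return \<open>c\<close>
    and \<open>v\<close>.\<close>
  define cF where "cF i x = a i * aligned_channel K u (fst x) (snd x) i - \<kappa> i" for i and x :: "(complex ^ 'n) \<times> (nat \<Rightarrow> complex ^ 'n)"
  define vF where "vF i y = (if i \<in> targets K then fst y i else snd y i)" for i and y :: "(nat \<Rightarrow> real ^ 'd) \<times> (nat \<Rightarrow> real ^ 'd)"
  have cF_meas: "cF i \<in> borel_measurable CS" if "i \<in> ?Dv" for i
    using measurable_aligned_channel[OF sub that, where w=u and 'n='n] unfolding cF_def CS_def by simp
  have vF_meas: "vF i \<in> borel_measurable SS" if "i \<in> ?Dv" for i
  proof (cases "i \<in> targets K")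
    case True
    then show ?thesis unfolding vF_def SS_def by simp
  next
    case False
    with that have "i \<in> interferers K K'" by auto
    then show ?thesis using False unfolding vF_def SS_def by simp
  qed
  have cF_eq: "cF i (hp \<omega>, \<lambda>i\<in>?Dv. hr i \<omega>) = c i \<omega>" if "i \<in> ?Dv" for i \<omega>
    using aligned_channel_restrict[OF sub that, where y="\<lambda>i. hr i \<omega>"] by (simp add: cF_def c_def T_def)
  have vF_eq: "vF i (\<lambda>k\<in>targets K. g k \<omega>, \<lambda>m\<in>interferers K K'. gi m \<omega>) = v i \<omega>" if "i \<in> ?Dv" for i \<omega>
    using that by (auto simp: vF_def v_def)

  have z_mom: "integrable M (\<lambda>\<omega>. \<zeta> \<omega> $ d)" "(\<integral>\<omega>. \<zeta> \<omega> $ d \<partial>M) = 0"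
    "integrable M (\<lambda>\<omega>. (\<zeta> \<omega> $ d)\<^sup>2)" "(\<integral>\<omega>. (\<zeta> \<omega> $ d)\<^sup>2 \<partial>M) = \<sigma>\<^sup>2 / 2" for d
  proof -
    have "z \<in> borel_measurable M" "distr M borel (\<lambda>\<omega>. z \<omega> $ d) = complex_normal (\<sigma>\<^sup>2)"
      using z by (auto simp: complex_normal_vector_def)
    moreover from this have "(\<lambda>\<omega>. z \<omega> $ d) \<in> borel_measurable M" by measurable
    ultimately show "integrable M (\<lambda>\<omega>. \<zeta> \<omega> $ d)" "(\<integral>\<omega>. \<zeta> \<omega> $ d \<partial>M) = 0"
      "integrable M (\<lambda>\<omega>. (\<zeta> \<omega> $ d)\<^sup>2)" "(\<integral>\<omega>. (\<zeta> \<omega> $ d)\<^sup>2 \<partial>M) = \<sigma>\<^sup>2 / 2"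
      using complex_normal_Re_moments[of "\<lambda>\<omega>. z \<omega> $ d" "\<sigma>\<^sup>2"] by (simp_all add: \<zeta>_def)
  qed

  have vm: "v i \<in> borel_measurable M" if "i \<in> ?Dv" for i
    using that gm[of i] gim[of i] by (cases "i \<in> targets K") (auto simp: v_def[abs_def])
  \<comment> \<open>The bound \<open>max G 1\<close> serves gradients of norm at most
    \<open>G\<close> and interference of norm \<open>1\<close> together.\<close>
  have vb: "AE \<omega> in M. norm (v i \<omega>) \<le> max G 1" if "i \<in> ?Dv" for i
  proof (cases "i \<in> targets K")
    case True
    with gb[OF True] show ?thesis by (auto simp: v_def elim: eventually_mono)
  next
    case False
    with that have "i \<in> interferers K K'" by auto
    from gib[OF this] False show ?thesis by (auto simp: v_def elim: eventually_mono)
  qed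
  have vv: "integrable M (\<lambda>\<omega>. v i \<omega> \<bullet> v j \<omega>)" if "i \<in> ?Dv" "j \<in> ?Dv" for i j
  proof (rule integrable_const_bound)
    show "AE \<omega> in M. norm (v i \<omega> \<bullet> v j \<omega>) \<le> max G 1 * max G 1"
      using vb[OF that(1)] vb[OF that(2)]
    proof eventually_elim
      case (elim \<omega>)
      have "norm (v i \<omega> \<bullet> v j \<omega>) \<le> norm (v i \<omega>) * norm (v j \<omega>)"
        using Cauchy_Schwarz_ineq2[of "v i \<omega>" "v j \<omega>"] by simp
      also have "\<dots> \<le> max G 1 * max G 1" using elim by (intro mult_mono) auto
      finally show ?case .
    qed
    show "(\<lambda>\<omega>. v i \<omega> \<bullet> v j \<omega>) \<in> borel_measurable M"
      using vm[OF that(1)] vm[OF that(2)] by measurable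
  qed
  have vd: "integrable M (\<lambda>\<omega>. v i \<omega> $ d)" if "i \<in> ?Dv" for i d
  proof (rule integrable_const_bound)
    show "AE \<omega> in M. norm (v i \<omega> $ d) \<le> max G 1"
      using vb[OF that] by eventually_elim (use component_le_norm_cart in \<open>auto intro: order_trans\<close>)
    show "(\<lambda>\<omega>. v i \<omega> $ d) \<in> borel_measurable M" using vm[OF that] by measurable
  qed

  have quad: "integrable M (\<lambda>\<omega>. c i \<omega> * c j \<omega> * (v i \<omega> \<bullet> v j \<omega>))"
    "(\<integral>\<omega>. c i \<omega> * c j \<omega> * (v i \<omega> \<bullet> v j \<omega>) \<partial>M) = (\<integral>\<omega>. c i \<omega> * c j \<omega> \<partial>M) * (\<integral>\<omega>. v i \<omega> \<bullet> v j \<omega> \<partial>M)"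
    if ij: "i \<in> ?Dv" "j \<in> ?Dv" for i j
  proof -
    have m: "(\<lambda>x. cF i x * cF j x) \<in> borel_measurable CS" "(\<lambda>y. vF i y \<bullet> vF j y) \<in> borel_measurable SS"
      using ij cF_meas vF_meas by auto
    \<comment> \<open>The quadratic terms contain no noise; the constant \<open>1\<close> takes its
      place in the triple product.\<close>
    have one: "(\<lambda>_. 1 :: real) \<in> borel_measurable borel" by simp
    have int1: "integrable M (\<lambda>_. 1 :: real)" by simp
    note trip' = indep_triple_integral[OF trip[folded CS_def SS_def] m(1) one m(2),
        unfolded cF_eq[OF ij(1)] cF_eq[OF ij(2)] vF_eq[OF ij(1)] vF_eq[OF ij(2)] mult_1_right,
        OF cc(1)[OF ij] int1 vv[OF ij]]
    show "integrable M (\<lambda>\<omega>. c i \<omega> * c j \<omega> * (v i \<omega> \<bullet> v j \<omega>))"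
      by (rule trip'(1))
    show "(\<integral>\<omega>. c i \<omega> * c j \<omega> * (v i \<omega> \<bullet> v j \<omega>) \<partial>M) = (\<integral>\<omega>. c i \<omega> * c j \<omega> \<partial>M) * (\<integral>\<omega>. v i \<omega> \<bullet> v j \<omega> \<partial>M)"
      using trip'(2) by (simp add: prob_space)
  qed
  have cross: "integrable M (\<lambda>\<omega>. c i \<omega> * \<zeta> \<omega> $ d * v i \<omega> $ d)"
    "(\<integral>\<omega>. c i \<omega> * \<zeta> \<omega> $ d * v i \<omega> $ d \<partial>M) = 0" if i: "i \<in> ?Dv" for i d
  proof -
    have m: "cF i \<in> borel_measurable CS" "(\<lambda>y. vF i y $ d) \<in> borel_measurable SS"
      "(\<lambda>x :: complex ^ 'd. Re (x $ d)) \<in> borel_measurable borel"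
      using i cF_meas vF_meas by auto
    have \<zeta>: "Re (z \<omega> $ d) = \<zeta> \<omega> $ d" for \<omega> by (simp add: \<zeta>_def)
    note trip' = indep_triple_integral[OF trip[folded CS_def SS_def] m(1) m(3) m(2),
        unfolded cF_eq[OF i] vF_eq[OF i] \<zeta>, OF c_mean[OF i] z_mom(1) vd[OF i]]
    show "integrable M (\<lambda>\<omega>. c i \<omega> * \<zeta> \<omega> $ d * v i \<omega> $ d)"
      by (rule trip'(1))
    show "(\<integral>\<omega>. c i \<omega> * \<zeta> \<omega> $ d * v i \<omega> $ d \<partial>M) = 0"
      using trip'(2) by (simp add: z_mom(2))
  qed

  show "integrable M (squared_error K K' \<beta> q lam phase hp hr g gi z)"
    unfolding err[abs_def]
    by (intro Bochner_Integration.integrable_add integrable_mult_right Bochner_Integration.integrable_sum quad(1) cross(1) z_mom(3))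

  define S where "S i j = (\<integral>\<omega>. v i \<omega> \<bullet> v j \<omega> \<partial>M)" for i j
  have "MSE M K K' \<beta> q lam phase hp hr g gi z
    = (\<Sum>i\<in>?Dv. \<Sum>j\<in>?Dv. \<integral>\<omega>. c i \<omega> * c j \<omega> * (v i \<omega> \<bullet> v j \<omega>) \<partial>M)
      + 2 * (1 / lam) * (\<Sum>i\<in>?Dv. \<Sum>d\<in>UNIV. \<integral>\<omega>. c i \<omega> * \<zeta> \<omega> $ d * v i \<omega> $ d \<partial>M)
      + (1 / lam)\<^sup>2 * (\<Sum>d\<in>UNIV. \<integral>\<omega>. (\<zeta> \<omega> $ d)\<^sup>2 \<partial>M)"
  proof -
    have 1: "integrable M (\<lambda>\<omega>. \<Sum>i\<in>?Dv. \<Sum>j\<in>?Dv. c i \<omega> * c j \<omega> * (v i \<omega> \<bullet> v j \<omega>))"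
      "(\<integral>\<omega>. (\<Sum>i\<in>?Dv. \<Sum>j\<in>?Dv. c i \<omega> * c j \<omega> * (v i \<omega> \<bullet> v j \<omega>)) \<partial>M)
        = (\<Sum>i\<in>?Dv. \<Sum>j\<in>?Dv. \<integral>\<omega>. c i \<omega> * c j \<omega> * (v i \<omega> \<bullet> v j \<omega>) \<partial>M)"
      by (rule integral_sum_sum, rule quad(1), assumption+)+
    have 2: "integrable M (\<lambda>\<omega>. \<Sum>i\<in>?Dv. \<Sum>d\<in>UNIV. c i \<omega> * \<zeta> \<omega> $ d * v i \<omega> $ d)"
      "(\<integral>\<omega>. (\<Sum>i\<in>?Dv. \<Sum>d\<in>UNIV. c i \<omega> * \<zeta> \<omega> $ d * v i \<omega> $ d) \<partial>M)
        = (\<Sum>i\<in>?Dv. \<Sum>d\<in>UNIV. \<integral>\<omega>. c i \<omega> * \<zeta> \<omega> $ d * v i \<omega> $ d \<partial>M)"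
      by (rule integral_sum_sum, rule cross(1), assumption+)+
    have 3: "integrable M (\<lambda>\<omega>. \<Sum>d\<in>UNIV. (\<zeta> \<omega> $ d)\<^sup>2)"
      "(\<integral>\<omega>. (\<Sum>d\<in>UNIV. (\<zeta> \<omega> $ d)\<^sup>2) \<partial>M) = (\<Sum>d\<in>UNIV. \<integral>\<omega>. (\<zeta> \<omega> $ d)\<^sup>2 \<partial>M)"
      using z_mom(3) by (simp_all add: Bochner_Integration.integral_sum)
    show ?thesis unfolding MSE_def err
      by (simp only: Bochner_Integration.integral_add integrable_mult_right Bochner_Integration.integrable_add
          1 2 3 integral_mult_right_zero)
  qed
  also have "\<dots> = (\<Sum>i\<in>?Dv. \<Sum>j\<in>?Dv. (of_bool (i = j) * (real N * (a i)\<^sup>2 / 2)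
        + \<kappa> i * \<kappa> j * ((8 - pi\<^sup>2) / (pi\<^sup>2 * real N))) * S i j) + \<sigma>\<^sup>2 * real D / (2 * lam\<^sup>2)"
  proof -
    have 1: "(\<Sum>i\<in>?Dv. \<Sum>j\<in>?Dv. \<integral>\<omega>. c i \<omega> * c j \<omega> * (v i \<omega> \<bullet> v j \<omega>) \<partial>M)
      = (\<Sum>i\<in>?Dv. \<Sum>j\<in>?Dv. (of_bool (i = j) * (real N * (a i)\<^sup>2 / 2)
        + \<kappa> i * \<kappa> j * ((8 - pi\<^sup>2) / (pi\<^sup>2 * real N))) * S i j)"
      by (intro sum.cong refl) (simp only: quad(2) cc(2) S_def)
    have 2: "(\<Sum>i\<in>?Dv. \<Sum>d\<in>UNIV. \<integral>\<omega>. c i \<omega> * \<zeta> \<omega> $ d * v i \<omega> $ d \<partial>M) = 0"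
      by (intro sum.neutral ballI cross(2))
    show ?thesis unfolding 1 2 by (simp add: z_mom(4) D power_divide mult.commute)
  qed
  also have "(\<Sum>i\<in>?Dv. \<Sum>j\<in>?Dv. (of_bool (i = j) * (real N * (a i)\<^sup>2 / 2)
        + \<kappa> i * \<kappa> j * ((8 - pi\<^sup>2) / (pi\<^sup>2 * real N))) * S i j)
     = (\<Sum>i\<in>?Dv. \<Sum>j\<in>?Dv. if i = j then real N * (a i)\<^sup>2 / 2 * S i i else 0)
       + (8 - pi\<^sup>2) / (pi\<^sup>2 * real N) * (\<Sum>i\<in>?Dv. \<Sum>j\<in>?Dv. \<kappa> i * \<kappa> j * S i j)"
    unfolding sum_distrib_left sum.distrib[symmetric]
    by (intro sum.cong refl) (simp add: algebra_simps)
  also have "(\<Sum>i\<in>?Dv. \<Sum>j\<in>?Dv. if i = j then real N * (a i)\<^sup>2 / 2 * S i i else 0) = (\<Sum>i\<in>?Dv. real N * (a i)\<^sup>2 / 2 * S i i)"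
    by simp
  also have "\<dots> = (\<Sum>k\<in>targets K. real N * (a k)\<^sup>2 / 2 * S k k) + (\<Sum>m\<in>interferers K K'. real N * (a m)\<^sup>2 / 2 * S m m)"
  proof -
    have 1: "?Dv = targets K \<union> interferers K K'" and 2: "targets K \<inter> interferers K K' = {}" by auto
    show ?thesis unfolding 1 by (rule sum.union_disjoint[OF _ _ 2]) simp_all
  qed
  also have "(\<Sum>k\<in>targets K. real N * (a k)\<^sup>2 / 2 * S k k) = (\<Sum>k\<in>targets K. real N * (a k)\<^sup>2 / 2 * (\<integral>\<omega>. (norm (g k \<omega>))\<^sup>2 \<partial>M))"
    by (intro sum.cong refl) (simp add: S_def v_def power2_norm_eq_inner)
  also have "(\<Sum>m\<in>interferers K K'. real N * (a m)\<^sup>2 / 2 * S m m) = (\<Sum>m\<in>interferers K K'. real N * (a m)\<^sup>2 / 2)"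
  proof (rule sum.cong[OF refl])
    fix m assume m: "m \<in> interferers K K'"
    have "S m m = (\<integral>\<omega>. 1 \<partial>M)"
      unfolding S_def
    proof (rule integral_cong_AE)
      show "AE \<omega> in M. v m \<omega> \<bullet> v m \<omega> = 1"
        using gib[OF m] by eventually_elim (use m in \<open>auto simp: v_def dot_square_norm\<close>)
      show "(\<lambda>\<omega>. v m \<omega> \<bullet> v m \<omega>) \<in> borel_measurable M"
        using vm[of m] m by auto
    qed simp
    then show "real N * (a m)\<^sup>2 / 2 * S m m = real N * (a m)\<^sup>2 / 2" using prob_space by simp
  qed
  \<comment> \<open>Since \<open>\<kappa>\<close> vanishes off the targets, interferers retain only
    the diagonal terms split off above.\<close>
  also have "(\<Sum>i\<in>?Dv. \<Sum>j\<in>?Dv. \<kappa> i * \<kappa> j * S i j) = (\<Sum>i\<in>targets K. \<Sum>j\<in>targets K. \<kappa> i * \<kappa> j * S i j)"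
  proof -
    have "(\<Sum>i\<in>?Dv. \<Sum>j\<in>?Dv. \<kappa> i * \<kappa> j * S i j) = (\<Sum>i\<in>targets K. \<Sum>j\<in>?Dv. \<kappa> i * \<kappa> j * S i j)"
      by (rule sum.mono_neutral_right) (use sub in \<open>auto simp: \<kappa>_def\<close>)
    also have "\<dots> = (\<Sum>i\<in>targets K. \<Sum>j\<in>targets K. \<kappa> i * \<kappa> j * S i j)"
      by (intro sum.cong[OF refl] sum.mono_neutral_right) (use sub in \<open>auto simp: \<kappa>_def\<close>)
    finally show ?thesis .
  qed
  also have "\<dots> = (1 / (real K)\<^sup>2) * (\<Sum>k\<in>targets K. \<Sum>k'\<in>targets K. \<integral>\<omega>. g k \<omega> \<bullet> g k' \<omega> \<partial>M)"
    unfolding sum_distrib_left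
    by (intro sum.cong refl) (simp add: \<kappa>_def S_def v_def power2_eq_square)
  finally show "MSE M K K' \<beta> q lam phase hp hr g gi z
      = (\<Sum>k\<in>targets K. real N * (a k)\<^sup>2 / 2 * (\<integral>\<omega>. (norm (g k \<omega>))\<^sup>2 \<partial>M))
        + (8 - pi\<^sup>2) / (pi\<^sup>2 * real N * (real K)\<^sup>2)
          * (\<Sum>k\<in>targets K. \<Sum>k'\<in>targets K. \<integral>\<omega>. g k \<omega> \<bullet> g k' \<omega> \<partial>M)
        + (\<Sum>m\<in>interferers K K'. real N * (a m)\<^sup>2 / 2)
        + \<sigma>\<^sup>2 * real D / (2 * lam\<^sup>2)"
    by (simp add: ac_simps)
qed

end

section \<open>Specialisation to the two schemes\<close>

lemma Min_power2_image:
  fixes f :: "'i \<Rightarrow> real"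
  assumes "finite A" "A \<noteq> {}" "\<And>x. x \<in> A \<Longrightarrow> f x \<ge> 0"
  shows "(MIN x\<in>A. (f x)\<^sup>2) = (MIN x\<in>A. f x)\<^sup>2"
proof (rule Min_eqI)
  have "(MIN x\<in>A. f x) \<in> f ` A" using assms by (intro Min_in) auto
  then obtain x where x: "x \<in> A" "(MIN x\<in>A. f x) = f x" by auto
  then show "(MIN x\<in>A. f x)\<^sup>2 \<in> (\<lambda>x. (f x)\<^sup>2) ` A" by auto
  fix y assume "y \<in> (\<lambda>x. (f x)\<^sup>2) ` A"
  then obtain x' where x': "x' \<in> A" "y = (f x')\<^sup>2" by auto
  then have "(MIN x\<in>A. f x) \<le> f x'" using assms by (intro Min_le) auto
  then show "(MIN x\<in>A. f x)\<^sup>2 \<le> y" using x x' assms by (auto intro!: power_mono)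
qed (use assms in auto)

theorem theorem3:
  fixes \<Omega> :: "'a measure"
    and K M N D :: nat
    and hp :: "'a \<Rightarrow> complex ^ 'n"
    and hr :: "nat \<Rightarrow> 'a \<Rightarrow> complex ^ 'n"
    and g gi :: "nat \<Rightarrow> 'a \<Rightarrow> real ^ 'd"
    and z :: "'a \<Rightarrow> complex ^ 'd"
    and \<beta> P \<alpha> :: "nat \<Rightarrow> real"
    and G \<sigma> :: real
  assumes "prob_space \<Omega>"
    and "K \<ge> 1" and "M \<ge> 1" and "N = CARD('n)" and "D = CARD('d)"
    and "\<And>i. i \<in> devices K M \<Longrightarrow> \<beta> i > 0"
    and "\<And>i. i \<in> devices K M \<Longrightarrow> P i > 0"
    and "G > 0"
    and "complex_normal_vector \<Omega> 1 hp"
    and "\<And>i. i \<in> devices K M \<Longrightarrow> complex_normal_vector \<Omega> 1 (hr i)"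
    and "prob_space.indep_vars \<Omega> (\<lambda>_. borel) (case_option hp hr)
           (insert None (Some ` devices K M))"
    and "complex_normal_vector \<Omega> (\<sigma>\<^sup>2) z"
    and "\<And>k. k \<in> targets K \<Longrightarrow> g k \<in> borel_measurable \<Omega>"
    and "\<And>k. k \<in> targets K \<Longrightarrow> AE \<omega> in \<Omega>. norm (g k \<omega>) \<le> G"
    and "\<And>m. m \<in> interferers K M \<Longrightarrow> gi m \<in> borel_measurable \<Omega>"
    and "\<And>m. m \<in> interferers K M \<Longrightarrow> AE \<omega> in \<Omega>. norm (gi m \<omega>) = 1"
    and "indep_triple \<Omega>
           (borel \<Otimes>\<^sub>M (\<Pi>\<^sub>M i\<in>devices K M. borel))
             (\<lambda>\<omega>. (hp \<omega>, \<lambda>i\<in>devices K M. hr i \<omega>))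
           borel z
           ((\<Pi>\<^sub>M k\<in>targets K. borel) \<Otimes>\<^sub>M (\<Pi>\<^sub>M m\<in>interferers K M. borel))
             (\<lambda>\<omega>. (\<lambda>k\<in>targets K. g k \<omega>, \<lambda>m\<in>interferers K M. gi m \<omega>))"
    and "\<And>i. i \<in> devices K M \<Longrightarrow> \<alpha> i = \<beta> i * sqrt (P i)"
  shows
    "(integrable \<Omega> (squared_error K M \<beta> (power_I K \<beta> P G) (lambda_I N K \<beta> P G) (phase_I K)
       hp hr g gi z) \<and>
     MSE \<Omega> K M \<beta> (power_I K \<beta> P G) (lambda_I N K \<beta> P G) (phase_I K) hp hr g gi z =
       (8 * (real K + 1) - pi\<^sup>2) / (pi\<^sup>2 * real N * (real K)\<^sup>2)
         * (\<Sum>k\<in>targets K. \<integral>\<omega>. (norm (g k \<omega>))\<^sup>2 \<partial>\<Omega>)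
       + (8 - pi\<^sup>2) / (pi\<^sup>2 * real N * (real K)\<^sup>2)
         * (\<Sum>k\<in>targets K. \<Sum>k'\<in>targets K - {k}. \<integral>\<omega>. g k \<omega> \<bullet> g k' \<omega> \<partial>\<Omega>)
       + (\<Sum>m\<in>interferers K M. 8 * G\<^sup>2 * (\<alpha> m)\<^sup>2
           / (pi\<^sup>2 * real N * real K * (MIN k\<in>targets K. (\<alpha> k)\<^sup>2)))
       + 8 * G\<^sup>2 * \<sigma>\<^sup>2 * real D
           / (pi\<^sup>2 * (real N)\<^sup>2 * real K * (MIN k\<in>targets K. (\<alpha> k)\<^sup>2))) \<and>
    (integrable \<Omega> (squared_error K M \<beta> (power_II K P G) (lambda_II N K \<beta> P G) (phase_II K \<beta> P)
       hp hr g gi z) \<and>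
     MSE \<Omega> K M \<beta> (power_II K P G) (lambda_II N K \<beta> P G) (phase_II K \<beta> P) hp hr g gi z =
       (\<Sum>k\<in>targets K.
          (8 * ((\<Sum>i\<in>targets K. \<alpha> i powi (-2)) / \<alpha> k powi (-2) + 1) - pi\<^sup>2)
            / (pi\<^sup>2 * real N * (real K)\<^sup>2)
          * (\<integral>\<omega>. (norm (g k \<omega>))\<^sup>2 \<partial>\<Omega>))
       + (8 - pi\<^sup>2) / (pi\<^sup>2 * real N * (real K)\<^sup>2)
         * (\<Sum>k\<in>targets K. \<Sum>k'\<in>targets K - {k}. \<integral>\<omega>. g k \<omega> \<bullet> g k' \<omega> \<partial>\<Omega>)
       + (\<Sum>m\<in>interferers K M. 8 * G\<^sup>2 * (\<Sum>i\<in>targets K. \<alpha> i powi (-2))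
           / (pi\<^sup>2 * real N * (real K)\<^sup>2 * \<alpha> m powi (-2)))
       + 8 * G\<^sup>2 * \<sigma>\<^sup>2 * real D * (\<Sum>i\<in>targets K. \<alpha> i powi (-2))
           / (pi\<^sup>2 * (real N)\<^sup>2 * (real K)\<^sup>2))"
proof -
  interpret prob_space \<Omega> by fact
  have K: "real K > 0" using assms(2) by simp
  have N: "real N > 0" unfolding assms(4) by simp
  have \<alpha>: "\<alpha> i = sqrt (P i) * \<beta> i" "\<alpha> i > 0" if "i \<in> devices K M" for i
    using assms(6,7,18)[OF that] by auto
  have sub: "i \<in> targets K \<Longrightarrow> i \<in> devices K M" "i \<in> interferers K M \<Longrightarrow> i \<in> devices K M" for i by auto
  have disj: "i \<notin> targets K" if "i \<in> interferers K M" for i using that by auto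
  have G: "G > 0" by fact
  define E where "E k = (\<integral>\<omega>. (norm (g k \<omega>))\<^sup>2 \<partial>\<Omega>)" for k
  define C where "C = (\<Sum>k\<in>targets K. \<Sum>k'\<in>targets K - {k}. \<integral>\<omega>. g k \<omega> \<bullet> g k' \<omega> \<partial>\<Omega>)"
  have diag: "(\<Sum>k\<in>targets K. \<Sum>k'\<in>targets K. \<integral>\<omega>. g k \<omega> \<bullet> g k' \<omega> \<partial>\<Omega>) = (\<Sum>k\<in>targets K. E k) + C"
    unfolding C_def sum.distrib[symmetric]
    by (intro sum.cong refl) (simp add: sum.remove E_def power2_norm_eq_inner)
  \<comment> \<open>The general formula sums over all pairs of targets; its diagonal share is moved
    into the coefficients of the squared norms, and \<open>C\<close> keeps the pairs with
    \<open>k' \<noteq> k\<close>.\<close>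
  have combine: "(\<Sum>k\<in>targets K. b k * E k) + r * ((\<Sum>k\<in>targets K. E k) + C) = (\<Sum>k\<in>targets K. (b k + r) * E k) + r * C" for b r
    by (simp add: sum.distrib sum_distrib_left algebra_simps)

  define \<mu> where "\<mu> = (MIN k\<in>targets K. sqrt (P k) * \<beta> k)"
  have \<mu>: "\<mu> > 0"
    unfolding \<mu>_def using assms(2) \<alpha> sub by (subst Min_gr_iff) auto
  have \<mu>2: "(MIN k\<in>targets K. (\<alpha> k)\<^sup>2) = \<mu>\<^sup>2"
  proof -
    have "(MIN k\<in>targets K. (\<alpha> k)\<^sup>2) = (MIN k\<in>targets K. (sqrt (P k) * \<beta> k)\<^sup>2)"
      using \<alpha>(1)[OF sub(1)] by (intro arg_cong[where f=Min] image_cong refl) auto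
    also have "\<dots> = \<mu>\<^sup>2"
      unfolding \<mu>_def using assms(2) \<alpha> sub by (intro Min_power2_image) (auto intro!: less_imp_le)
    finally show ?thesis .
  qed
  define L1 where "L1 = lambda_I N K \<beta> P G"
  have L1: "L1 = pi * real N * sqrt (real K) * \<mu> / (4 * G)" by (simp add: L1_def lambda_I_def \<mu>_def)
  \<comment> \<open>The powers of Scheme I invert the fading, so every target is received with
    amplitude \<open>\<mu> / G\<close>, which cancels against \<open>L1\<close>.\<close>
  have a1: "\<beta> k * sqrt (power_I K \<beta> P G k) / L1 = 4 / (pi * real N * sqrt (real K))" if "k \<in> targets K" for k
  proof -
    have "power_I K \<beta> P G k = (inverse (\<beta> k) * (\<mu> / G))\<^sup>2"
      using that by (simp only: power_I_def \<mu>_def if_True)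
    then have "\<beta> k * sqrt (power_I K \<beta> P G k) = \<mu> / G"
      using assms(6)[OF sub(1)[OF that]] \<mu> G by simp
    then show ?thesis using \<mu> G N K by (simp add: L1 field_simps)
  qed
  have a1': "\<beta> m * sqrt (power_I K \<beta> P G m) / L1 = 4 * G * \<alpha> m / (pi * real N * sqrt (real K) * \<mu>)"
    if "m \<in> interferers K M" for m
  proof -
    have "power_I K \<beta> P G m = P m" using disj[OF that] by (simp only: power_I_def if_False)
    then show ?thesis using \<alpha>(1)[OF sub(2)[OF that]] \<mu> G N K by (simp add: L1 field_simps)
  qed
  \<comment> \<open>All weights are \<open>1\<close>, so \<open>W = sqrt K\<close>: one factor
    \<open>1 / sqrt K\<close> comes from \<open>L1\<close>, the other from the share
    \<open>w k / W\<close>.\<close>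
  have un1: "\<beta> k * sqrt (power_I K \<beta> P G k) / lambda_I N K \<beta> P G * (real N * (pi / 4 * (1 / sqrt (real K)))) = 1 / real K"
    if "k \<in> targets K" for k
    unfolding L1_def[symmetric] a1[OF that] using N K by (simp add: field_simps)
  have ph1: "phase_I K x y $ n = - Arg (cnj (x $ n)) + Arg (\<Sum>l\<in>targets K. complex_of_real 1 * cnj (y l $ n))"
    for x :: "complex ^ 'n" and y n
    by (simp add: phase_I_def)
  have W1: "sqrt (real K) > 0" "(sqrt (real K))\<^sup>2 = (\<Sum>k\<in>targets K. (1 :: real)\<^sup>2)" using K by simp_all
  have "MSE \<Omega> K M \<beta> (power_I K \<beta> P G) L1 (phase_I K) hp hr g gi z
    = (\<Sum>k\<in>targets K. 8 / (pi\<^sup>2 * real N * real K) * E k)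
      + (8 - pi\<^sup>2) / (pi\<^sup>2 * real N * (real K)\<^sup>2) * ((\<Sum>k\<in>targets K. E k) + C)
      + (\<Sum>m\<in>interferers K M. 8 * G\<^sup>2 * (\<alpha> m)\<^sup>2 / (pi\<^sup>2 * real N * real K * \<mu>\<^sup>2))
      + 8 * G\<^sup>2 * \<sigma>\<^sup>2 * real D / (pi\<^sup>2 * (real N)\<^sup>2 * real K * \<mu>\<^sup>2)"
  proof -
    have 1: "real N * (\<beta> k * sqrt (power_I K \<beta> P G k) / L1)\<^sup>2 / 2 = 8 / (pi\<^sup>2 * real N * real K)"
      if "k \<in> targets K" for k
      unfolding a1[OF that] using N K by (simp add: power_divide power_mult_distrib field_simps power2_eq_square)
    have 2: "real N * (\<beta> m * sqrt (power_I K \<beta> P G m) / L1)\<^sup>2 / 2 = 8 * G\<^sup>2 * (\<alpha> m)\<^sup>2 / (pi\<^sup>2 * real N * real K * \<mu>\<^sup>2)"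
      if "m \<in> interferers K M" for m
      unfolding a1'[OF that] using N K by (simp add: power_divide power_mult_distrib field_simps power2_eq_square)
    have 3: "\<sigma>\<^sup>2 * real D / (2 * L1\<^sup>2) = 8 * G\<^sup>2 * \<sigma>\<^sup>2 * real D / (pi\<^sup>2 * (real N)\<^sup>2 * real K * \<mu>\<^sup>2)"
      unfolding L1 using N K by (simp add: power_divide power_mult_distrib mult_ac)
    have "MSE \<Omega> K M \<beta> (power_I K \<beta> P G) (lambda_I N K \<beta> P G) (phase_I K) hp hr g gi z
      = (\<Sum>k\<in>targets K. real N * (\<beta> k * sqrt (power_I K \<beta> P G k) / lambda_I N K \<beta> P G)\<^sup>2 / 2 * (\<integral>\<omega>. (norm (g k \<omega>))\<^sup>2 \<partial>\<Omega>))
        + (8 - pi\<^sup>2) / (pi\<^sup>2 * real N * (real K)\<^sup>2) * (\<Sum>k\<in>targets K. \<Sum>k'\<in>targets K. \<integral>\<omega>. g k \<omega> \<bullet> g k' \<omega> \<partial>\<Omega>)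
        + (\<Sum>m\<in>interferers K M. real N * (\<beta> m * sqrt (power_I K \<beta> P G m) / lambda_I N K \<beta> P G)\<^sup>2 / 2)
        + \<sigma>\<^sup>2 * real D / (2 * (lambda_I N K \<beta> P G)\<^sup>2)"
      by (rule aligned_unbiased_MSE(2)[where w="\<lambda>_. 1" and W="sqrt (real K)"]) (fact assms ph1 W1 un1)+
    then show ?thesis
      by (simp only: L1_def[symmetric] diag E_def[symmetric] 1 2 3 cong: sum.cong)
  qed
  also have "(\<Sum>k\<in>targets K. 8 / (pi\<^sup>2 * real N * real K) * E k)
      + (8 - pi\<^sup>2) / (pi\<^sup>2 * real N * (real K)\<^sup>2) * ((\<Sum>k\<in>targets K. E k) + C)
    = (8 * (real K + 1) - pi\<^sup>2) / (pi\<^sup>2 * real N * (real K)\<^sup>2) * (\<Sum>k\<in>targets K. E k)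
      + (8 - pi\<^sup>2) / (pi\<^sup>2 * real N * (real K)\<^sup>2) * C"
  proof -
    \<comment> \<open>Over the denominator with \<open>K^2\<close> the first numerator is
      \<open>8 K\<close>; together with \<open>8 - pi^2\<close> it explains
      \<open>K + 1\<close>.\<close>
    have "8 / (pi\<^sup>2 * real N * real K) + (8 - pi\<^sup>2) / (pi\<^sup>2 * real N * (real K)\<^sup>2)
      = (8 * (real K + 1) - pi\<^sup>2) / (pi\<^sup>2 * real N * (real K)\<^sup>2)"
      using N K by (simp add: field_simps power2_eq_square)
    then show ?thesis unfolding combine by (simp only: sum_distrib_left)
  qed
  finally have MSE_I: "MSE \<Omega> K M \<beta> (power_I K \<beta> P G) L1 (phase_I K) hp hr g gi z
    = (8 * (real K + 1) - pi\<^sup>2) / (pi\<^sup>2 * real N * (real K)\<^sup>2) * (\<Sum>k\<in>targets K. E k)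
      + (8 - pi\<^sup>2) / (pi\<^sup>2 * real N * (real K)\<^sup>2) * C
      + (\<Sum>m\<in>interferers K M. 8 * G\<^sup>2 * (\<alpha> m)\<^sup>2 / (pi\<^sup>2 * real N * real K * \<mu>\<^sup>2))
      + 8 * G\<^sup>2 * \<sigma>\<^sup>2 * real D / (pi\<^sup>2 * (real N)\<^sup>2 * real K * \<mu>\<^sup>2)" .
  have int_I: "integrable \<Omega> (squared_error K M \<beta> (power_I K \<beta> P G) (lambda_I N K \<beta> P G) (phase_I K) hp hr g gi z)"
    by (rule aligned_unbiased_MSE(1)[where w="\<lambda>_. 1" and W="sqrt (real K)"]) (fact assms ph1 W1 un1)+

  define W where "W = sqrt (\<Sum>k\<in>targets K. (weight_II \<beta> P k)\<^sup>2)"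
  have weight: "weight_II \<beta> P k = 1 / \<alpha> k" if "k \<in> targets K" for k
    using \<alpha>(1)[OF sub(1)[OF that]] by (simp add: weight_II_def mult.commute)
  have inv2: "x powi (- 2) = 1 / x\<^sup>2" for x :: real
    by (simp add: power_int_minus field_simps)
  have W2: "W\<^sup>2 = (\<Sum>k\<in>targets K. (weight_II \<beta> P k)\<^sup>2)" by (simp add: W_def sum_nonneg)
  \<comment> \<open>As \<open>w k = 1 / \<alpha> k\<close>, the sum of inverse squares in the claim
    is the squared norm of the weights.\<close>
  have W\<alpha>: "(\<Sum>i\<in>targets K. \<alpha> i powi (- 2)) = W\<^sup>2"
    unfolding W2 by (intro sum.cong refl) (simp add: inv2 weight power_divide)
  have W: "W > 0"
  proof -
    have "(\<Sum>k\<in>targets K. (weight_II \<beta> P k)\<^sup>2) > 0"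
      using assms(2) \<alpha>(2) sub(1) by (intro sum_pos) (force simp: weight)+
    then show ?thesis by (simp add: W_def)
  qed
  define L2 where "L2 = lambda_II N K \<beta> P G"
  have L2: "L2 = pi * real N * real K / (4 * G * W)" by (simp add: L2_def lambda_II_def W_def)
  \<comment> \<open>A target transmits with its full amplitude divided by \<open>G\<close>, which
    cancels the \<open>G\<close> brought in by \<open>L2\<close>; an interferer has no such division
    and keeps the factor.\<close>
  have a2: "\<beta> i * sqrt (power_II K P G i) / L2 = (if i \<in> targets K then 1 else G) * (4 * \<alpha> i * W / (pi * real N * real K))"
    if "i \<in> devices K M" for i
  proof (cases "i \<in> targets K")
    case True
    then have "power_II K P G i = (sqrt (P i) / G)\<^sup>2" by (simp only: power_II_def if_True)
    then have s: "sqrt (power_II K P G i) = sqrt (P i) / G" using assms(7)[OF that] G by simp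
    show ?thesis
      unfolding s if_P[OF True] using \<alpha>(1)[OF that] W G N K by (simp add: L2 field_simps)
  next
    case False
    then have p: "power_II K P G i = P i" by (simp only: power_II_def if_False)
    show ?thesis
      unfolding p if_not_P[OF False] using \<alpha>(1)[OF that] W G N K by (simp add: L2 field_simps)
  qed
  \<comment> \<open>The received amplitudes are proportional to \<open>\<alpha> k\<close> and so
    unequal, but the alignment share \<open>w k / W\<close> is proportional to
    \<open>1 / \<alpha> k\<close>. Their product is the same for all targets, and \<open>W\<close>
    cancels against \<open>L2\<close>.\<close>
  have un2: "\<beta> k * sqrt (power_II K P G k) / lambda_II N K \<beta> P G * (real N * (pi / 4 * (weight_II \<beta> P k / W))) = 1 / real K"
    if "k \<in> targets K" for k
    unfolding L2_def[symmetric] a2[OF sub(1)[OF that]] using that \<alpha>(2)[OF sub(1)[OF that]] W N K by (simp add: weight field_simps)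
  have ph2: "phase_II K \<beta> P x y $ n = - Arg (cnj (x $ n)) + Arg (\<Sum>l\<in>targets K. complex_of_real (weight_II \<beta> P l) * cnj (y l $ n))"
    for x :: "complex ^ 'n" and y n
    by (simp add: phase_II_def)
  have "MSE \<Omega> K M \<beta> (power_II K P G) L2 (phase_II K \<beta> P) hp hr g gi z
    = (\<Sum>k\<in>targets K. 8 * (W\<^sup>2 / \<alpha> k powi (- 2)) / (pi\<^sup>2 * real N * (real K)\<^sup>2) * E k)
      + (8 - pi\<^sup>2) / (pi\<^sup>2 * real N * (real K)\<^sup>2) * ((\<Sum>k\<in>targets K. E k) + C)
      + (\<Sum>m\<in>interferers K M. 8 * G\<^sup>2 * W\<^sup>2 / (pi\<^sup>2 * real N * (real K)\<^sup>2 * \<alpha> m powi (- 2)))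
      + 8 * G\<^sup>2 * \<sigma>\<^sup>2 * real D * W\<^sup>2 / (pi\<^sup>2 * (real N)\<^sup>2 * (real K)\<^sup>2)"
  proof -
    have 1: "real N * (\<beta> k * sqrt (power_II K P G k) / L2)\<^sup>2 / 2 = 8 * (W\<^sup>2 / \<alpha> k powi (- 2)) / (pi\<^sup>2 * real N * (real K)\<^sup>2)"
      if "k \<in> targets K" for k
      unfolding a2[OF sub(1)[OF that]] inv2 using that N K
      by (simp add: power_divide power_mult_distrib field_simps power2_eq_square)
    have 2: "real N * (\<beta> m * sqrt (power_II K P G m) / L2)\<^sup>2 / 2 = 8 * G\<^sup>2 * W\<^sup>2 / (pi\<^sup>2 * real N * (real K)\<^sup>2 * \<alpha> m powi (- 2))"
      if "m \<in> interferers K M" for m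
      unfolding a2[OF sub(2)[OF that]] inv2 if_not_P[OF disj[OF that]] using \<alpha>(2)[OF sub(2)[OF that]] N K
      by (simp add: power_divide power_mult_distrib field_simps power2_eq_square)
    have 3: "\<sigma>\<^sup>2 * real D / (2 * L2\<^sup>2) = 8 * G\<^sup>2 * \<sigma>\<^sup>2 * real D * W\<^sup>2 / (pi\<^sup>2 * (real N)\<^sup>2 * (real K)\<^sup>2)"
      unfolding L2 using N K by (simp add: power_divide power_mult_distrib mult_ac)
    have "MSE \<Omega> K M \<beta> (power_II K P G) (lambda_II N K \<beta> P G) (phase_II K \<beta> P) hp hr g gi z
      = (\<Sum>k\<in>targets K. real N * (\<beta> k * sqrt (power_II K P G k) / lambda_II N K \<beta> P G)\<^sup>2 / 2 * (\<integral>\<omega>. (norm (g k \<omega>))\<^sup>2 \<partial>\<Omega>))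
        + (8 - pi\<^sup>2) / (pi\<^sup>2 * real N * (real K)\<^sup>2) * (\<Sum>k\<in>targets K. \<Sum>k'\<in>targets K. \<integral>\<omega>. g k \<omega> \<bullet> g k' \<omega> \<partial>\<Omega>)
        + (\<Sum>m\<in>interferers K M. real N * (\<beta> m * sqrt (power_II K P G m) / lambda_II N K \<beta> P G)\<^sup>2 / 2)
        + \<sigma>\<^sup>2 * real D / (2 * (lambda_II N K \<beta> P G)\<^sup>2)"
      by (rule aligned_unbiased_MSE(2)[where w="weight_II \<beta> P" and W=W]) (fact assms ph2 W W2 un2)+
    then show ?thesis
      by (simp only: L2_def[symmetric] diag E_def[symmetric] 1 2 3 cong: sum.cong)
  qed
  also have "(\<Sum>k\<in>targets K. 8 * (W\<^sup>2 / \<alpha> k powi (- 2)) / (pi\<^sup>2 * real N * (real K)\<^sup>2) * E k)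
      + (8 - pi\<^sup>2) / (pi\<^sup>2 * real N * (real K)\<^sup>2) * ((\<Sum>k\<in>targets K. E k) + C)
    = (\<Sum>k\<in>targets K. (8 * (W\<^sup>2 / \<alpha> k powi (- 2) + 1) - pi\<^sup>2) / (pi\<^sup>2 * real N * (real K)\<^sup>2) * E k)
      + (8 - pi\<^sup>2) / (pi\<^sup>2 * real N * (real K)\<^sup>2) * C"
  proof -
    have "8 * x / y + (8 - p) / y = (8 * (x + 1) - p) / y" for x y p :: real
      by (simp add: add_divide_distrib[symmetric] algebra_simps)
    then show ?thesis unfolding combine by (simp only:)
  qed
  finally have MSE_II: "MSE \<Omega> K M \<beta> (power_II K P G) L2 (phase_II K \<beta> P) hp hr g gi z
    = (\<Sum>k\<in>targets K. (8 * (W\<^sup>2 / \<alpha> k powi (- 2) + 1) - pi\<^sup>2) / (pi\<^sup>2 * real N * (real K)\<^sup>2) * E k)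
      + (8 - pi\<^sup>2) / (pi\<^sup>2 * real N * (real K)\<^sup>2) * C
      + (\<Sum>m\<in>interferers K M. 8 * G\<^sup>2 * W\<^sup>2 / (pi\<^sup>2 * real N * (real K)\<^sup>2 * \<alpha> m powi (- 2)))
      + 8 * G\<^sup>2 * \<sigma>\<^sup>2 * real D * W\<^sup>2 / (pi\<^sup>2 * (real N)\<^sup>2 * (real K)\<^sup>2)" .
  have int_II: "integrable \<Omega> (squared_error K M \<beta> (power_II K P G) (lambda_II N K \<beta> P G) (phase_II K \<beta> P) hp hr g gi z)"
    by (rule aligned_unbiased_MSE(1)[where w="weight_II \<beta> P" and W=W]) (fact assms ph2 W W2 un2)+
  show ?thesis
    unfolding \<mu>2 W\<alpha> E_def[symmetric] C_def[symmetric]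
    using int_I MSE_I[unfolded L1_def] int_II MSE_II[unfolded L2_def] by (intro conjI)
qed

end
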